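(* For every integer $d\ge 5$ the Hessian map $h_{d,1}:\Sigma(d,1)\dashrightarrow \Sigma(2d-4,1)$, $[f]\mapsto [f_{00}f_{11}-f_{01}^2]$, from binary forms of degree $d$ to binary forms of degree $2d-4$ (up to scalars), is birational onto its image (i.e., onto the closure of its image).
   Context: Work over an algebraically closed field $k$ of characteristic zero. $\Sigma(d,1)\cong\mathbb P^d$ is the projective space of nonzero homogeneous polynomials of degree $d$ in $x_0,x_1$ up to scalars. For such $f$, $f_{ij}=\partial^2 f/\partial x_i\partial x_j$, and $\operatorname{hess}(f)=f_{00}f_{11}-f_{01}^2$, a form of degree $2d-4$ (or zero). The Hessian map $h_{d,1}$ is the rational map $[f]\mapsto[\operatorname{hess}(f)]$, defined where $\operatorname{hess}(f)\not\equiv 0$. *)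

theory Defs
  imports
    "HOL-Analysis.Abstract_Topology"
    "HOL-Library.Poly_Mapping"
    "HOL-Computational_Algebra.Polynomial"
begin

text \<open>
  A polynomial over \<open>'k\<close> in variables indexed by \<open>'i\<close> is a finitely supported map from exponent
  vectors \<open>'i \<Rightarrow>\<^sub>0 nat\<close> to \<open>'k\<close>; the ring structure is the one of
  \<^theory>\<open>HOL-Library.Poly_Mapping\<close> (multiplication is convolution).
\<close>

type_synonym ('i, 'k) mpoly = "('i \<Rightarrow>\<^sub>0 nat) \<Rightarrow>\<^sub>0 'k"

definition monomials :: "'i set \<Rightarrow> nat \<Rightarrow> ('i \<Rightarrow>\<^sub>0 nat) set" where
  "monomials I e = {m. Poly_Mapping.keys m \<subseteq> I \<and>
     (\<Sum>i\<in>Poly_Mapping.keys m. Poly_Mapping.lookup m i) = e}"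

text \<open>The zero polynomial is a form of every degree.\<close>

definition forms :: "'i set \<Rightarrow> nat \<Rightarrow> ('i, 'k::zero) mpoly set" where
  "forms I e = {F. Poly_Mapping.keys F \<subseteq> monomials I e}"

definition mpoly_at :: "('i, 'k::comm_semiring_1) mpoly \<Rightarrow> ('i \<Rightarrow>\<^sub>0 'k) \<Rightarrow> 'k" where
  "mpoly_at F v = (\<Sum>m\<in>Poly_Mapping.keys F. Poly_Mapping.lookup F m *
     (\<Prod>i\<in>Poly_Mapping.keys m. Poly_Mapping.lookup v i ^ Poly_Mapping.lookup m i))"

definition pdiff :: "'i \<Rightarrow> ('i, 'k::semiring_1) mpoly \<Rightarrow> ('i, 'k) mpoly" where
  "pdiff i F = (\<Sum>m\<in>Poly_Mapping.keys F. Poly_Mapping.single (m - Poly_Mapping.single i 1)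
     (of_nat (Poly_Mapping.lookup m i) * Poly_Mapping.lookup F m))"

text \<open>
  For a finite index set \<open>I\<close>, \<open>proj_space I\<close> is the projective space of lines in \<open>k\<^sup>I\<close>, a vector
  of \<open>k\<^sup>I\<close> being a finitely supported map whose support lies in \<open>I\<close>.  A point is the set of all
  its homogeneous coordinate vectors.
\<close>

type_synonym ('i, 'k) point = "('i \<Rightarrow>\<^sub>0 'k) set"

definition proj_point :: "('i \<Rightarrow>\<^sub>0 'k::field) \<Rightarrow> ('i, 'k) point" where
  "proj_point v = {Poly_Mapping.map ((*) c) v |c. c \<noteq> 0}"

definition proj_space :: "'i set \<Rightarrow> ('i, 'k::field) point set" where
  "proj_space I = {proj_point v |v. v \<noteq> 0 \<and> Poly_Mapping.keys v \<subseteq> I}"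

definition zero_locus :: "'i set \<Rightarrow> ('i, 'k::field) mpoly set \<Rightarrow> ('i, 'k) point set" where
  "zero_locus I S = {p \<in> proj_space I. \<forall>v\<in>p. \<forall>F\<in>S. mpoly_at F v = 0}"

definition zariski :: "'i set \<Rightarrow> ('i, 'k::field) point topology" where
  "zariski I = topology (\<lambda>U. \<exists>S \<subseteq> (\<Union>e. forms I e). U = proj_space I - zero_locus I S)"

definition irreducible_in :: "'a topology \<Rightarrow> 'a set \<Rightarrow> bool" where
  "irreducible_in T X \<longleftrightarrow> X \<noteq> {} \<and> X \<subseteq> topspace T \<and>
     (\<forall>A B. closedin T A \<and> closedin T B \<and> X \<subseteq> A \<union> B \<longrightarrow> X \<subseteq> A \<or> X \<subseteq> B)"

definition proj_variety :: "'i set \<Rightarrow> ('i, 'k::field) point set \<Rightarrow> bool" where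
  "proj_variety I X \<longleftrightarrow> finite I \<and> closedin (zariski I) X \<and> irreducible_in (zariski I) X"

text \<open>
  \<open>g\<close> is a regular map from the locally closed set \<open>U\<close> of \<open>proj_space I\<close> to \<open>proj_space J\<close>:
  locally it is given by a tuple of forms of one and the same degree without common zeros.
\<close>

definition regular_map ::
  "'i set \<Rightarrow> ('i, 'k::field) point set \<Rightarrow> 'j set \<Rightarrow> (('i, 'k) point \<Rightarrow> ('j, 'k) point) \<Rightarrow> bool" where
  "regular_map I U J g \<longleftrightarrow>
     (\<forall>p\<in>U. \<exists>W. openin (subtopology (zariski I) U) W \<and> p \<in> W \<and>
       (\<exists>e F. (\<forall>j\<in>J. F j \<in> forms I e) \<and>
          (\<forall>q\<in>W. \<forall>v\<in>q. (\<exists>j\<in>J. mpoly_at (F j) v \<noteq> 0) \<and>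
             g q = proj_point (\<Sum>j\<in>J. Poly_Mapping.single j (mpoly_at (F j) v)))))"

text \<open>
  A rational map from the variety \<open>X\<close> to the variety \<open>Y\<close> is represented by a pair \<open>(U, g)\<close>, where
  \<open>g\<close> is a regular map to \<open>Y\<close> on the nonempty open subset \<open>U\<close> of \<open>X\<close>; values of \<open>g\<close> outside \<open>U\<close>
  are irrelevant.  Two representatives define the same rational map if they agree on the
  intersection of their domains.
\<close>

definition rational_map ::
  "'i set \<Rightarrow> ('i, 'k::field) point set \<Rightarrow> 'j set \<Rightarrow> ('j, 'k) point set \<Rightarrow>
   ('i, 'k) point set \<Rightarrow> (('i, 'k) point \<Rightarrow> ('j, 'k) point) \<Rightarrow> bool" where
  "rational_map I X J Y U g \<longleftrightarrow> proj_variety I X \<and> proj_variety J Y \<and>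
     openin (subtopology (zariski I) X) U \<and> U \<noteq> {} \<and> g ` U \<subseteq> Y \<and> regular_map I U J g"

definition dominant_map ::
  "'i set \<Rightarrow> ('i, 'k::field) point set \<Rightarrow> 'j set \<Rightarrow> ('j, 'k) point set \<Rightarrow>
   ('i, 'k) point set \<Rightarrow> (('i, 'k) point \<Rightarrow> ('j, 'k) point) \<Rightarrow> bool" where
  "dominant_map I X J Y U g \<longleftrightarrow>
     rational_map I X J Y U g \<and> zariski J closure_of (g ` U) = Y"

text \<open>
  A birational map has an inverse among dominant rational maps: both compositions, which are
  defined on \<open>{p \<in> U. g p \<in> V}\<close> and \<open>{q \<in> V. h q \<in> U}\<close> (nonempty open sets by dominance), represent
  the identity.
\<close>

definition birational_map ::
  "'i set \<Rightarrow> ('i, 'k::field) point set \<Rightarrow> 'j set \<Rightarrow> ('j, 'k) point set \<Rightarrow>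
   ('i, 'k) point set \<Rightarrow> (('i, 'k) point \<Rightarrow> ('j, 'k) point) \<Rightarrow> bool" where
  "birational_map I X J Y U g \<longleftrightarrow> dominant_map I X J Y U g \<and>
     (\<exists>V h. dominant_map J Y I X V h \<and>
        (\<forall>p\<in>U. g p \<in> V \<longrightarrow> h (g p) = p) \<and>
        (\<forall>q\<in>V. h q \<in> U \<longrightarrow> g (h q) = q))"

definition birational_onto_image ::
  "'i set \<Rightarrow> ('i, 'k::field) point set \<Rightarrow> 'j set \<Rightarrow> ('j, 'k) point set \<Rightarrow>
   ('i, 'k) point set \<Rightarrow> (('i, 'k) point \<Rightarrow> ('j, 'k) point) \<Rightarrow> bool" where
  "birational_onto_image I X J Y U g \<longleftrightarrow> rational_map I X J Y U g \<and>
     birational_map I X J (zariski J closure_of (g ` U)) U g"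

text \<open>
  Forms of degree \<open>d\<close> in \<open>x\<^sub>0, \<dots>, x\<^sub>n\<close> up to scalars.  The homogeneous coordinates of a form are
  its coefficients, so the index set is the set of monomials of degree \<open>d\<close>.
\<close>

abbreviation form_coords :: "nat \<Rightarrow> nat \<Rightarrow> (nat \<Rightarrow>\<^sub>0 nat) set" where
  "form_coords d n \<equiv> monomials {..n} d"

definition Sigma_space :: "nat \<Rightarrow> nat \<Rightarrow> (nat \<Rightarrow>\<^sub>0 nat, 'k::field) point set" where
  "Sigma_space d n = proj_space (form_coords d n)"

definition hess :: "(nat, 'k::comm_ring_1) mpoly \<Rightarrow> (nat, 'k) mpoly" where
  "hess f = pdiff 0 (pdiff 0 f) * pdiff 1 (pdiff 1 f) - (pdiff 0 (pdiff 1 f))\<^sup>2"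

definition hessian_domain :: "nat \<Rightarrow> (nat \<Rightarrow>\<^sub>0 nat, 'k::field) point set" where
  "hessian_domain d = {p \<in> Sigma_space d 1. \<forall>f\<in>p. hess f \<noteq> 0}"

text \<open>Independent of the chosen representative, see lemma \<open>hessian_map_proj_point\<close>.\<close>

definition hessian_map ::
  "(nat \<Rightarrow>\<^sub>0 nat, 'k::field) point \<Rightarrow> (nat \<Rightarrow>\<^sub>0 nat, 'k) point" where
  "hessian_map p = proj_point (hess (SOME f. f \<in> p))"

lemma lookup_scale:
  "Poly_Mapping.lookup (Poly_Mapping.map ((*) c) v) i = (c::'k::field) * Poly_Mapping.lookup v i"
  by (simp add: map.rep_eq when_def)

lemma keys_scale:
  "c \<noteq> 0 \<Longrightarrow> Poly_Mapping.keys (Poly_Mapping.map ((*) (c::'k::field)) v) = Poly_Mapping.keys v"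
  by (auto simp: in_keys_iff lookup_scale)

lemma scale_scale_mapping:
  "Poly_Mapping.map ((*) (a::'k::field)) (Poly_Mapping.map ((*) b) v) = Poly_Mapping.map ((*) (a * b)) v"
  by (rule poly_mapping_eqI) (simp add: lookup_scale)

lemma proj_point_self: "v \<in> proj_point v"
  unfolding proj_point_def
  by (auto intro!: exI[of _ 1] poly_mapping_eqI simp: lookup_scale)

lemma proj_point_scale:
  assumes "c \<noteq> 0"
  shows "proj_point (Poly_Mapping.map ((*) c) v) = proj_point v"
proof -
  have "Poly_Mapping.map ((*) a) v \<in> proj_point (Poly_Mapping.map ((*) c) v)" if "a \<noteq> 0" for a
    unfolding proj_point_def using assms that
    by (auto simp: scale_scale_mapping intro!: exI[of _ "a / c"])
  moreover have "Poly_Mapping.map ((*) a) (Poly_Mapping.map ((*) c) v) \<in> proj_point v" if "a \<noteq> 0" for a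
    unfolding proj_point_def using assms that
    by (auto simp: scale_scale_mapping intro!: exI[of _ "a * c"])
  ultimately show ?thesis
    by (auto simp: proj_point_def)
qed

lemma pdiff_scale:
  assumes "c \<noteq> (0::'k::field)"
  shows "pdiff i (Poly_Mapping.map ((*) c) F) = Poly_Mapping.map ((*) c) (pdiff i F)"
proof -
  have "Poly_Mapping.map ((*) c) (pdiff i F) = Poly_Mapping.single 0 c * pdiff i F"
    by (rule mult_map_scale_conv_mult)
  also have "\<dots> = pdiff i (Poly_Mapping.map ((*) c) F)"
    unfolding pdiff_def keys_scale[OF assms] sum_distrib_left
    by (simp add: lookup_scale mult_single mult.left_commute)
  finally show ?thesis by simp
qed

lemma hess_scale:
  assumes "c \<noteq> (0::'k::field)"
  shows "hess (Poly_Mapping.map ((*) c) f) = Poly_Mapping.map ((*) (c\<^sup>2)) (hess f)"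
proof -
  have c: "Poly_Mapping.single 0 (c\<^sup>2) = (Poly_Mapping.single 0 c)\<^sup>2"
    by (simp add: power2_eq_square mult_single)
  show ?thesis
    unfolding hess_def pdiff_scale[OF assms]
    unfolding mult_map_scale_conv_mult c
    by (simp only: power2_eq_square right_diff_distrib ac_simps)
qed

lemma hessian_map_proj_point: "hessian_map (proj_point f) = proj_point (hess f)"
proof -
  have "(SOME g. g \<in> proj_point f) \<in> proj_point f"
    using proj_point_self by (rule someI)
  then obtain c where "c \<noteq> 0" "(SOME g. g \<in> proj_point f) = Poly_Mapping.map ((*) c) f"
    by (auto simp: proj_point_def)
  then show ?thesis
    by (simp add: hessian_map_def hess_scale proj_point_scale)
qed

lemma mpoly_at_scale:
  assumes "F \<in> forms I e"
  shows "mpoly_at F (Poly_Mapping.map ((*) (c::'k::field)) v) = c ^ e * mpoly_at F v"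
proof -
  have "(\<Prod>i\<in>Poly_Mapping.keys m. (c * Poly_Mapping.lookup v i) ^ Poly_Mapping.lookup m i) =
      c ^ e * (\<Prod>i\<in>Poly_Mapping.keys m. Poly_Mapping.lookup v i ^ Poly_Mapping.lookup m i)"
    if "m \<in> Poly_Mapping.keys F" for m
  proof -
    have "(\<Sum>i\<in>Poly_Mapping.keys m. Poly_Mapping.lookup m i) = e"
      using assms that by (auto simp: forms_def monomials_def)
    then show ?thesis
      by (simp add: power_mult_distrib prod.distrib flip: power_sum)
  qed
  then show ?thesis
    unfolding mpoly_at_def lookup_scale sum_distrib_left
    by (intro sum.cong) (simp_all add: algebra_simps)
qed

lemma prod_keys_superset:
  assumes "finite A" "Poly_Mapping.keys m \<subseteq> A"
  shows "(\<Prod>i\<in>Poly_Mapping.keys m. (x i :: 'k::comm_semiring_1) ^ Poly_Mapping.lookup m i) =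
    (\<Prod>i\<in>A. x i ^ Poly_Mapping.lookup m i)"
  by (rule prod.mono_neutral_left) (use assms in \<open>auto simp: in_keys_iff\<close>)

lemma mpoly_at_add: "mpoly_at (F + G) v = mpoly_at F v + mpoly_at G v"
  unfolding mpoly_at_def by (rule setsum_keys_plus_distrib) (simp_all add: algebra_simps)

lemma mpoly_at_sum: "mpoly_at (sum F A) v = (\<Sum>a\<in>A. mpoly_at (F a) v)"
  by (induction A rule: infinite_finite_induct) (simp_all add: mpoly_at_add, simp_all add: mpoly_at_def)

lemma mpoly_at_single:
  "mpoly_at (Poly_Mapping.single m a) v =
    a * (\<Prod>i\<in>Poly_Mapping.keys m. Poly_Mapping.lookup v i ^ Poly_Mapping.lookup m i)"
  by (simp add: mpoly_at_def)

lemma sum_single_keys: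
  "(\<Sum>m\<in>Poly_Mapping.keys F. Poly_Mapping.single m (Poly_Mapping.lookup F m)) = F"
  by (rule poly_mapping_eqI) (auto simp: lookup_sum lookup_single when_def in_keys_iff)

lemma mpoly_at_mult: "mpoly_at (F * G) v = mpoly_at F v * mpoly_at G v"
proof -
  let ?e = "\<lambda>m. \<Prod>i\<in>Poly_Mapping.keys m. Poly_Mapping.lookup v i ^ Poly_Mapping.lookup m i"
  have e: "?e (m + n) = ?e m * ?e n" for m n
  proof -
    let ?A = "Poly_Mapping.keys m \<union> Poly_Mapping.keys n"
    have "Poly_Mapping.keys (m + n) \<subseteq> ?A"
      by (rule keys_add)
    then show ?thesis
      by (subst (1 2 3) prod_keys_superset[of ?A])
         (auto simp: lookup_add power_add prod.distrib)
  qed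
  have "F * G = (\<Sum>m\<in>Poly_Mapping.keys F. \<Sum>n\<in>Poly_Mapping.keys G.
      Poly_Mapping.single (m + n) (Poly_Mapping.lookup F m * Poly_Mapping.lookup G n))"
    using arg_cong2[OF sum_single_keys[of F] sum_single_keys[of G], of "(*)"]
    by (simp add: sum_product mult_single)
  then have "mpoly_at (F * G) v = (\<Sum>m\<in>Poly_Mapping.keys F. \<Sum>n\<in>Poly_Mapping.keys G.
      Poly_Mapping.lookup F m * Poly_Mapping.lookup G n * ?e (m + n))"
    by (simp add: mpoly_at_sum mpoly_at_single)
  also have "\<dots> = mpoly_at F v * mpoly_at G v"
    unfolding mpoly_at_def sum_product e by (intro sum.cong) (simp_all add: algebra_simps)
  finally show ?thesis .
qed

lemma monomials_add:
  assumes "m \<in> monomials I a" "n \<in> monomials I b"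
  shows "m + n \<in> monomials I (a + b)"
proof -
  let ?A = "Poly_Mapping.keys m \<union> Poly_Mapping.keys n"
  have s: "(\<Sum>i\<in>Poly_Mapping.keys k. Poly_Mapping.lookup k i) = (\<Sum>i\<in>?A. Poly_Mapping.lookup k i)"
    if "Poly_Mapping.keys k \<subseteq> ?A" for k :: "'a \<Rightarrow>\<^sub>0 nat"
    by (rule sum.mono_neutral_left) (use that in \<open>auto simp: in_keys_iff\<close>)
  have "Poly_Mapping.keys (m + n) \<subseteq> ?A"
    by (rule keys_add)
  then show ?thesis
    using assms s[of m] s[of n] s[of "m + n"]
    by (auto simp: monomials_def lookup_add sum.distrib)
qed

lemma forms_mult:
  assumes "F \<in> forms I a" "G \<in> forms I b"
  shows "F * G \<in> forms I (a + b)"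
  using assms keys_mult[of F G] monomials_add[of _ I a _ b] unfolding forms_def by blast

lemma zero_locus_products:
  assumes A: "A \<subseteq> (\<Union>e. forms I e)" and B: "B \<subseteq> (\<Union>e. forms I e)"
  shows "zero_locus I {F * G |F G. F \<in> A \<and> G \<in> B} = zero_locus I A \<union> zero_locus I B"
    (is "zero_locus I ?S = _")
proof (intro subset_antisym subsetI)
  fix p assume p: "p \<in> zero_locus I ?S"
  show "p \<in> zero_locus I A \<union> zero_locus I B"
  proof (rule ccontr)
    assume n: "p \<notin> zero_locus I A \<union> zero_locus I B"
    have P: "p \<in> proj_space I"
      using p by (simp add: zero_locus_def)
    from n P obtain v F where v: "v \<in> p" "F \<in> A" "mpoly_at F v \<noteq> 0"
      by (auto simp: zero_locus_def)
    from n P obtain w G where w: "w \<in> p" "G \<in> B" "mpoly_at G w \<noteq> 0"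
      by (auto simp: zero_locus_def)
    from P obtain u where u: "p = proj_point u"
      by (auto simp: proj_space_def)
    from v(1) u obtain a where a: "a \<noteq> 0" "v = Poly_Mapping.map ((*) a) u"
      by (auto simp: proj_point_def)
    from w(1) u obtain b where b: "b \<noteq> 0" "w = Poly_Mapping.map ((*) b) u"
      by (auto simp: proj_point_def)
    from w(2) B obtain e where e: "G \<in> forms I e"
      by auto
    have wv: "w = Poly_Mapping.map ((*) (b / a)) v"
      using a(1) unfolding a(2) b(2) by (simp add: scale_scale_mapping)
    have "mpoly_at G v \<noteq> 0"
      using w(3) unfolding wv mpoly_at_scale[OF e] by simp
    then have "mpoly_at (F * G) v \<noteq> 0"
      using v(3) by (simp add: mpoly_at_mult)
    moreover have "F * G \<in> ?S"
      using v(2) w(2) by auto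
    ultimately show False
      using p v(1) unfolding zero_locus_def by blast
  qed
next
  fix p assume "p \<in> zero_locus I A \<union> zero_locus I B"
  then show "p \<in> zero_locus I ?S"
    by (auto simp: zero_locus_def mpoly_at_mult)
qed

lemma istopology_zariski:
  "istopology (\<lambda>U::('i, 'k::field) point set.
     \<exists>S \<subseteq> (\<Union>e. forms I e). U = proj_space I - zero_locus I S)"
  (is "istopology ?open")
  unfolding istopology_def
proof (intro conjI allI impI)
  let ?H = "\<Union>e. forms I e :: ('i, 'k) mpoly set"
  fix U V assume "?open U" "?open V"
  then obtain A B where A: "A \<subseteq> ?H" "U = proj_space I - zero_locus I A"
    and B: "B \<subseteq> ?H" "V = proj_space I - zero_locus I B"
    by auto
  have "{F * G |F G. F \<in> A \<and> G \<in> B} \<subseteq> ?H"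
  proof
    fix P assume "P \<in> {F * G |F G. F \<in> A \<and> G \<in> B}"
    then obtain F G where P: "P = F * G" "F \<in> A" "G \<in> B"
      by auto
    have "F \<in> ?H" "G \<in> ?H"
      using subsetD[OF A(1) P(2)] subsetD[OF B(1) P(3)] .
    then obtain a b where "F \<in> forms I a" "G \<in> forms I b"
      by (elim UN_E)
    then have "P \<in> forms I (a + b)"
      unfolding P(1) by (rule forms_mult)
    then show "P \<in> ?H"
      by blast
  qed
  moreover have "U \<inter> V = proj_space I - zero_locus I {F * G |F G. F \<in> A \<and> G \<in> B}"
    unfolding zero_locus_products[OF A(1) B(1)] A(2) B(2) by blast
  ultimately show "?open (U \<inter> V)"
    by (intro exI conjI)
next
  let ?H = "\<Union>e. forms I e :: ('i, 'k) mpoly set"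
  fix K assume "\<forall>U\<in>K. ?open U"
  then obtain s where s: "\<forall>U\<in>K. s U \<subseteq> ?H \<and> U = proj_space I - zero_locus I (s U)"
    unfolding bchoice_iff by blast
  have "\<Union>K = (\<Union>U\<in>K. proj_space I - zero_locus I (s U))"
    using s by auto
  also have "\<dots> = proj_space I - zero_locus I (\<Union>U\<in>K. s U)"
    unfolding zero_locus_def by blast
  finally have "\<Union>K = proj_space I - zero_locus I (\<Union>U\<in>K. s U)" .
  moreover have "(\<Union>U\<in>K. s U) \<subseteq> ?H"
    using s by (intro UN_least) simp
  ultimately show "?open (\<Union>K)"
    by (intro exI conjI)
qed

lemma openin_zariski:
  "openin (zariski I) U \<longleftrightarrow> (\<exists>S \<subseteq> (\<Union>e. forms I e). U = proj_space I - zero_locus I S)"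
  unfolding zariski_def by (simp only: topology_inverse'[OF istopology_zariski])

lemma topspace_zariski: "topspace (zariski I) = (proj_space I :: ('i, 'k::field) point set)"
proof -
  have "1 \<in> forms I 0"
    by (simp add: forms_def monomials_def)
  moreover have "zero_locus I {1} = ({} :: ('i, 'k) point set)"
    by (auto simp: zero_locus_def proj_space_def mpoly_at_def intro: proj_point_self)
  ultimately have "openin (zariski I) (proj_space I :: ('i, 'k) point set)"
    unfolding openin_zariski by (intro exI[of _ "{1}"]) auto
  moreover have "U \<subseteq> proj_space I" if "openin (zariski I) U" for U :: "('i, 'k) point set"
    using that unfolding openin_zariski by blast
  ultimately show ?thesis
    by (meson openin_subset openin_topspace subset_antisym)
qed

lemma closedin_zariski:
  "closedin (zariski I) Z \<longleftrightarrow> (\<exists>S \<subseteq> (\<Union>e. forms I e). Z = zero_locus I S)"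
proof -
  have "zero_locus I S \<subseteq> proj_space I" for S :: "('a, 'b) mpoly set"
    by (auto simp: zero_locus_def)
  then show ?thesis
    unfolding closedin_def openin_zariski topspace_zariski
    by (metis double_diff subset_refl)
qed

end

theory Submission
  imports Defs "HOL-Computational_Algebra.Fraction_Field"
begin

text \<open>
  Let \<open>f\<close> be the generic form with coefficients \<open>b\<^sub>i\<close> in \<open>L = k(b\<^sub>0, \<dots>, b\<^sub>d)\<close>, and let \<open>R \<subseteq> L\<close> be the
  local ring of the rational functions \<open>P(hess f) / Q(hess f)\<close>, with \<open>P\<close> and \<open>Q\<close> forms of the same
  degree, which are defined at the special form \<open>f\<^sub>0 = x\<^sup>a y\<^sup>d\<^sup>-\<^sup>a + x\<^sup>d\<^sup>-\<^sup>a y\<^sup>a\<close>, \<open>a = (d - 1) div 2\<close>. It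
  suffices to show that the ratios \<open>b\<^sub>i / b\<^sub>a\<close> belong to \<open>R\<close>: clearing denominators gives forms which
  recover \<open>f\<close> from \<open>hess f\<close>.

  By the valuative criterion the \<open>b\<^sub>i / b\<^sub>a\<close> are integral over \<open>R\<close> once every place of \<open>L\<close> that dominates
  \<open>R\<close> takes them to the coefficients of \<open>f\<^sub>0\<close>. Normalize \<open>f\<close> at such a place. If the reduction has a nonzero
  Hessian, then this Hessian is proportional to that of \<open>f\<^sub>0\<close>, and a comparison of coefficients shows that
  the reduction is proportional to \<open>f\<^sub>0\<close>. Otherwise the reduction is the \<open>d\<close>-th power of a linear form
  \<open>l\<close>, and the leading part of \<open>hess f\<close>, hence \<open>hess f\<^sub>0\<close>, is divisible by \<open>l\<^sup>d\<^sup>-\<^sup>2\<close>, which is not the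
  case. Finally, the differential of the Hessian map is injective at \<open>f\<^sub>0\<close>, so Nakayama's lemma turns
  integrality into membership in \<open>R\<close>.
\<close>

section \<open>Extension of places\<close>

text \<open>A single reduced point as fibre does not bound the degree of a rational map: further
  preimages of nearby points may run into the indeterminacy locus, here the d-th powers of linear
  forms. The places exclude this; they play the part of properness over the chosen point. They send
  the differences t_i between b_i / b_a and the coefficients of f_0 to 0, not merely to finite
  values, so the integral equations of the t_i have all lower coefficients in the maximal ideal of
  R. Modulo that ideal the t_i are nilpotent. Injectivity of the differential puts each t_i into the
  square of the ideal generated by all of them, again modulo the maximal ideal, and Nakayama applies
  without R being known to be noetherian or normal. The bound d >= 5 enters through a >= 2, which
  lets the two expansions of a form at 0 and at infinity overlap, and through 2 < d - 2, which keeps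
  the root multiplicities of hess f_0 below d - 2. The strict inequality 2 a < d keeps the two terms
  of f_0 distinct.\<close>

lemma poly_as_sum_upto:
  fixes p :: "'a::comm_semiring_1 poly"
  assumes "degree p \<le> n"
  shows "poly p x = (\<Sum>i\<le>n. coeff p i * x ^ i)"
  unfolding poly_altdef
  by (rule sum.mono_neutral_left) (use assms in \<open>auto simp: coeff_eq_0\<close>)

text \<open>A ring homomorphism defined on a subring of a field is represented by its graph; the last
  condition says that the graph is single-valued.\<close>

definition hom_graph :: "('a::field \<times> 'b::field) set \<Rightarrow> bool" where
  "hom_graph G \<longleftrightarrow> (1, 1) \<in> G \<and>
     (\<forall>x u y v. (x, u) \<in> G \<longrightarrow> (y, v) \<in> G \<longrightarrow> (x - y, u - v) \<in> G \<and> (x * y, u * v) \<in> G) \<and>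
     (\<forall>u. (0, u) \<in> G \<longrightarrow> u = 0)"

text \<open>The domain is a local ring whose maximal ideal is the kernel
  \<open>{x. (x, 0) \<in> G}\<close>. Inclusion of such graphs is domination of local rings: the
  larger one extends the ring and keeps the residues.\<close>

definition local_graph :: "('a::field \<times> 'b::field) set \<Rightarrow> bool" where
  "local_graph G \<longleftrightarrow> hom_graph G \<and> (\<forall>x u. (x, u) \<in> G \<longrightarrow> u \<noteq> 0 \<longrightarrow> (inverse x, inverse u) \<in> G)"

text \<open>A pole is expressed through the value 0 of the inverse, so no point at infinity has to
  be adjoined to the residue field.\<close>

definition place_graph :: "('a::field \<times> 'b::field) set \<Rightarrow> bool" where
  "place_graph G \<longleftrightarrow> local_graph G \<and> (\<forall>x. (\<exists>u. (x, u) \<in> G) \<or> (inverse x, 0) \<in> G)"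

text \<open>Coefficientwise reduction. A pair \<open>(p, 1)\<close> means that \<open>p\<close> is 1
  up to coefficients in the kernel; if such a \<open>p\<close> has the root x, then 1 lies in the
  ideal that the kernel generates after adjoining x.\<close>

definition poly_graph :: "('a::field \<times> 'b::field) set \<Rightarrow> ('a poly \<times> 'b poly) set" where
  "poly_graph G = {(p, q). \<forall>i. (coeff p i, coeff q i) \<in> G}"

context
  fixes G :: "('a::field \<times> 'b::field) set"
  assumes G: "hom_graph G"
begin

lemma graph_one: "(1, 1) \<in> G"
  using G by (simp add: hom_graph_def)

lemma graph_diff: "(x, u) \<in> G \<Longrightarrow> (y, v) \<in> G \<Longrightarrow> (x - y, u - v) \<in> G"
  using G by (simp add: hom_graph_def)

lemma graph_mult: "(x, u) \<in> G \<Longrightarrow> (y, v) \<in> G \<Longrightarrow> (x * y, u * v) \<in> G"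
  using G by (simp add: hom_graph_def)

lemma graph_zero_unique: "(0, u) \<in> G \<Longrightarrow> u = 0"
  using G by (simp add: hom_graph_def)

lemma graph_zero: "(0, 0) \<in> G"
  using graph_diff[OF graph_one graph_one] by simp

lemma graph_uminus: "(x, u) \<in> G \<Longrightarrow> (- x, - u) \<in> G"
  using graph_diff[OF graph_zero] by force

lemma graph_add: "(x, u) \<in> G \<Longrightarrow> (y, v) \<in> G \<Longrightarrow> (x + y, u + v) \<in> G"
  using graph_diff[OF _ graph_uminus] by force

lemma graph_unique: "(x, u) \<in> G \<Longrightarrow> (x, v) \<in> G \<Longrightarrow> u = v"
  using graph_diff[of x u x v] graph_zero_unique[of "u - v"] by simp

lemma graph_nonzero: "(x, u) \<in> G \<Longrightarrow> u \<noteq> 0 \<Longrightarrow> x \<noteq> 0"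
  using graph_zero_unique by blast

lemma graph_power: "(x, u) \<in> G \<Longrightarrow> (x ^ n, u ^ n) \<in> G"
  by (induction n) (auto intro: graph_one graph_mult)

lemma graph_sum:
  "(\<And>i. i \<in> A \<Longrightarrow> (f i, g i) \<in> G) \<Longrightarrow> (sum f A, sum g A) \<in> G"
  by (induction A rule: infinite_finite_induct) (auto intro: graph_zero graph_add)

lemma graph_of_nat: "(of_nat n, of_nat n) \<in> G"
  by (induction n) (auto intro: graph_zero graph_one graph_add)

lemma graph_of_int: "(of_int n, of_int n) \<in> G"
  by (cases n) (auto intro: graph_of_nat graph_uminus simp del: of_nat_Suc)

lemma poly_graph_const: "(x, u) \<in> G \<Longrightarrow> ([:x:], [:u:]) \<in> poly_graph G"
  by (auto simp: poly_graph_def coeff_pCons split: nat.split intro: graph_zero)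

lemma poly_graph_X: "([:0, 1:], [:0, 1:]) \<in> poly_graph G"
  by (auto simp: poly_graph_def coeff_pCons split: nat.split intro: graph_zero graph_one)

lemma poly_graph_monom: "(x, u) \<in> G \<Longrightarrow> (monom x n, monom u n) \<in> poly_graph G"
  by (auto simp: poly_graph_def intro: graph_zero)

lemma poly_graph_diff:
  "(p, q) \<in> poly_graph G \<Longrightarrow> (p', q') \<in> poly_graph G \<Longrightarrow> (p - p', q - q') \<in> poly_graph G"
  by (auto simp: poly_graph_def intro: graph_diff)

lemma poly_graph_mult:
  "(p, q) \<in> poly_graph G \<Longrightarrow> (p', q') \<in> poly_graph G \<Longrightarrow> (p * p', q * q') \<in> poly_graph G"
  by (auto simp: poly_graph_def coeff_mult intro!: graph_sum graph_mult)

end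

lemma local_graph_hom: "local_graph G \<Longrightarrow> hom_graph G"
  by (simp add: local_graph_def)

lemma local_graph_inverse: "local_graph G \<Longrightarrow> (x, u) \<in> G \<Longrightarrow> u \<noteq> 0 \<Longrightarrow> (inverse x, inverse u) \<in> G"
  by (simp add: local_graph_def)

lemma local_graph_divide:
  "local_graph G \<Longrightarrow> (x, u) \<in> G \<Longrightarrow> (y, v) \<in> G \<Longrightarrow> v \<noteq> 0 \<Longrightarrow> (x / y, u / v) \<in> G"
  using local_graph_inverse by (metis divide_inverse graph_mult local_graph_hom)

lemma place_graph_local: "place_graph G \<Longrightarrow> local_graph G"
  by (simp add: place_graph_def)

text \<open>A homomorphism into an algebraically closed field extends to \<open>x\<close> unless the ideal generated
  by its kernel in the enlarged ring is trivial: the polynomials satisfied by \<open>x\<close> are mapped to an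
  ideal of polynomials over the residue field, any common root of which is a possible value.\<close>

lemma hom_graph_extend_elem:
  fixes G :: "('a::field \<times> 'b::alg_closed_field) set"
  assumes G: "local_graph G" and triv: "\<nexists>p. (p, 1) \<in> poly_graph G \<and> poly p x = 0"
  shows "\<exists>\<xi> G'. hom_graph G' \<and> G \<subseteq> G' \<and> (x, \<xi>) \<in> G'"
proof -
  note hG = local_graph_hom[OF G]
  define I where "I = {q. \<exists>p. (p, q) \<in> poly_graph G \<and> poly p x = 0}"
  have I_diff: "q - q' \<in> I" if "q \<in> I" "q' \<in> I" for q q'
    using that poly_graph_diff[OF hG] unfolding I_def by fastforce
  have I_mult: "q * q' \<in> I" if "q \<in> I" "(p', q') \<in> poly_graph G" for q q' p'
    using that poly_graph_mult[OF hG] unfolding I_def by fastforce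
  obtain \<xi> where \<xi>: "poly q \<xi> = 0" if "q \<in> I" for q
  proof (cases "I \<subseteq> {0}")
    case True
    have "poly q 0 = 0" if "q \<in> I" for q using True that by auto
    then show ?thesis by (rule that)
  next
    case False
    then obtain q1 where "q1 \<in> I \<and> q1 \<noteq> 0" by auto
    then obtain q0 where q0: "q0 \<in> I" "q0 \<noteq> 0"
      and min: "\<And>q. q \<in> I \<Longrightarrow> q \<noteq> 0 \<Longrightarrow> degree q0 \<le> degree q"
      using ex_has_least_nat[of "\<lambda>q. q \<in> I \<and> q \<noteq> 0" q1 degree] by blast
    obtain p0 where p0: "(p0, q0) \<in> poly_graph G" "poly p0 x = 0"
      using q0(1) by (auto simp: I_def)
    let ?n = "degree q0"
    \<comment> \<open>Locality makes the leading coefficient of the lift \<open>p0\<close>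
      invertible as well, so division with remainder by \<open>q0\<close> can be carried out on
      lifts and stays in \<open>I\<close>.\<close>
    have lead: "(inverse (coeff p0 ?n), inverse (coeff q0 ?n)) \<in> G"
      using p0(1) q0(2) local_graph_inverse[OF G] by (auto simp: poly_graph_def)
    have "?n > 0"
    proof (rule ccontr)
      assume "\<not> ?n > 0"
      then obtain u where u: "q0 = [:u:]" by (meson degree_eq_zeroE gr0I)
      then have "u \<noteq> 0" using q0(2) by auto
      have "(p0 * [:inverse (coeff p0 0):], q0 * [:inverse (coeff q0 0):]) \<in> poly_graph G"
        using p0(1) lead u by (intro poly_graph_mult[OF hG] poly_graph_const[OF hG]) auto
      moreover have "q0 * [:inverse (coeff q0 0):] = 1"
        using u \<open>u \<noteq> 0\<close> by simp
      ultimately show False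
        using triv p0(2) by (metis mult_zero_left poly_mult)
    qed
    then obtain \<xi> where \<xi>: "poly q0 \<xi> = 0"
      using alg_closed_imp_poly_has_root by blast
    have "poly q \<xi> = 0" if "q \<in> I" for q
      using that
    proof (induction "degree q" arbitrary: q rule: less_induct)
      case less
      show ?case
      proof (cases "q = 0")
        case False
        obtain p where p: "(p, q) \<in> poly_graph G"
          using less.prems by (auto simp: I_def)
        have le: "?n \<le> degree q" using min less.prems False by blast
        define c where "c = coeff q (degree q) * inverse (coeff q0 ?n)"
        define k where "k = degree q - ?n"
        have "(coeff p (degree q) * inverse (coeff p0 ?n), c) \<in> G"
          unfolding c_def using p lead by (intro graph_mult[OF hG]) (auto simp: poly_graph_def)
        then have r: "q - q0 * monom c k \<in> I" (is "?r \<in> I")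
          using I_diff[OF less.prems I_mult[OF q0(1) poly_graph_monom[OF hG]]] by blast
        have c: "c \<noteq> 0" using False q0(2) by (simp add: c_def)
        have deg: "degree (q0 * monom c k) = degree q"
          using q0(2) c le by (subst degree_mult_eq) (auto simp: degree_monom_eq k_def monom_eq_0_iff)
        have "coeff (q0 * monom c k) (degree q) = coeff q (degree q)"
          using q0(2) le by (simp add: mult.commute[of q0] coeff_monom_mult k_def c_def)
        then have "degree ?r < degree q \<or> ?r = 0"
          using deg \<open>?n > 0\<close> le
          by (metis degree_diff_le eq_zero_or_degree_less coeff_diff diff_self order_refl)
        then have "poly ?r \<xi> = 0" using less.hyps[OF _ r] by auto
        then show ?thesis using \<xi> by simp
      qed simp
    qed
    then show ?thesis using that by blast
  qed
  \<comment> \<open>Well defined because every member of \<open>I\<close> vanishes at \<xi>.\<close>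
  define G' where "G' = {(poly p x, poly q \<xi>) |p q. (p, q) \<in> poly_graph G}"
  have "hom_graph G'"
    unfolding hom_graph_def
  proof (intro conjI allI impI)
    show "(1, 1) \<in> G'"
      unfolding G'_def using poly_graph_const[OF hG graph_one[OF hG]]
      by (intro CollectI exI[of _ "[:1:]"]) simp
  next
    fix y u z v assume "(y, u) \<in> G'" "(z, v) \<in> G'"
    then obtain p q p' q' where 1: "(p, q) \<in> poly_graph G" "(p', q') \<in> poly_graph G"
      and 2: "y = poly p x" "u = poly q \<xi>" "z = poly p' x" "v = poly q' \<xi>"
      by (auto simp: G'_def)
    show "(y - z, u - v) \<in> G'"
      unfolding G'_def using poly_graph_diff[OF hG 1] 2
      by (intro CollectI exI[of _ "p - p'"] exI[of _ "q - q'"]) simp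
    show "(y * z, u * v) \<in> G'"
      unfolding G'_def using poly_graph_mult[OF hG 1] 2
      by (intro CollectI exI[of _ "p * p'"] exI[of _ "q * q'"]) simp
  next
    fix u assume "(0, u) \<in> G'"
    then obtain p q where "(p, q) \<in> poly_graph G" "poly p x = 0" "u = poly q \<xi>"
      by (auto simp: G'_def)
    then show "u = 0" using \<xi> by (auto simp: I_def)
  qed
  moreover have "G \<subseteq> G'"
  proof
    fix z assume "z \<in> G"
    then have "([:fst z:], [:snd z:]) \<in> poly_graph G"
      using poly_graph_const[OF hG] by simp
    then show "z \<in> G'"
      unfolding G'_def by (intro CollectI exI[of _ "[:fst z:]"] exI[of _ "[:snd z:]"]) simp
  qed
  moreover have "(x, \<xi>) \<in> G'"
    unfolding G'_def using poly_graph_X[OF hG]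
    by (intro CollectI exI[of _ "[:0, 1:]"]) simp
  ultimately show ?thesis by blast
qed

lemma hom_graph_localize:
  assumes G: "hom_graph G" and z: "(z, w) \<in> G" "w \<noteq> 0"
  shows "\<exists>G'. hom_graph G' \<and> G \<subseteq> G' \<and> (inverse z, inverse w) \<in> G'"
proof -
  have z0: "z \<noteq> 0" using graph_nonzero[OF G z] .
  define G' where "G' = {(x / z ^ n, u / w ^ n) |x u n. (x, u) \<in> G}"
  have "hom_graph G'"
    unfolding hom_graph_def
  proof (intro conjI allI impI)
    show "(1, 1) \<in> G'"
      unfolding G'_def using graph_one[OF G] by (intro CollectI exI[of _ 1] exI[of _ 0]) simp
  next
    fix x u y v assume "(x, u) \<in> G'" "(y, v) \<in> G'"
    then obtain x' u' n y' v' m where 1: "(x', u') \<in> G" "(y', v') \<in> G"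
      and 2: "x = x' / z ^ n" "u = u' / w ^ n" "y = y' / z ^ m" "v = v' / w ^ m"
      unfolding G'_def by blast
    have "(x' * z ^ m - y' * z ^ n, u' * w ^ m - v' * w ^ n) \<in> G"
      using 1 z by (intro graph_diff[OF G] graph_mult[OF G] graph_power[OF G])
    moreover have "x - y = (x' * z ^ m - y' * z ^ n) / z ^ (n + m)"
      "u - v = (u' * w ^ m - v' * w ^ n) / w ^ (n + m)"
      using z0 z(2) 2 by (simp_all add: diff_divide_distrib power_add)
    ultimately show "(x - y, u - v) \<in> G'"
      unfolding G'_def by blast
    have "x * y = (x' * y') / z ^ (n + m)" "u * v = (u' * v') / w ^ (n + m)"
      using 2 by (simp_all add: power_add)
    then show "(x * y, u * v) \<in> G'"
      unfolding G'_def using graph_mult[OF G 1] by blast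
  next
    fix u assume "(0, u) \<in> G'"
    then obtain x' u' n where "(x', u') \<in> G" "0 = x' / z ^ n" "u = u' / w ^ n"
      by (auto simp: G'_def)
    then show "u = 0" using z0 graph_zero_unique[OF G] by auto
  qed
  moreover have "G \<subseteq> G'"
  proof
    fix y assume "y \<in> G"
    then show "y \<in> G'" unfolding G'_def by (cases y) (force intro: exI[of _ 0])
  qed
  moreover have "(inverse z, inverse w) \<in> G'"
    unfolding G'_def using graph_one[OF G]
    by (intro CollectI exI[of _ 1] exI[of _ "1::nat"]) (simp add: inverse_eq_divide)
  ultimately show ?thesis by blast
qed

lemma hom_graph_maximal:
  assumes "hom_graph G"
  shows "\<exists>M. hom_graph M \<and> G \<subseteq> M \<and> (\<forall>M'. hom_graph M' \<longrightarrow> M \<subseteq> M' \<longrightarrow> M' = M)"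
proof -
  let ?S = "{H. hom_graph H \<and> G \<subseteq> H}"
  have "\<exists>M\<in>?S. \<forall>X\<in>?S. M \<subseteq> X \<longrightarrow> X = M"
  proof (rule subset_Zorn_nonempty)
    show "?S \<noteq> {}" using assms by auto
  next
    fix C assume C: "C \<noteq> {}" "subset.chain ?S C"
    then have sub: "\<And>H. H \<in> C \<Longrightarrow> hom_graph H \<and> G \<subseteq> H"
      by (auto simp: subset.chain_def)
    have two: "\<exists>H\<in>C. a \<in> H \<and> b \<in> H" if "a \<in> \<Union>C" "b \<in> \<Union>C" for a b
    proof -
      obtain H1 H2 where H: "H1 \<in> C" "a \<in> H1" "H2 \<in> C" "b \<in> H2"
        using \<open>a \<in> \<Union>C\<close> \<open>b \<in> \<Union>C\<close> by (elim UnionE) (rule that)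
      then have "H1 \<subseteq> H2 \<or> H2 \<subseteq> H1"
        using C(2) by (metis subset_chain_def)
      then show ?thesis using H by blast
    qed
    have "hom_graph (\<Union>C)"
      unfolding hom_graph_def
    proof (intro conjI allI impI)
      show "(1, 1) \<in> \<Union>C" using C(1) sub graph_one by blast
    next
      fix x u y v assume "(x, u) \<in> \<Union>C" "(y, v) \<in> \<Union>C"
      then obtain H where H: "H \<in> C" "(x, u) \<in> H" "(y, v) \<in> H" using two by meson
      then show "(x - y, u - v) \<in> \<Union>C" "(x * y, u * v) \<in> \<Union>C"
        using sub[OF H(1)] graph_diff graph_mult by blast+
    next
      fix u assume "(0, u) \<in> \<Union>C"
      then show "u = 0" using sub graph_zero_unique by blast
    qed
    then show "\<Union>C \<in> ?S" using C(1) sub by auto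
  qed
  then show ?thesis by (smt (verit) mem_Collect_eq order_trans)
qed

text \<open>Descent step of Chevalley's extension theorem. Reversing \<open>p'\<close> gives a
  relation for \<open>x\<close> whose leading coefficient is the unit \<open>c\<close>; a multiple
  of it with factor in the kernel cancels the leading term of \<open>p\<close> and, reducing to 0,
  leaves the reduction 1 intact.\<close>

lemma valuation_descent:
  assumes G: "local_graph G" and "x \<noteq> 0"
    and p: "(p, 1) \<in> poly_graph G" "poly p x = 0"
    and p': "(p', 1) \<in> poly_graph G" "poly p' (inverse x) = 0" and le: "degree p' \<le> degree p"
  shows "\<exists>p2. (p2, 1) \<in> poly_graph G \<and> poly p2 x = 0 \<and> degree p2 < degree p"
proof -
  note hG = local_graph_hom[OF G]
  let ?n = "degree p" and ?m = "degree p'"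
  have n: "?n > 0"
  proof (rule ccontr)
    assume "\<not> ?n > 0"
    then obtain c where "p = [:c:]" by (meson degree_eq_zeroE gr0I)
    then show False
      using p graph_zero_unique[OF hG, of 1] by (force simp: poly_graph_def dest: spec[of _ 0])
  qed
  define c where "c = coeff p' 0"
  have c: "(c, 1) \<in> G" using p'(1) by (auto simp: poly_graph_def c_def dest: spec[of _ 0])
  then have c0: "c \<noteq> 0" using graph_nonzero[OF hG] by force
  have ic: "(inverse c, 1) \<in> G" using local_graph_inverse[OF G c] by simp
  define a where "a = coeff p ?n * inverse c"
  have "(coeff p ?n, 0) \<in> G"
    using p(1) n by (auto simp: poly_graph_def dest!: spec[of _ ?n])
  then have a: "(a, 0) \<in> G" unfolding a_def using graph_mult[OF hG _ ic] by fastforce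
  define r where "r = reflect_poly p'"
  have "poly r x = 0"
    using p'(2) \<open>x \<noteq> 0\<close> by (simp add: r_def poly_reflect_poly_nz)
  moreover have rG: "\<exists>u. (coeff r i, u) \<in> G" for i
    using p'(1) graph_zero[OF hG]
    by (auto simp: r_def coeff_reflect_poly poly_graph_def)
  have "degree r = ?m" using c0 by (simp add: r_def c_def)
  have cr: "coeff r ?m = c" by (simp add: r_def coeff_reflect_poly c_def)
  define p2 where "p2 = p - monom a (?n - ?m) * r"
  have "(monom a (?n - ?m) * r, 0) \<in> poly_graph G"
  proof -
    have "(coeff (monom a (?n - ?m) * r) i, 0) \<in> G" for i
    proof (cases "i < ?n - ?m")
      case False
      obtain u where "(coeff r (i - (?n - ?m)), u) \<in> G" using rG by blast
      from graph_mult[OF hG a this] show ?thesis using False by (simp add: coeff_monom_mult)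
    qed (simp add: coeff_monom_mult graph_zero[OF hG])
    then show ?thesis by (simp add: poly_graph_def)
  qed
  from poly_graph_diff[OF hG p(1) this] have "(p2, 1) \<in> poly_graph G"
    by (simp add: p2_def)
  moreover have "poly p2 x = 0" using p(2) \<open>poly r x = 0\<close> by (simp add: p2_def)
  moreover have "degree p2 < ?n"
  proof -
    have "coeff p2 ?n = 0"
      using le c0 by (simp add: p2_def coeff_monom_mult cr a_def)
    moreover have "degree p2 \<le> ?n"
      unfolding p2_def
      by (intro degree_diff_le order_refl order_trans[OF degree_mult_le])
         (use le \<open>degree r = ?m\<close> degree_monom_le[of a "?n - ?m"] in linarith)
    ultimately show ?thesis
      using n by (metis eq_zero_or_degree_less degree_0)
  qed
  ultimately show ?thesis by blast
qed

text \<open>A graph that is maximal under inclusion is a place: if neither \<open>x\<close> nor its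
  inverse had a value, both would be roots of polynomials reducing to 1, and
  \<open>valuation_descent\<close> would lower the total degree forever.\<close>

lemma place_extension:
  fixes G :: "('a::field \<times> 'b::alg_closed_field) set"
  assumes "hom_graph G"
  shows "\<exists>M. place_graph M \<and> G \<subseteq> M"
proof -
  obtain M where M: "hom_graph M" "G \<subseteq> M"
    and max: "\<And>M'. hom_graph M' \<Longrightarrow> M \<subseteq> M' \<Longrightarrow> M' = M"
    using hom_graph_maximal[OF assms] by blast
  have loc: "local_graph M"
    unfolding local_graph_def
  proof (intro conjI allI impI M(1))
    fix x u assume "(x, u) \<in> M" "u \<noteq> 0"
    then show "(inverse x, inverse u) \<in> M"
      using hom_graph_localize[OF M(1)] max by blast
  qed
  have ext: "\<exists>p. (p, 1) \<in> poly_graph M \<and> poly p x = 0" if "\<nexists>u. (x, u) \<in> M" for x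
    using hom_graph_extend_elem[OF loc, of x] max that by blast
  have "(inverse x, 0) \<in> M" if nx: "\<nexists>u. (x, u) \<in> M" for x
  proof (cases "\<exists>v. (inverse x, v) \<in> M")
    case True
    then obtain v where v: "(inverse x, v) \<in> M" by blast
    \<comment> \<open>A nonzero value of \<open>inverse x\<close> would give \<open>x\<close> the
      value \<open>inverse v\<close>.\<close>
    then have "v = 0" using local_graph_inverse[OF loc v] nx by fastforce
    then show ?thesis using v by simp
  next
    case False
    have x0: "x \<noteq> 0" using nx graph_zero[OF M(1)] by blast
    have "\<not> ((p, 1) \<in> poly_graph M \<and> poly p x = 0 \<and> (p', 1) \<in> poly_graph M \<and> poly p' (inverse x) = 0)" for p p'
    proof (induction "degree p + degree p'" arbitrary: p p' rule: less_induct)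
      case less
      show ?case
      proof
        assume A: "(p, 1) \<in> poly_graph M \<and> poly p x = 0 \<and> (p', 1) \<in> poly_graph M \<and> poly p' (inverse x) = 0"
        show False
        proof (cases "degree p' \<le> degree p")
          case True
          then obtain p2 where "(p2, 1) \<in> poly_graph M \<and> poly p2 x = 0 \<and> degree p2 < degree p"
            using valuation_descent[OF loc x0, of p p'] A by blast
          then show False using less[of p2 p'] A by auto
        next
          case False
          then obtain p2 where "(p2, 1) \<in> poly_graph M \<and> poly p2 (inverse x) = 0 \<and> degree p2 < degree p'"
            using valuation_descent[OF loc, of "inverse x" p' p] A x0 by auto
          then show False using less[of p p2] A by auto
        qed
      qed
    qed
    then show ?thesis using ext[OF nx] ext[OF False] by blast
  qed
  then show ?thesis using loc M(2) unfolding place_graph_def by blast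
qed

text \<open>Consider \<open>inverse t\<close>: no place takes a finite value there, so the constant \<open>1\<close> lies in the
  ideal generated by the kernel, and clearing denominators gives the equation.\<close>

lemma strongly_integral:
  fixes G :: "('a::field \<times> 'b::alg_closed_field) set"
  assumes G: "local_graph G" and places: "\<And>M. place_graph M \<Longrightarrow> G \<subseteq> M \<Longrightarrow> (t, 0) \<in> M"
  shows "\<exists>N c. (\<forall>m<N. (c m, 0) \<in> G) \<and> t ^ N = (\<Sum>m<N. c m * t ^ m)"
proof (cases "t = 0")
  case True
  then show ?thesis
    using graph_zero[OF local_graph_hom[OF G]]
    by (intro exI[of _ "1::nat"] exI[of _ "\<lambda>_. 0"]) auto
next
  case False
  note hG = local_graph_hom[OF G]
  have "\<exists>p. (p, 1) \<in> poly_graph G \<and> poly p (inverse t) = 0"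
  proof (rule ccontr)
    assume "\<nexists>p. (p, 1) \<in> poly_graph G \<and> poly p (inverse t) = 0"
    then obtain \<xi> G' where G': "hom_graph G'" "G \<subseteq> G'" "(inverse t, \<xi>) \<in> G'"
      using hom_graph_extend_elem[OF G] by blast
    then obtain M where M: "place_graph M" "G' \<subseteq> M"
      using place_extension by blast
    note hM = local_graph_hom[OF place_graph_local[OF M(1)]]
    have "(t, 0) \<in> M" using places M G'(2) by blast
    then have "(t * inverse t, 0 * \<xi>) \<in> M"
      using graph_mult[OF hM] G'(3) M(2) by blast
    then have "(1, 0) \<in> M" using False by simp
    then show False using graph_unique[OF hM graph_one[OF hM]] by fastforce
  qed
  then obtain p where p: "(p, 1) \<in> poly_graph G" "poly p (inverse t) = 0" by blast
  let ?N = "degree p"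
  define c where "c = coeff p 0"
  have c: "(c, 1) \<in> G" using p(1) by (auto simp: poly_graph_def c_def dest: spec[of _ 0])
  then have c0: "c \<noteq> 0" using graph_nonzero[OF hG] by force
  have ic: "(inverse c, 1) \<in> G" using local_graph_inverse[OF G c] by simp
  \<comment> \<open>Reversal moves the unit constant term to the top, while the lower coefficients
    now come from the kernel.\<close>
  have "poly (reflect_poly p) t = 0"
    using p(2) False by (simp add: poly_reflect_poly_nz)
  moreover have "poly (reflect_poly p) t = (\<Sum>i\<le>?N. coeff (reflect_poly p) i * t ^ i)"
    by (rule poly_as_sum_upto) (rule degree_reflect_poly_le)
  moreover have "\<dots> = (\<Sum>i<?N. coeff (reflect_poly p) i * t ^ i) + c * t ^ ?N"
    by (subst lessThan_Suc_atMost[symmetric]) (simp add: coeff_reflect_poly c_def)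
  ultimately have "c * t ^ ?N = - (\<Sum>i<?N. coeff (reflect_poly p) i * t ^ i)"
    by (simp add: eq_neg_iff_add_eq_0 add.commute)
  then have "t ^ ?N = - inverse c * (\<Sum>i<?N. coeff (reflect_poly p) i * t ^ i)"
    using c0 by (simp add: field_simps)
  then have "t ^ ?N = (\<Sum>i<?N. - (inverse c * coeff (reflect_poly p) i) * t ^ i)"
    by (simp add: sum_distrib_left sum_negf mult.assoc)
  moreover have "(- (inverse c * coeff (reflect_poly p) i), 0) \<in> G" if "i < ?N" for i
  proof -
    have "(coeff p (?N - i), 0) \<in> G"
      using p(1) that by (auto simp: poly_graph_def dest!: spec[of _ "?N - i"])
    then show ?thesis
      using that graph_uminus[OF hG graph_mult[OF hG ic]] by (force simp: coeff_reflect_poly)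
  qed
  ultimately show ?thesis
    by (intro exI[of _ ?N] exI[of _ "\<lambda>i. - (inverse c * coeff (reflect_poly p) i)"]) auto
qed

section \<open>Nakayama's lemma for strongly integral elements\<close>

text \<open>The coefficient set need not be a ring, so the same notion covers a module over the
  domain of a graph and its product with the maximal ideal. Repeated generators are not
  collected.\<close>

inductive_set lincomb :: "'a::comm_ring_1 set \<Rightarrow> 'a set \<Rightarrow> 'a set"
  for A S :: "'a set" where
  zero: "0 \<in> lincomb A S"
| step: "x \<in> lincomb A S \<Longrightarrow> a \<in> A \<Longrightarrow> s \<in> S \<Longrightarrow> x + a * s \<in> lincomb A S"

lemma lincomb_add:
  assumes "y \<in> lincomb A S" "x \<in> lincomb A S"
  shows "x + y \<in> lincomb A S"
  using assms(1,2)
proof (induction arbitrary: x)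
  case zero
  then show ?case by simp
next
  case (step y a s)
  then show ?case using lincomb.step[of "x + y" A S a s] by (simp add: add.assoc)
qed

lemma lincomb_single: "a \<in> A \<Longrightarrow> s \<in> S \<Longrightarrow> a * s \<in> lincomb A S"
  using lincomb.step[OF lincomb.zero] by fastforce

lemma lincomb_sum: "(\<And>i. i \<in> B \<Longrightarrow> f i \<in> lincomb A S) \<Longrightarrow> sum f B \<in> lincomb A S"
  by (induction B rule: infinite_finite_induct) (auto intro: lincomb.zero lincomb_add)

lemma lincomb_trans:
  assumes "x \<in> lincomb A S"
    and "\<And>a s. a \<in> A \<Longrightarrow> s \<in> S \<Longrightarrow> a * s \<in> lincomb B T"
  shows "x \<in> lincomb B T"
  using assms(1) by induction (auto intro: lincomb.zero lincomb_add assms(2))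

lemma lincomb_scale:
  assumes "x \<in> lincomb A S" and "\<And>a s. a \<in> A \<Longrightarrow> s \<in> S \<Longrightarrow> c * (a * s) \<in> lincomb B T"
  shows "c * x \<in> lincomb B T"
  using assms(1)
  by induction (auto simp: distrib_left intro: lincomb.zero lincomb_add assms(2))

text \<open>The generators are eliminated one after the other.\<close>

lemma nakayama:
  fixes G :: "('a::field \<times> 'b::field) set"
  assumes G: "local_graph G" and "finite F"
    and "\<And>f. f \<in> F \<Longrightarrow> f \<in> lincomb {x. (x, 0) \<in> G} (insert 1 F)"
  shows "F \<subseteq> fst ` G"
  using assms(2,3)
proof (induction F rule: finite_induct)
  case empty
  then show ?case by simp
next
  case (insert f F)
  note hG = local_graph_hom[OF G]
  let ?n = "{x. (x, 0) \<in> G}"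
  \<comment> \<open>Only the generator \<open>f\<close> is collected; its total coefficient stays in
    the kernel.\<close>
  have split: "\<exists>c y. c \<in> ?n \<and> y \<in> lincomb ?n (Set.insert 1 F) \<and> x = c * f + y"
    if "x \<in> lincomb ?n (Set.insert 1 (Set.insert f F))" for x
    using that
  proof induction
    case zero
    then show ?case using graph_zero[OF hG] by (auto intro!: exI[of _ 0] lincomb.zero)
  next
    case (step x a s)
    then obtain c y where cy: "c \<in> ?n" "y \<in> lincomb ?n (Set.insert 1 F)" "x = c * f + y"
      by blast
    show ?case
    proof (cases "s = f")
      case True
      have "(c + a, 0) \<in> G" using graph_add[OF hG, of c 0 a 0] cy(1) step.hyps(2) by simp
      then show ?thesis
        using cy True by (intro exI[of _ "c + a"] exI[of _ y]) (simp add: algebra_simps)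
    next
      case False
      then have "y + a * s \<in> lincomb ?n (Set.insert 1 F)"
        using step cy(2) by (intro lincomb.step) auto
      then show ?thesis
        using cy by (intro exI[of _ c] exI[of _ "y + a * s"]) (simp add: algebra_simps)
    qed
  qed
  obtain c y where cy: "(c, 0) \<in> G" "y \<in> lincomb ?n (Set.insert 1 F)" "f = c * f + y"
    using split[OF insert.prems[of f]] by auto
  \<comment> \<open>The residue of \<open>1 - c\<close> is 1, so it is a unit and the relation can
    be solved for \<open>f\<close>.\<close>
  have u: "(1 - c, 1) \<in> G" using graph_diff[OF hG graph_one[OF hG] cy(1)] by simp
  then have u0: "1 - c \<noteq> 0" using graph_nonzero[OF hG] by force
  have iu: "(inverse (1 - c), 1) \<in> G" using local_graph_inverse[OF G u] by simp
  have f: "f = inverse (1 - c) * y"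
    using cy(3) u0 by (simp add: field_simps)
  have f_in: "f \<in> lincomb ?n (Set.insert 1 F)"
    unfolding f
  proof (rule lincomb_scale[OF cy(2)])
    fix a s assume "a \<in> ?n" "s \<in> Set.insert 1 F"
    then show "inverse (1 - c) * (a * s) \<in> lincomb ?n (Set.insert 1 F)"
      using graph_mult[OF hG iu, of a 0] by (simp add: mult.assoc[symmetric] lincomb_single)
  qed
  have nf: "a * f \<in> lincomb ?n (Set.insert 1 F)" if "a \<in> ?n" for a
  proof (rule lincomb_scale[OF f_in])
    fix b s assume "b \<in> ?n" "s \<in> Set.insert 1 F"
    then show "a * (b * s) \<in> lincomb ?n (Set.insert 1 F)"
      using graph_mult[OF hG, of a 0 b 0] that by (simp add: mult.assoc[symmetric] lincomb_single)
  qed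
  have F: "F \<subseteq> fst ` G"
  proof (rule insert.IH)
    fix g assume "g \<in> F"
    then show "g \<in> lincomb ?n (Set.insert 1 F)"
      using lincomb_trans[OF insert.prems[of g]] nf lincomb_single by (metis insert_iff)
  qed
  moreover have "f \<in> fst ` G"
  proof -
    have "\<exists>u. (z, u) \<in> G" if "z \<in> lincomb ?n (Set.insert 1 F)" for z
      using that
    proof induction
      case zero
      then show ?case using graph_zero[OF hG] by blast
    next
      case (step x a s)
      then obtain u where "(x, u) \<in> G" by blast
      moreover obtain v where "(s, v) \<in> G"
        using step.hyps(3) F graph_one[OF hG] by force
      ultimately show ?case
        using graph_add[OF hG _ graph_mult[OF hG]] step.hyps(2) by blast
    qed
    then show ?thesis using f_in by force
  qed
  ultimately show ?case by simp
qed

section \<open>Powers of the ideal generated by strongly integral elements\<close>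

locale strongly_integral_family =
  fixes G :: "('a::field \<times> 'b::field) set" and d :: nat and t :: "nat \<Rightarrow> 'a" and N :: "nat \<Rightarrow> nat"
    and c :: "nat \<Rightarrow> nat \<Rightarrow> 'a"
  assumes G: "local_graph G"
    and c: "\<And>i m. i \<le> d \<Longrightarrow> m < N i \<Longrightarrow> (c i m, 0) \<in> G"
    and integral: "\<And>i. i \<le> d \<Longrightarrow> t i ^ N i = (\<Sum>m<N i. c i m * t i ^ m)"
begin

definition mon :: "(nat \<Rightarrow> nat) \<Rightarrow> 'a" where
  "mon \<alpha> = (\<Prod>i\<le>d. t i ^ \<alpha> i)"

definition wt :: "(nat \<Rightarrow> nat) \<Rightarrow> nat" where
  "wt \<alpha> = (\<Sum>i\<le>d. \<alpha> i)"

text \<open>Let R be the domain of \<open>G\<close>, n its kernel, and R[t] the ring generated by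
  the \<open>t i\<close>. The reduced monomials generate R[t] as an R-module, so \<open>RS\<close>
  is R[t] and \<open>NS\<close> is n R[t]. Fixing the exponents beyond \<open>d\<close> makes the
  exponent functions finite in number.\<close>

definition red :: "'a set" where
  "red = mon ` {\<alpha>. (\<forall>i. i \<le> d \<longrightarrow> \<alpha> i < N i) \<and> (\<forall>i>d. \<alpha> i = 0)}"

abbreviation (input) "nn \<equiv> {x. (x, 0) \<in> G}"
abbreviation (input) "NS \<equiv> lincomb nn red"
abbreviation (input) "RS \<equiv> lincomb (fst ` G) red"

text \<open>The module n R[t] + J^m, where J is the ideal of R[t] generated by the
  \<open>t i\<close>.\<close>

definition filt :: "nat \<Rightarrow> 'a set" where
  "filt m = lincomb (fst ` G) (NS \<union> mon ` {\<alpha>. wt \<alpha> \<ge> m})"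

lemma mon_add: "mon (\<lambda>i. \<alpha> i + \<beta> i) = mon \<alpha> * mon \<beta>"
  by (simp add: mon_def power_add prod.distrib)

lemma wt_add: "wt (\<lambda>i. \<alpha> i + \<beta> i) = wt \<alpha> + wt \<beta>"
  by (simp add: wt_def sum.distrib)

lemma mon_unit: "i \<le> d \<Longrightarrow> mon (\<lambda>j. if j = i then k else 0) = t i ^ k"
  by (simp add: mon_def if_distrib[of "power _"] cong: if_cong)

lemma wt_unit: "i \<le> d \<Longrightarrow> wt (\<lambda>j. if j = i then k else 0) = k"
  by (simp add: wt_def)

lemma red_finite: "finite red"
proof -
  let ?S = "{\<alpha>. (\<forall>i. i \<le> d \<longrightarrow> \<alpha> i < N i) \<and> (\<forall>i>d. \<alpha> i = (0::nat))}"
  let ?E = "PiE {..d} (\<lambda>i. {..<N i})"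
  have "?S \<subseteq> (\<lambda>f i. if i \<le> d then f i else 0) ` ?E"
  proof
    fix \<alpha> assume \<alpha>: "\<alpha> \<in> ?S"
    then have "\<alpha> = (\<lambda>i. if i \<le> d then restrict \<alpha> {..d} i else 0)"
      by (auto simp: fun_eq_iff)
    moreover have "restrict \<alpha> {..d} \<in> ?E" using \<alpha> by auto
    ultimately show "\<alpha> \<in> (\<lambda>f i. if i \<le> d then f i else 0) ` ?E" by blast
  qed
  moreover have "finite ?E" by (intro finite_PiE) auto
  ultimately have "finite ?S" by (meson finite_surj)
  then show ?thesis by (simp add: red_def)
qed

lemma nn_mult: "(x, u) \<in> G \<Longrightarrow> a \<in> nn \<Longrightarrow> x * a \<in> nn"
  using graph_mult[OF local_graph_hom[OF G], of x u a 0] by simp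

lemma nn_RS: "a \<in> nn \<Longrightarrow> x \<in> RS \<Longrightarrow> a * x \<in> NS"
proof (rule lincomb_scale, assumption)
  fix b s assume "a \<in> nn" "b \<in> fst ` G" "s \<in> red"
  then obtain u where "(b, u) \<in> G" by auto
  then have "a * b \<in> nn" using nn_mult \<open>a \<in> nn\<close> by (metis mult.commute)
  then show "a * (b * s) \<in> NS" using \<open>s \<in> red\<close> by (simp add: mult.assoc[symmetric] lincomb_single)
qed

lemma NS_RS: "x \<in> NS \<Longrightarrow> x \<in> RS"
  by (erule lincomb_trans) (force intro: lincomb_single)

lemma mon_reduce:
  assumes "i \<le> d" "\<alpha> i \<ge> N i"
  shows "mon \<alpha> = (\<Sum>m<N i. c i m * mon (\<alpha>(i := \<alpha> i - N i + m)))"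
proof -
  have s: "mon (\<alpha>(i := k)) = t i ^ k * (\<Prod>j\<in>{..d}-{i}. t j ^ \<alpha> j)" for k
    unfolding mon_def using assms(1) by (subst prod.remove[of _ i]) (auto intro!: prod.cong)
  have "mon \<alpha> = mon (\<alpha>(i := \<alpha> i))" by simp
  also have "\<dots> = t i ^ (\<alpha> i - N i) * t i ^ N i * (\<Prod>j\<in>{..d}-{i}. t j ^ \<alpha> j)"
    unfolding s using assms(2) by (simp add: power_add[symmetric])
  also have "\<dots> = (\<Sum>m<N i. c i m * mon (\<alpha>(i := \<alpha> i - N i + m)))"
    unfolding s integral[OF assms(1)] by (simp add: sum_distrib_left sum_distrib_right power_add algebra_simps)
  finally show ?thesis .
qed

text \<open>Each use of an integral equation lowers the weight, since its right-hand side has only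
  powers of \<open>t i\<close> below \<open>N i\<close>.\<close>

lemma mon_RS: "mon \<alpha> \<in> RS"
proof (induction "wt \<alpha>" arbitrary: \<alpha> rule: less_induct)
  case less
  show ?case
  proof (cases "\<forall>i\<le>d. \<alpha> i < N i")
    case True
    have "mon \<alpha> = mon (\<lambda>i. if i \<le> d then \<alpha> i else 0)" by (simp add: mon_def)
    then have "mon \<alpha> \<in> red" unfolding red_def using True by auto
    then show ?thesis
      using lincomb_single[of 1 "fst ` G" "mon \<alpha>" red] graph_one[OF local_graph_hom[OF G]] by force
  next
    case False
    then obtain i where i: "i \<le> d" "\<alpha> i \<ge> N i" by (auto simp: not_less)
    have "c i m * mon (\<alpha>(i := \<alpha> i - N i + m)) \<in> RS" if m: "m < N i" for m
    proof -
      have "wt (\<alpha>(i := \<alpha> i - N i + m)) < wt \<alpha>"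
        unfolding wt_def using i m by (intro sum_strict_mono_ex1) auto
      then show ?thesis using less c[OF i(1) m] nn_RS NS_RS by blast
    qed
    then show ?thesis unfolding mon_reduce[of i \<alpha>, OF i] by (auto intro: lincomb_sum)
  qed
qed

text \<open>Here it matters that the coefficients of the integral equations lie in the kernel: one
  reduction puts the monomial into n R[t]. So J is nilpotent modulo n R[t].\<close>

lemma mon_NS:
  assumes "i \<le> d" "\<alpha> i \<ge> N i"
  shows "mon \<alpha> \<in> NS"
  unfolding mon_reduce[of i \<alpha>, OF assms] using assms(1) by (auto intro!: lincomb_sum nn_RS c mon_RS)

lemma NS_mult:
  assumes "x \<in> NS" "(a, u) \<in> G"
  shows "a * mon \<alpha> * x \<in> NS"
proof (rule lincomb_scale[OF assms(1)])
  fix b s assume b: "b \<in> nn" and "s \<in> red"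
  then obtain \<beta> where s: "s = mon \<beta>" by (auto simp: red_def)
  have "a * b * mon (\<lambda>i. \<alpha> i + \<beta> i) \<in> NS"
    using nn_mult[OF assms(2) b] mon_RS by (rule nn_RS)
  then show "a * mon \<alpha> * (b * s) \<in> NS" by (simp add: s mon_add ac_simps)
qed

lemma NS_filt: "x \<in> NS \<Longrightarrow> x \<in> filt m"
  unfolding filt_def
  using lincomb_single[of 1 "fst ` G" x] graph_one[OF local_graph_hom[OF G]] by force

lemma mon_filt: "wt \<alpha> \<ge> m \<Longrightarrow> mon \<alpha> \<in> filt m"
  unfolding filt_def
  using lincomb_single[of 1 "fst ` G" "mon \<alpha>"] graph_one[OF local_graph_hom[OF G]] by force

lemma filt_add: "x \<in> filt m \<Longrightarrow> y \<in> filt m \<Longrightarrow> x + y \<in> filt m"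
  unfolding filt_def by (rule lincomb_add)

lemma filt_scale:
  assumes "x \<in> filt m" "(a, u) \<in> G"
  shows "a * x \<in> filt m"
  using assms(1) unfolding filt_def
proof (rule lincomb_scale)
  fix b s assume "b \<in> fst ` G" and s: "s \<in> NS \<union> mon ` {\<alpha>. wt \<alpha> \<ge> m}"
  then have "a * b \<in> fst ` G"
    using graph_mult[OF local_graph_hom[OF G] assms(2)] by force
  then show "a * (b * s) \<in> lincomb (fst ` G) (NS \<union> mon ` {\<alpha>. wt \<alpha> \<ge> m})"
    using s by (simp add: mult.assoc[symmetric] lincomb_single)
qed

lemma filt_diff: "x \<in> filt m \<Longrightarrow> y \<in> filt m \<Longrightarrow> x - y \<in> filt m"
  using filt_add[of x m "- 1 * y"] filt_scale[OF _ graph_uminus[OF local_graph_hom[OF G] graph_one[OF local_graph_hom[OF G]]]]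
  by simp

lemma filt_zero: "0 \<in> filt m"
  by (simp add: filt_def lincomb.zero)

lemma filt_sum: "(\<And>i. i \<in> B \<Longrightarrow> f i \<in> filt m) \<Longrightarrow> sum f B \<in> filt m"
  unfolding filt_def by (rule lincomb_sum)

lemma filt_mon_mult:
  assumes "x \<in> filt m"
  shows "mon \<alpha> * x \<in> filt (wt \<alpha> + m)"
  using assms unfolding filt_def[of m]
proof induction
  case zero
  then show ?case by (simp add: filt_zero)
next
  case (step x a s)
  obtain u where a: "(a, u) \<in> G" using step.hyps(2) by auto
  have "a * mon \<alpha> * s \<in> filt (wt \<alpha> + m)"
  proof (cases "s \<in> NS")
    case True
    then show ?thesis using NS_mult[OF _ a] NS_filt by blast
  next
    case False
    then obtain \<beta> where "s = mon \<beta>" "wt \<beta> \<ge> m" using step.hyps(3) by auto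
    then have "mon \<alpha> * s \<in> filt (wt \<alpha> + m)"
      using mon_filt[of "wt \<alpha> + m" "\<lambda>i. \<alpha> i + \<beta> i"] by (simp add: mon_add wt_add)
    from filt_scale[OF this a] show ?thesis by (simp add: mult.assoc)
  qed
  from filt_add[OF step.IH this] show ?case by (simp add: algebra_simps)
qed

text \<open>Pigeonhole: a monomial of such a weight has an exponent
  \<open>\<alpha> i \<ge> N i\<close>, so J^m is contained in n R[t].\<close>

lemma filt_high:
  assumes "m \<ge> (\<Sum>i\<le>d. N i)" "x \<in> filt m" "m > 0"
  shows "x \<in> NS"
  using assms(2) unfolding filt_def
proof (rule lincomb_trans)
  fix a s assume a: "a \<in> fst ` G" and s: "s \<in> NS \<union> mon ` {\<alpha>. wt \<alpha> \<ge> m}"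
  obtain u where u: "(a, u) \<in> G" using a by auto
  have "s \<in> NS"
  proof (cases "s \<in> NS")
    case False
    then obtain \<alpha> where \<alpha>: "s = mon \<alpha>" "wt \<alpha> \<ge> m" using s by auto
    have "\<exists>i\<le>d. \<alpha> i \<ge> N i"
    proof (rule ccontr)
      assume "\<not> (\<exists>i\<le>d. \<alpha> i \<ge> N i)"
      then have "(\<Sum>i\<le>d. \<alpha> i) < (\<Sum>i\<le>d. N i)"
        by (intro sum_strict_mono) auto
      then show False using \<alpha>(2) assms(1) by (simp add: wt_def)
    qed
    then show ?thesis using mon_NS \<alpha>(1) by blast
  qed
  then show "a * s \<in> NS" using NS_mult[OF _ u, of s "\<lambda>_. 0"] by (simp add: mon_def)
qed

lemma filt_antimono: "m \<le> m' \<Longrightarrow> x \<in> filt m' \<Longrightarrow> x \<in> filt m"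
  unfolding filt_def by (erule lincomb_trans) (auto intro: lincomb_single)

text \<open>If J lies in J^2 + n R[t], it lies in J^k + n R[t] for every k, hence in n R[t]. The
  nonconstant reduced monomials then satisfy the hypothesis of \<open>nakayama\<close>, which yields
  R[t] = R.\<close>

lemma integral_in_local:
  assumes square: "\<And>i. i \<le> d \<Longrightarrow> t i \<in> filt 2"
  shows "i \<le> d \<Longrightarrow> t i \<in> fst ` G"
proof -
  have up: "x \<in> filt (Suc m)" if "x \<in> filt m" "m \<ge> 1" for x m
    using that(1) unfolding filt_def[of m]
  proof induction
    case zero
    then show ?case by (simp add: filt_zero)
  next
    case (step x a s)
    obtain u where a: "(a, u) \<in> G" using step.hyps(2) by auto
    have "s \<in> filt (Suc m)"
    proof (cases "s \<in> NS")
      case False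
      then obtain \<alpha> where \<alpha>: "s = mon \<alpha>" "wt \<alpha> \<ge> m" using step.hyps(3) by auto
      then have "wt \<alpha> \<noteq> 0" using that(2) by simp
      then obtain i where i: "i \<le> d" "\<alpha> i > 0" by (auto simp: wt_def)
      let ?u = "\<lambda>j. if j = i then 1 else (0::nat)"
      \<comment> \<open>One factor \<open>t i\<close> is split off and replaced by an element of
        \<open>filt 2\<close>, which raises the weight by one.\<close>
      define \<beta> where "\<beta> = \<alpha>(i := \<alpha> i - 1)"
      have "\<alpha> = (\<lambda>j. \<beta> j + ?u j)"
        using i by (auto simp: \<beta>_def)
      then have "s = mon \<beta> * t i" "wt \<alpha> = wt \<beta> + 1"
        using mon_add[of \<beta> ?u] wt_add[of \<beta> ?u] mon_unit[OF i(1), of 1] wt_unit[OF i(1), of 1] \<alpha>(1) by simp_all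
      then have "s \<in> filt (wt \<alpha> + 1)" using filt_mon_mult[OF square[OF i(1)], of \<beta>] by simp
      then show ?thesis using \<alpha>(2) filt_antimono[of "Suc m" "wt \<alpha> + 1"] by simp
    qed (rule NS_filt)
    from filt_add[OF step.IH filt_scale[OF this a]] show ?case .
  qed
  have "x \<in> filt (1 + k)" if "x \<in> filt 1" for x k
    by (induction k) (use that up in auto)
  then have NS: "x \<in> NS" if "x \<in> filt 1" for x
    using filt_high[of "1 + (\<Sum>i\<le>d. N i)" x] that by auto
  have "red - {1} \<subseteq> fst ` G"
  proof (rule nakayama[OF G])
    show "finite (red - {1})" using red_finite by simp
    fix f assume f: "f \<in> red - {1}"
    then obtain \<alpha> where \<alpha>: "f = mon \<alpha>" by (auto simp: red_def)
    have "mon \<alpha> = 1" if "wt \<alpha> = 0" using that by (simp add: wt_def mon_def)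
    then have "wt \<alpha> \<noteq> 0" using f \<alpha> by auto
    then have "f \<in> NS" using NS mon_filt[of 1 \<alpha>] \<alpha> by simp
    then show "f \<in> lincomb nn (insert 1 (red - {1}))"
      by (rule lincomb_trans) (auto intro: lincomb_single)
  qed
  moreover have "1 \<in> fst ` G" using graph_one[OF local_graph_hom[OF G]] by force
  ultimately have red: "red \<subseteq> fst ` G" by auto
  have "x \<in> fst ` G" if "x \<in> NS" for x
    using that
  proof induction
    case zero
    then show ?case using graph_zero[OF local_graph_hom[OF G]] by force
  next
    case (step x a s)
    then obtain u v where "(x, u) \<in> G" "(s, v) \<in> G" using red by fastforce
    then show ?case
      using graph_add[OF local_graph_hom[OF G] _ graph_mult[OF local_graph_hom[OF G]]] step.hyps(2)
      by (metis fst_conv image_eqI mem_Collect_eq)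
  qed
  moreover assume "i \<le> d"
  ultimately show ?thesis
    using NS filt_antimono[of 1 2] square by (meson one_le_numeral)
qed

end

section \<open>The Hessian in affine coordinates\<close>

text \<open>For \<open>f = (\<Sum>i\<le>d. b i * x ^ i)\<close>, \<open>hess_quad d b n\<close> is the coefficient of \<open>x ^ n\<close> in
  \<open>2 * (d * f * f'' - (d - 1) * f'\<^sup>2)\<close>. By Euler's relation this is the dehomogenized Hessian of the
  homogenization of \<open>f\<close>, up to the factor \<open>(d - 1) / 2\<close>.\<close>

definition hess_weight :: "nat \<Rightarrow> nat \<Rightarrow> nat \<Rightarrow> int" where
  "hess_weight d i j = int d * (int i * (int i - 1) + int j * (int j - 1)) - 2 * (int d - 1) * int i * int j"

definition hess_polar :: "nat \<Rightarrow> (nat \<Rightarrow> 'a::comm_ring_1) \<Rightarrow> (nat \<Rightarrow> 'a) \<Rightarrow> nat \<Rightarrow> 'a" where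
  "hess_polar d b c n = (\<Sum>i\<le>d. \<Sum>j\<le>d. if i + j = n + 2 then of_int (hess_weight d i j) * b i * c j else 0)"

abbreviation hess_quad :: "nat \<Rightarrow> (nat \<Rightarrow> 'a::comm_ring_1) \<Rightarrow> nat \<Rightarrow> 'a" where
  "hess_quad d b n \<equiv> hess_polar d b b n"

lemma hess_weight_commute: "hess_weight d i j = hess_weight d j i"
  by (simp add: hess_weight_def algebra_simps)

lemma hess_weight_reverse: "i \<le> d \<Longrightarrow> j \<le> d \<Longrightarrow> hess_weight d (d - i) (d - j) = hess_weight d i j"
  by (simp add: hess_weight_def of_nat_diff algebra_simps)

lemma hess_weight_diag: "hess_weight d i i = 2 * int i * (int i - int d)"
  by (simp add: hess_weight_def algebra_simps)

lemma hess_weight_zero: "hess_weight d 0 j = int d * int j * (int j - 1)"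
  by (simp add: hess_weight_def algebra_simps)

lemma hess_weight_top: "hess_weight d d j = int d * (int d - int j) * (int d - 1 - int j)"
  by (simp add: hess_weight_def algebra_simps)

lemma hess_weight_top_right: "hess_weight d j d = int d * (int d - int j) * (int d - 1 - int j)"
  using hess_weight_top hess_weight_commute by metis

text \<open>Modulo \<open>d\<close> only the last term of \<open>hess_weight d a s\<close> survives, and \<open>2 * a\<close> is \<open>- 1\<close> or \<open>- 2\<close>.\<close>

lemma hess_weight_middle_nonzero:
  assumes d: "d \<ge> 5" and a: "a = (d - 1) div 2" and s: "s \<le> d"
  shows "hess_weight d a s \<noteq> 0"
proof
  assume 0: "hess_weight d a s = 0"
  have a2: "a \<ge> 2" using d a by simp
  have dvd: "int d dvd 2 * int a * int s"
  proof -
    have "2 * int a * int s = hess_weight d a s + int d * (2 * int a * int s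
        - (int a * (int a - 1) + int s * (int s - 1)))"
      by (simp add: hess_weight_def algebra_simps)
    then show ?thesis using 0 by (metis add_0 dvd_triv_left)
  qed
  consider "d = 2 * a + 1" | "d = 2 * a + 2" using a d by linarith
  then show False
  proof cases
    case 1
    then have "2 * int a * int s = int d * int s - int s" by (simp add: algebra_simps)
    then have "int d dvd int s" using dvd by (metis dvd_diff_right_iff dvd_triv_left)
    then have "s = 0 \<or> s = d" using s by (auto dest: dvd_imp_le)
    then show False
    proof
      assume "s = d"
      then have "hess_weight d a s = int d * (int a + 1) * int a"
        using 1 by (simp add: hess_weight_top_right algebra_simps)
      then show False using 0 a2 d by simp
    qed (use 0 a2 d in \<open>simp add: hess_weight_commute[of d a] hess_weight_zero\<close>)
  next
    case 2
    then have "2 * int a * int s = int d * int s - 2 * int s" by (simp add: algebra_simps)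
    then have "int d dvd 2 * int s" using dvd by (metis dvd_diff_right_iff dvd_triv_left)
    then obtain k where k: "2 * int s = int d * k" by (elim dvdE)
    have "int d * k \<ge> 0" unfolding k[symmetric] by simp
    then have "k \<ge> 0" using d by (simp add: zero_le_mult_iff)
    moreover have "k \<le> 2"
    proof (rule ccontr)
      assume "\<not> k \<le> 2"
      then have "int d * 3 \<le> int d * k" by (intro mult_left_mono) auto
      then show False using k s d by linarith
    qed
    \<comment> \<open>Divisibility leaves only s = 0, d / 2 and d, where the weight is computed
      directly.\<close>
    ultimately have "k = 0 \<or> k = 1 \<or> k = 2" by linarith
    then have "s = 0 \<or> s = a + 1 \<or> s = d" using k 2 by auto
    then consider "s = 0" | "s = a + 1" | "s = d" by blast
    then show False
    proof cases
      case 1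
      then show ?thesis using 0 a2 d by (simp add: hess_weight_commute[of d a] hess_weight_zero)
    next
      case s: 2
      have "hess_weight d a s = - (2 * (int a + 1) * int a)"
        unfolding s 2 by (simp add: hess_weight_def algebra_simps)
      then show ?thesis using 0 a2 by simp
    next
      case s: 3
      have "hess_weight d a s = int d * (int a + 2) * (int a + 1)"
        using s 2 by (simp add: hess_weight_top_right)
      then show ?thesis using 0 a2 d by simp
    qed
  qed
qed

lemma hess_polar_alt:
  "hess_polar d b c n = (\<Sum>i\<le>d. if i \<le> n + 2 \<and> n + 2 - i \<le> d then of_int (hess_weight d i (n + 2 - i)) * b i * c (n + 2 - i) else 0)"
  unfolding hess_polar_def
proof (rule sum.cong[OF refl])
  fix i assume "i \<in> {..d}"
  have eq: "(i + j = n + 2) = (i \<le> n + 2 \<and> j = n + 2 - i)" for j by auto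
  show "(\<Sum>j\<le>d. if i + j = n + 2 then of_int (hess_weight d i j) * b i * c j else 0) =
    (if i \<le> n + 2 \<and> n + 2 - i \<le> d then of_int (hess_weight d i (n + 2 - i)) * b i * c (n + 2 - i) else 0)"
    unfolding eq by (cases "i \<le> n + 2") (auto simp: sum.delta)
qed

lemma hess_polar_commute: "hess_polar d b c n = hess_polar d c b n"
  unfolding hess_polar_def
  by (subst sum.swap) (intro sum.cong refl, simp add: hess_weight_commute add.commute mult_ac)

lemma hess_polar_add_left: "hess_polar d (\<lambda>i. b i + b' i) c n = hess_polar d b c n + hess_polar d b' c n"
  unfolding hess_polar_def sum.distrib[symmetric] by (intro sum.cong refl) (simp add: algebra_simps)

lemma hess_polar_add_right: "hess_polar d b (\<lambda>i. c i + c' i) n = hess_polar d b c n + hess_polar d b c' n"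
  unfolding hess_polar_commute[of d b] by (rule hess_polar_add_left)

lemma hess_polar_scale_left: "hess_polar d (\<lambda>i. x * b i) c n = x * hess_polar d b c n"
  unfolding hess_polar_def sum_distrib_left by (intro sum.cong refl) (simp add: algebra_simps)

lemma hess_polar_scale_right: "hess_polar d b (\<lambda>i. x * c i) n = x * hess_polar d b c n"
  unfolding hess_polar_commute[of d b] by (rule hess_polar_scale_left)

lemma hess_polar_cong:
  "(\<And>i. i \<le> d \<Longrightarrow> b i = b' i) \<Longrightarrow> (\<And>i. i \<le> d \<Longrightarrow> c i = c' i) \<Longrightarrow> hess_polar d b c n = hess_polar d b' c' n"
  unfolding hess_polar_def by (intro sum.cong refl) simp

lemma hess_polar_delta:
  "k \<le> d \<Longrightarrow> hess_polar d (\<lambda>i. if i = k then 1 else 0) c n =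
    (if k \<le> n + 2 \<and> n + 2 - k \<le> d then of_int (hess_weight d k (n + 2 - k)) * c (n + 2 - k) else 0)"
  unfolding hess_polar_alt
  by (subst sum.mono_neutral_right[where S = "{k}"]) auto

text \<open>The range of summation alone allows n up to 2 d - 2. In the two top degrees only the
  pairs (d, d), (d, d - 1) and (d - 1, d) occur, and their weights are 0.\<close>

lemma hess_polar_above:
  assumes "n > 2 * d - 4"
  shows "hess_polar d b c n = 0"
  unfolding hess_polar_alt
proof (rule sum.neutral, clarify)
  fix i assume "i \<le> d"
  have "hess_weight d i (n + 2 - i) = 0" if "i \<le> n + 2" "n + 2 - i \<le> d"
  proof -
    have "i = d \<and> n + 2 - i = d \<or> i = d \<and> n + 2 - i = d - 1 \<or> i = d - 1 \<and> n + 2 - i = d \<or> d \<le> 1"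
      using assms that \<open>i \<le> d\<close> by linarith
    then show ?thesis
    proof (elim disjE)
      assume "i = d \<and> n + 2 - i = d - 1"
      then show ?thesis by (cases d) (auto simp: hess_weight_top)
    next
      assume "i = d - 1 \<and> n + 2 - i = d"
      then show ?thesis by (cases d) (auto simp: hess_weight_top_right)
    next
      assume "d \<le> 1"
      then have "i = d \<and> n + 2 - i = d" using that \<open>i \<le> d\<close> by linarith
      then show ?thesis by (auto simp: hess_weight_diag)
    qed (auto simp: hess_weight_diag)
  qed
  then show "(if i \<le> n + 2 \<and> n + 2 - i \<le> d then of_int (hess_weight d i (n + 2 - i)) * b i * c (n + 2 - i) else 0) = 0"
    by simp
qed

text \<open>Exchange of the two variables; it transfers statements about the order at 0 to
  infinity.\<close>

lemma hess_polar_reverse: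
  assumes "d \<ge> 2" "n \<le> 2 * d - 4"
  shows "hess_polar d (\<lambda>i. b (d - i)) (\<lambda>i. c (d - i)) n = hess_polar d b c (2 * d - 4 - n)"
proof -
  have bij: "bij_betw (\<lambda>i. d - i) {..d} {..d}"
    by (rule bij_betwI[where g = "\<lambda>i. d - i"]) auto
  have "hess_polar d b c (2 * d - 4 - n) = (\<Sum>i\<le>d. \<Sum>j\<le>d. if (d - i) + (d - j) = 2 * d - 4 - n + 2
      then of_int (hess_weight d (d - i) (d - j)) * b (d - i) * c (d - j) else 0)"
    unfolding hess_polar_def
    by (subst sum.reindex_bij_betw[OF bij, symmetric], rule sum.cong[OF refl])
       (subst sum.reindex_bij_betw[OF bij, symmetric], rule refl)
  also have "\<dots> = hess_polar d (\<lambda>i. b (d - i)) (\<lambda>i. c (d - i)) n"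
    unfolding hess_polar_def using assms by (intro sum.cong refl) (auto simp: hess_weight_reverse)
  finally show ?thesis ..
qed

text \<open>The tool for determining coefficients one at a time: once all other products agree, the
  Hessian coefficient isolates \<open>b i * b j\<close>. The factor 2 counts the ordered pairs (i,
  j) and (j, i).\<close>

lemma hess_quad_diff:
  assumes "i \<le> d" "j \<le> d" "i + j = n + 2"
    and eq: "\<And>k l. k \<le> d \<Longrightarrow> l \<le> d \<Longrightarrow> k + l = n + 2 \<Longrightarrow> k \<noteq> i \<Longrightarrow> k \<noteq> j \<Longrightarrow> b k * b l = c k * c l"
  shows "hess_quad d b n - hess_quad d c n = (if i = j then 1 else 2) * of_int (hess_weight d i j) * (b i * b j - c i * c j)"
proof -
  let ?f = "\<lambda>k. if k \<le> n + 2 \<and> n + 2 - k \<le> d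
    then of_int (hess_weight d k (n + 2 - k)) * (b k * b (n + 2 - k) - c k * c (n + 2 - k)) else 0"
  have "hess_quad d b n - hess_quad d c n = (\<Sum>k\<le>d. ?f k)"
    unfolding hess_polar_alt sum_subtractf[symmetric] by (intro sum.cong refl) (simp add: algebra_simps)
  also have "\<dots> = (\<Sum>k\<in>{i, j}. ?f k)"
  proof (rule sum.mono_neutral_right)
    show "\<forall>k\<in>{..d} - {i, j}. ?f k = 0"
    proof
      fix k assume "k \<in> {..d} - {i, j}"
      then show "?f k = 0" using eq[of k "n + 2 - k"] by simp
    qed
  qed (use assms in auto)
  also have "\<dots> = (if i = j then 1 else 2) * of_int (hess_weight d i j) * (b i * b j - c i * c j)"
  proof -
    have "n + 2 - i = j" "n + 2 - j = i" "i \<le> n + 2" "j \<le> n + 2" using assms(3) by auto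
    then show ?thesis
      using assms(1,2) hess_weight_commute[of d i j] by (cases "i = j") (simp_all add: algebra_simps)
  qed
  finally show ?thesis .
qed

lemma hess_polar_graph:
  assumes G: "hom_graph G" and "\<And>i. i \<le> d \<Longrightarrow> (b i, b' i) \<in> G" "\<And>i. i \<le> d \<Longrightarrow> (c i, c' i) \<in> G"
  shows "(hess_polar d b c n, hess_polar d b' c' n) \<in> G"
  unfolding hess_polar_alt using assms
  by (intro graph_sum[OF G]) (auto intro: graph_zero[OF G] graph_mult[OF G] graph_of_int[OF G])

text \<open>The same quadratic expression as a differential operator, in which translations of the
  variable and powers of linear polynomials are easy to treat.\<close>

definition hess_poly :: "nat \<Rightarrow> 'a::field poly \<Rightarrow> 'a poly" where
  "hess_poly d p = smult (2 * of_nat d) (p * pderiv (pderiv p)) - smult (2 * (of_nat d - 1)) ((pderiv p)\<^sup>2)"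

lemma hess_quad_poly:
  assumes "degree p \<le> d"
  shows "hess_quad d (coeff p) n = coeff (hess_poly d p) n"
proof -
  let ?s = "\<lambda>f. \<Sum>i\<le>n+2. f i * (coeff p i * coeff p (n + 2 - i))"
  have A: "coeff (p * pderiv (pderiv p)) n = ?s (\<lambda>i. of_nat (n + 2 - i) * (of_nat (n + 2 - i) - 1))"
  proof -
    have "coeff (p * pderiv (pderiv p)) n =
        (\<Sum>i\<le>n. (of_nat (n + 2 - i) * (of_nat (n + 2 - i) - 1)) * (coeff p i * coeff p (n + 2 - i)))"
      unfolding coeff_mult
      by (intro sum.cong refl) (simp add: coeff_pderiv Suc_diff_le algebra_simps)
    also have "\<dots> = ?s (\<lambda>i. of_nat (n + 2 - i) * (of_nat (n + 2 - i) - 1))"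
      by (rule sum.mono_neutral_left) (auto simp: le_Suc_eq not_le)
    finally show ?thesis .
  qed
  \<comment> \<open>Together with \<open>A\<close> this supplies both i (i - 1) and j (j - 1) in the
    symmetric \<open>hess_weight\<close>.\<close>
  have A': "?s (\<lambda>i. of_nat (n + 2 - i) * (of_nat (n + 2 - i) - 1)) = ?s (\<lambda>i. of_nat i * (of_nat i - 1))"
    by (rule sum.reindex_bij_witness[where i = "\<lambda>i. n + 2 - i" and j = "\<lambda>i. n + 2 - i"]) auto
  have B: "coeff ((pderiv p)\<^sup>2) n = ?s (\<lambda>i. of_nat i * of_nat (n + 2 - i))"
  proof -
    have "coeff ((pderiv p)\<^sup>2) n = (\<Sum>i\<le>n. (of_nat (Suc i) * of_nat (n + 2 - Suc i)) * (coeff p (Suc i) * coeff p (n + 2 - Suc i)))"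
      unfolding power2_eq_square coeff_mult
      by (intro sum.cong refl) (simp add: coeff_pderiv Suc_diff_le algebra_simps)
    also have "\<dots> = (\<Sum>i\<in>Suc ` {..n}. (of_nat i * of_nat (n + 2 - i)) * (coeff p i * coeff p (n + 2 - i)))"
      by (subst sum.reindex) auto
    also have "\<dots> = ?s (\<lambda>i. of_nat i * of_nat (n + 2 - i))"
    proof (rule sum.mono_neutral_left)
      show "\<forall>i\<in>{..n + 2} - Suc ` {..n}. of_nat i * of_nat (n + 2 - i) * (coeff p i * coeff p (n + 2 - i)) = 0"
      proof
        fix i assume i: "i \<in> {..n + 2} - Suc ` {..n}"
        then have "i = 0 \<or> i = n + 2"
          by (cases i) (auto simp: image_iff)
        then show "of_nat i * of_nat (n + 2 - i) * (coeff p i * coeff p (n + 2 - i)) = 0" by auto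
      qed
    qed auto
    finally show ?thesis .
  qed
  have "hess_quad d (coeff p) n = ?s (\<lambda>i. of_int (hess_weight d i (n + 2 - i)))"
  proof -
    let ?t = "\<lambda>i. of_int (hess_weight d i (n + 2 - i)) * (coeff p i * coeff p (n + 2 - i))"
    have "hess_quad d (coeff p) n = (\<Sum>i\<in>{..d} \<inter> {..n+2}. ?t i)"
      unfolding hess_polar_alt
      by (subst sum.inter_restrict)
         (auto intro!: sum.cong simp: not_le coeff_eq_0 le_less_trans[OF assms])
    also have "\<dots> = (\<Sum>i\<le>n+2. ?t i)"
      by (rule sum.mono_neutral_left) (auto simp: not_le coeff_eq_0 le_less_trans[OF assms])
    finally show ?thesis by simp
  qed
  also have "\<dots> = of_nat d * (?s (\<lambda>i. of_nat i * (of_nat i - 1)) + ?s (\<lambda>i. of_nat (n + 2 - i) * (of_nat (n + 2 - i) - 1)))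
      - 2 * (of_nat d - 1) * ?s (\<lambda>i. of_nat i * of_nat (n + 2 - i))"
    unfolding sum.distrib[symmetric] sum_distrib_left sum_subtractf[symmetric]
    by (intro sum.cong refl) (simp add: hess_weight_def of_nat_diff algebra_simps)
  also have "\<dots> = coeff (hess_poly d p) n"
    unfolding hess_poly_def coeff_diff coeff_smult A B A' by (simp add: algebra_simps)
  finally show ?thesis .
qed

lemma hess_poly_pcompose: "hess_poly d (pcompose p [:r, 1:]) = pcompose (hess_poly d p) [:r, 1:]"
  by (simp add: hess_poly_def pderiv_pcompose pcompose_mult pcompose_diff pcompose_smult power2_eq_square
      pderiv_pCons)

lemma coeff_linear_power:
  "coeff ([:r, 1:] ^ i) k = of_nat (i choose k) * (r::'a::field) ^ (i - k)"
proof (cases "k \<le> i")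
  case False
  then show ?thesis
    by (subst coeff_eq_0) (auto simp: degree_linear_power binomial_eq_0)
qed (simp add: coeff_linear_poly_power)

lemma coeff_pcompose_linear:
  fixes p :: "'a::field poly"
  assumes "degree p \<le> N"
  shows "coeff (pcompose p [:r, 1:]) k = (\<Sum>i\<le>N. coeff p i * of_nat (i choose k) * r ^ (i - k))"
proof -
  have "pcompose p [:r, 1:] = (\<Sum>i\<le>N. smult (coeff p i) ([:r, 1:] ^ i))"
    unfolding pcompose_altdef
    by (subst poly_as_sum_upto[where n = N]) (use assms in \<open>auto simp: coeff_map_poly degree_map_poly\<close>)
  then show ?thesis
    by (simp add: coeff_sum coeff_linear_power mult.assoc)
qed

text \<open>With d = e + 2, both terms are multiples of the square of \<open>l ^ (d - 1)\<close>,
  and the factors 2 d * d (d - 1) c^2 and 2 (d - 1) (d c)^2 coincide.\<close>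

lemma hess_poly_power: fixes l :: "'a::field poly"
  assumes "pderiv l = [:c:]"
  shows "hess_poly (Suc (Suc e)) (l ^ Suc (Suc e)) = 0"
proof -
    have 1: "pderiv (l ^ Suc (Suc e)) = smult (of_nat (e + 2) * c) (l ^ Suc e)"
      unfolding pderiv_power_Suc assms by (simp add: mult.commute del: power_Suc)
    have 2: "pderiv (pderiv (l ^ Suc (Suc e))) = smult (of_nat (e + 2) * c * (of_nat (e + 1) * c)) (l ^ e)"
      unfolding 1 by (simp only: pderiv_smult pderiv_power_Suc assms) (simp add: algebra_simps del: power_Suc)
    have 3: "l ^ Suc (Suc e) * l ^ e = (l ^ Suc e)\<^sup>2"
      by (simp add: power2_eq_square ac_simps)
    have "hess_poly (Suc (Suc e)) (l ^ Suc (Suc e)) = smult (2 * of_nat (Suc (Suc e)) * (of_nat (e + 2) * c * (of_nat (e + 1) * c))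
        - 2 * (of_nat (Suc (Suc e)) - 1) * (of_nat (e + 2) * c)\<^sup>2) ((l ^ Suc e)\<^sup>2)"
      unfolding hess_poly_def 2 unfolding 1 by (simp only: mult_smult_right smult_smult smult_power smult_diff_left 3)
    also have "2 * of_nat (Suc (Suc e)) * (of_nat (e + 2) * c * (of_nat (e + 1) * c))
        - 2 * (of_nat (Suc (Suc e)) - 1) * (of_nat (e + 2) * c)\<^sup>2 = 0"
      by (simp add: power2_eq_square algebra_simps)
    finally show ?thesis by simp
qed

text \<open>These are the coefficients of g (1 + c x)^d, the comparison form in
  \<open>fibre_unit\<close>.\<close>

lemma hess_quad_binomial: "hess_quad d (\<lambda>i. g * of_nat (d choose i) * c ^ i) n = (0::'a::field)"
proof -
  let ?p = "[:1, c:] ^ d"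
  have "hess_poly d ?p = 0"
  proof (cases "d \<ge> 2")
    case False
    then have "d = 0 \<or> d = 1" by linarith
    then show ?thesis by (auto simp: hess_poly_def pderiv_pCons)
  next
    case True
    then obtain e where d: "d = Suc (Suc e)" by (metis add_2_eq_Suc le_Suc_ex)
    show ?thesis
      unfolding d by (rule hess_poly_power) (simp add: pderiv_pCons)
  qed
  moreover have "degree ?p \<le> d"
  proof -
    have "degree ?p \<le> degree [:1, c:] * d" by (rule degree_power_le)
    also have "\<dots> \<le> 1 * d" by (intro mult_right_mono) auto
    finally show ?thesis by simp
  qed
  ultimately have "hess_quad d (coeff ?p) n = 0" by (simp add: hess_quad_poly)
  moreover have "hess_quad d (\<lambda>i. g * of_nat (d choose i) * c ^ i) n = hess_quad d (\<lambda>i. g * coeff ?p i) n"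
    by (rule hess_polar_cong) (simp_all add: coeff_linear_poly_power mult.assoc)
  ultimately show ?thesis by (simp add: hess_polar_scale_left hess_polar_scale_right)
qed

section \<open>The fibre of the Hessian map over a special form\<close>

definition special_exp :: "nat \<Rightarrow> nat" where
  "special_exp d = (d - 1) div 2"

text \<open>The special form \<open>x ^ a + x ^ (d - a)\<close> with \<open>a = special_exp d\<close>. Since \<open>2 \<le> a\<close>, a form with a proportional
  Hessian either vanishes at \<open>0\<close> to order \<open>a\<close> or agrees with a \<open>d\<close>-th power up to order \<open>2 * a\<close>, and
  likewise at infinity; since \<open>a\<close> is close to \<open>d / 2\<close>, the two expansions overlap.\<close>

definition special_form :: "nat \<Rightarrow> nat \<Rightarrow> 'a::comm_ring_1" where
  "special_form d i = (if i = special_exp d \<or> i = d - special_exp d then 1 else 0)"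

lemma special_exp_bounds:
  assumes "d \<ge> 5"
  shows "2 \<le> special_exp d" "2 * special_exp d < d" "d \<le> 2 * special_exp d + 2" "special_exp d < d - special_exp d" "special_exp d \<le> d"
  using assms by (auto simp: special_exp_def)

lemma special_form_split:
  assumes "d \<ge> 5"
  shows "special_form d = (\<lambda>i. (if i = special_exp d then 1 else 0) + (if i = d - special_exp d then 1 else 0 :: 'a::comm_ring_1))"
  using special_exp_bounds[OF assms] by (auto simp: special_form_def fun_eq_iff)

lemma special_form_reverse: "d \<ge> 5 \<Longrightarrow> i \<le> d \<Longrightarrow> special_form d (d - i) = special_form d i"
  using special_exp_bounds[of d] by (auto simp: special_form_def)

lemma hess_polar_special_form:
  assumes d: "d \<ge> 5"
  shows "hess_polar d (special_form d) c n =
    (if special_exp d \<le> n + 2 \<and> n + 2 - special_exp d \<le> d then of_int (hess_weight d (special_exp d) (n + 2 - special_exp d)) * c (n + 2 - special_exp d) else 0) +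
    (if d - special_exp d \<le> n + 2 \<and> n + 2 - (d - special_exp d) \<le> d
     then of_int (hess_weight d (d - special_exp d) (n + 2 - (d - special_exp d))) * c (n + 2 - (d - special_exp d)) else 0)"
  unfolding special_form_split[OF d] hess_polar_add_left using special_exp_bounds[OF d] by (simp add: hess_polar_delta)

lemma hess_polar_zero: "hess_polar d (\<lambda>_. 0) c n = 0"
  unfolding hess_polar_def by (intro sum.neutral ballI) simp

lemma hess_polar_delta_delta:
  assumes "k \<le> d" "l \<le> d"
  shows "hess_polar d (\<lambda>i. if i = k then 1 else 0) (\<lambda>i. if i = l then 1 else 0) n =
    (if k + l = n + 2 then of_int (hess_weight d k l) else (0::'a::comm_ring_1))"
  using assms by (auto simp: hess_polar_delta)

lemma hess_quad_special_form:
  assumes d: "d \<ge> 5"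
  shows "hess_quad d (special_form d :: nat \<Rightarrow> 'a::comm_ring_1) n =
    (if n + 2 = 2 * special_exp d \<or> n + 2 = 2 * (d - special_exp d) then of_int (hess_weight d (special_exp d) (special_exp d))
     else if n + 2 = d then 2 * of_int (hess_weight d (special_exp d) (d - special_exp d)) else 0)"
proof -
  note b = special_exp_bounds[OF d]
  define e where "e = d - special_exp d"
  have e: "e \<le> d" "special_exp d < e" "d = special_exp d + e" using b by (auto simp: e_def)
  have r: "hess_weight d e e = hess_weight d (special_exp d) (special_exp d)"
    using b by (simp add: e_def hess_weight_reverse)
  have "hess_quad d (special_form d :: nat \<Rightarrow> 'a) n =
      (if special_exp d + special_exp d = n + 2 then of_int (hess_weight d (special_exp d) (special_exp d)) else 0) +
      (if special_exp d + e = n + 2 then of_int (hess_weight d (special_exp d) e) else 0) +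
      ((if e + special_exp d = n + 2 then of_int (hess_weight d e (special_exp d)) else 0) +
       (if e + e = n + 2 then of_int (hess_weight d e e) else 0))"
    unfolding special_form_split[OF d] hess_polar_add_left hess_polar_add_right e_def[symmetric]
    by (simp only: hess_polar_delta_delta b(5) e(1))
  moreover have "n + 2 = 2 * special_exp d \<longleftrightarrow> special_exp d + special_exp d = n + 2" "n + 2 = 2 * e \<longleftrightarrow> e + e = n + 2"
    "n + 2 = d \<longleftrightarrow> special_exp d + e = n + 2" "e + special_exp d = special_exp d + e"
    using e by auto
  ultimately show ?thesis
    unfolding e_def[symmetric] r hess_weight_commute[of d e "special_exp d"] using e(2) by simp
qed

lemma hess_quad_special_form_special_exp: "d \<ge> 5 \<Longrightarrow> hess_quad d (special_form d) (2 * special_exp d - 2) = of_int (hess_weight d (special_exp d) (special_exp d))"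
  using special_exp_bounds[of d] by (subst hess_quad_special_form) auto

lemma hess_quad_special_form_low: "d \<ge> 5 \<Longrightarrow> n + 2 < 2 * special_exp d \<Longrightarrow> hess_quad d (special_form d) n = 0"
  using special_exp_bounds[of d] by (auto simp: hess_quad_special_form)

lemma hess_weight_special_exp_nonzero: "d \<ge> 5 \<Longrightarrow> s \<le> d \<Longrightarrow> hess_weight d (special_exp d) s \<noteq> 0"
  by (rule hess_weight_middle_nonzero) (auto simp: special_exp_def)

text \<open>The first nonzero coefficient \<open>g s\<close> with \<open>0 < s < d\<close> shows up squared in the Hessian.\<close>

lemma hess_quad_low_vanish:
  fixes g :: "nat \<Rightarrow> 'a::field_char_0"
  assumes "\<And>n. n + 2 < 2 * a \<Longrightarrow> hess_quad d g n = 0" and "g 0 = 0" "a \<le> d" "i < a"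
  shows "g i = 0"
  using assms(4)
proof (induction i rule: less_induct)
  case (less s)
  show ?case
  proof (cases "s = 0")
    case False
    have "hess_quad d g (2 * s - 2) - hess_quad d (\<lambda>_. 0) (2 * s - 2) =
        (if s = s then 1 else 2) * of_int (hess_weight d s s) * (g s * g s - 0 * 0)"
    proof (rule hess_quad_diff)
      fix k l assume "k \<le> d" "l \<le> d" "k + l = 2 * s - 2 + 2" "k \<noteq> s"
      then have "k < s \<or> l < s" using False by linarith
      then show "g k * g l = 0 * 0" using less by auto
    qed (use False less.prems assms(3) in auto)
    moreover have "hess_quad d g (2 * s - 2) = 0"
      using False less.prems by (intro assms(1)) auto
    moreover have "hess_quad d (\<lambda>_. 0) (2 * s - 2) = (0::'a)" by (rule hess_polar_zero)
    moreover have "hess_weight d s s \<noteq> 0" using False less.prems assms(3) by (auto simp: hess_weight_diag)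
    ultimately show ?thesis by simp
  qed (simp add: assms)
qed

text \<open>Write a for \<open>special_exp d\<close>. The coefficient of index 2 a - 2 shows that
  \<open>lam\<close> is the square of \<open>g a\<close>. After that the coefficient of index a + i
  - 2 determines \<open>g i\<close>: the other products vanish or are known, and the pivot
  \<open>hess_weight d a i\<close> is nonzero.\<close>

lemma fibre_order:
  fixes g :: "nat \<Rightarrow> 'a::field_char_0"
  assumes d: "d \<ge> 5" and eq: "\<And>n. hess_quad d g n = lam * hess_quad d (special_form d) n" and lam: "lam \<noteq> 0"
    and low: "\<And>i. i < special_exp d \<Longrightarrow> g i = 0"
  shows "g (special_exp d) \<noteq> 0" "i \<le> d \<Longrightarrow> g i = g (special_exp d) * special_form d i"
proof -
  let ?a = "special_exp d"
  note b = special_exp_bounds[OF d]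
  have "hess_quad d g (2 * ?a - 2) - hess_quad d (\<lambda>_. 0) (2 * ?a - 2) =
      (if ?a = ?a then 1 else 2) * of_int (hess_weight d ?a ?a) * (g ?a * g ?a - 0 * 0)"
  proof (rule hess_quad_diff)
    fix k l assume "k \<le> d" "l \<le> d" "k + l = 2 * ?a - 2 + 2" "k \<noteq> ?a"
    then have "k < ?a \<or> l < ?a" using b by linarith
    then show "g k * g l = 0 * 0" using low by auto
  qed (use b in auto)
  then have "lam * of_int (hess_weight d ?a ?a) = of_int (hess_weight d ?a ?a) * (g ?a * g ?a)"
    using b by (simp add: eq hess_quad_special_form_special_exp[OF d] hess_polar_zero)
  then have lam': "lam = g ?a * g ?a" using hess_weight_special_exp_nonzero[OF d b(5)] by simp
  then show "g ?a \<noteq> 0" using lam by auto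
  define c where "c i = g ?a * special_form d i" for i
  have c: "hess_quad d c n = hess_quad d g n" for n
    unfolding eq lam' c_def hess_polar_scale_left hess_polar_scale_right by simp
  have "g i = c i" if "i \<le> d"
    using that
  proof (induction i rule: less_induct)
    case (less i)
    consider "i < ?a" | "i = ?a" | "i > ?a" by linarith
    then show ?case
    proof cases
      case 1
      then show ?thesis using low b by (auto simp: c_def special_form_def)
    next
      case 2
      then show ?thesis by (simp add: c_def special_form_def)
    next
      case 3
      have "hess_quad d g (?a + i - 2) - hess_quad d c (?a + i - 2) =
          (if ?a = i then 1 else 2) * of_int (hess_weight d ?a i) * (g ?a * g i - c ?a * c i)"
      proof (rule hess_quad_diff)
        fix k l assume kl: "k \<le> d" "l \<le> d" "k + l = ?a + i - 2 + 2" "k \<noteq> ?a" "k \<noteq> i"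
        then consider "k < ?a" | "l < ?a" | "k < i" "l < i" using b by linarith
        then show "g k * g l = c k * c l"
        proof cases
          case 3
          then show ?thesis using less.IH kl by auto
        qed (use low b in \<open>auto simp: c_def special_form_def\<close>)
      qed (use b less.prems 3 in auto)
      then show ?thesis
        using 3 hess_weight_special_exp_nonzero[OF d less.prems] \<open>g ?a \<noteq> 0\<close> by (simp add: c) (simp add: c_def special_form_def)
    qed
  qed
  then show "i \<le> d \<Longrightarrow> g i = g ?a * special_form d i" by (simp add: c_def)
qed

text \<open>For i \<ge> 2 the coefficient of index i - 2 determines \<open>g i\<close> from the
  smaller ones, because the weight d i (i - 1) of the pair (0, i) is nonzero. The binomial form has
  zero Hessian and the same first two coefficients, so it solves the same recursion.\<close>

lemma fibre_unit:
  fixes g :: "nat \<Rightarrow> 'a::field_char_0"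
  assumes "\<And>n. n + 2 < M \<Longrightarrow> hess_quad d g n = 0" and "g 0 \<noteq> 0" "0 < d" "i < M" "i \<le> d"
  shows "g i = g 0 * of_nat (d choose i) * (g 1 / (of_nat d * g 0)) ^ i"
  using assms(4,5)
proof (induction i rule: less_induct)
  case (less i)
  define c where "c i = g 0 * of_nat (d choose i) * (g 1 / (of_nat d * g 0)) ^ i" for i
  consider "i = 0" | "i = 1" | "i \<ge> 2" by linarith
  then show ?case
  proof cases
    case 3
    have "hess_quad d g (i - 2) - hess_quad d c (i - 2) =
        (if 0 = i then 1 else 2) * of_int (hess_weight d 0 i) * (g 0 * g i - c 0 * c i)"
    proof (rule hess_quad_diff)
      fix k l assume "k \<le> d" "l \<le> d" "k + l = i - 2 + 2" "k \<noteq> 0" "k \<noteq> i"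
      then show "g k * g l = c k * c l"
        using less.IH[of k] less.IH[of l] less.prems 3 by (simp add: c_def)
    qed (use 3 less.prems in auto)
    moreover have "hess_quad d g (i - 2) = 0" using 3 less.prems by (intro assms(1)) auto
    moreover have "hess_quad d c (i - 2) = 0" unfolding c_def by (rule hess_quad_binomial)
    moreover have "hess_weight d 0 i \<noteq> 0" using 3 less.prems by (auto simp: hess_weight_zero)
    ultimately have "g i = c i" using 3 assms(2) by (auto simp: c_def)
    then show ?thesis by (simp add: c_def)
  qed (use assms in auto)
qed

text \<open>For \<open>d = 6\<close> the two expansions overlap in the middle coefficient only, and the remaining
  Hessian coefficients have to be inspected.\<close>

lemma fibre_six:
  fixes g :: "nat \<Rightarrow> 'a::field_char_0"
  assumes eq: "\<And>n. hess_quad 6 g n = lam * hess_quad 6 (special_form 6) n" and lam: "lam \<noteq> 0"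
    and nz: "g 0 \<noteq> 0" "c \<noteq> 0" "e \<noteq> 0"
    and lo: "\<And>i. i < 4 \<Longrightarrow> g i = g 0 * of_nat (6 choose i) * c ^ i"
    and hi: "\<And>i. i < 4 \<Longrightarrow> g (6 - i) = g 6 * of_nat (6 choose i) * e ^ i"
  shows "c * e = 1"
proof (rule ccontr)
  assume ne: "c * e \<noteq> 1"
  have ch: "6 choose 2 = (15::nat)" "6 choose 3 = (20::nat)"
    by code_simp+
  have g1: "g 1 = 6 * g 0 * c" and g2: "g 2 = 15 * g 0 * c ^ 2" and g3: "g 3 = 20 * g 0 * c ^ 3"
    using lo[of 1] lo[of 2] lo[of 3] ch by simp_all
  have g5: "g 5 = 6 * g 6 * e" and g4: "g 4 = 15 * g 6 * e ^ 2" and g3': "g 3 = 20 * g 6 * e ^ 3"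
    using hi[of 1] hi[of 2] hi[of 3] ch by simp_all
  have s: "special_exp 6 = 2" by (simp add: special_exp_def)
  have sixth: "g 6 * e ^ 3 = g 0 * c ^ 3" using g3 g3' by simp
  \<comment> \<open>The Hessian of the special form of degree 6 has only the exponents 2, 4 and 6,
    so index 3 gives an equation for \<open>c\<close> and \<open>e\<close>.\<close>
  have "hess_quad 6 g 3 = 0" unfolding eq by (simp add: hess_quad_special_form s)
  then have "240 * g 0 * g 5 + 64 * g 1 * g 4 - 24 * g 2 * g 3 = 0"
    by (simp add: hess_polar_alt hess_weight_def atMost_nat_numeral algebra_simps)
  then have "1440 * g 0 * (g 6 * e + 4 * c * e ^ 2 * g 6 - 5 * g 0 * c ^ 5) = 0"
    unfolding g1 g2 g3 g4 g5 by (simp add: algebra_simps power2_eq_square power3_eq_cube eval_nat_numeral)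
  then have "g 6 * e + 4 * c * e ^ 2 * g 6 - 5 * g 0 * c ^ 5 = 0" using nz by simp
  \<comment> \<open>With this factor \<open>g 6\<close> occurs only in \<open>g 6 * e ^ 3\<close>,
    which equals \<open>g 0 * c ^ 3\<close>; what remains is an equation in
    \<open>c * e\<close>.\<close>
  then have "e ^ 2 * (g 6 * e + 4 * c * e ^ 2 * g 6 - 5 * g 0 * c ^ 5) = 0" by simp
  then have "(g 6 * e ^ 3) * (1 + 4 * (c * e)) - 5 * g 0 * c ^ 5 * e ^ 2 = 0"
    by (simp add: algebra_simps power2_eq_square power3_eq_cube)
  then have "g 0 * c ^ 3 * (1 + 4 * (c * e) - 5 * (c * e) ^ 2) = 0"
    unfolding sixth by (simp add: algebra_simps eval_nat_numeral)
  then have "1 + 4 * (c * e) - 5 * (c * e) ^ 2 = 0"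
    using nz by (metis mult_eq_0_iff power_eq_0_iff)
  then have "(1 - c * e) * (1 + 5 * (c * e)) = 0"
    by (simp add: algebra_simps power2_eq_square)
  \<comment> \<open>The spurious root -1/5 determines g from \<open>g 0\<close> and
    \<open>c\<close>; it is refuted by the proportions of the remaining Hessian
    coefficients.\<close>
  then have ce: "5 * (c * e) = - 1" using ne by (simp add: eq_neg_iff_add_eq_0 add.commute)
  have h: "g 6 = - 125 * g 0 * c ^ 6"
  proof -
    have "(5 * (c * e)) ^ 3 * g 6 = 125 * c ^ 3 * (g 6 * e ^ 3)"
      by (simp add: power_mult_distrib)
    then have "- g 6 = 125 * c ^ 3 * (g 0 * c ^ 3)"
      unfolding sixth ce by simp
    then have "g 6 = - (125 * c ^ 3 * (g 0 * c ^ 3))" by (metis minus_minus)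
    then show ?thesis by (simp add: eval_nat_numeral algebra_simps)
  qed
  have e1: "g 5 = 150 * g 0 * c ^ 5"
  proof -
    have "g 5 = 6 * (- 125 * g 0 * c ^ 5) * (c * e)"
      unfolding g5 h by (simp add: eval_nat_numeral algebra_simps)
    also have "\<dots> = 6 * (- 25 * g 0 * c ^ 5) * (5 * (c * e))" by simp
    finally show ?thesis unfolding ce by simp
  qed
  have e2: "g 4 = - 75 * g 0 * c ^ 4"
  proof -
    have "g 4 = 15 * (- 5 * g 0 * c ^ 4) * (5 * (c * e)) ^ 2"
      unfolding g4 h by (simp add: eval_nat_numeral algebra_simps)
    then show ?thesis unfolding ce by simp
  qed
  note all = g1 g2 g3 e1 e2 h
  have "hess_quad 6 g 2 = 2 * (72 * g 0 * g 4 + 6 * g 1 * g 3 - 8 * g 2 * g 2)"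
    by (simp add: hess_polar_alt hess_weight_def atMost_nat_numeral algebra_simps)
  then have H2: "hess_quad 6 g 2 = - 12960 * (g 0)\<^sup>2 * c ^ 4"
    unfolding all by (simp add: eval_nat_numeral algebra_simps)
  have "hess_quad 6 g 4 = 2 * (180 * g 0 * g 6 + 70 * g 1 * g 5 + 4 * g 2 * g 4 - 9 * g 3 * g 3)"
    by (simp add: hess_polar_alt hess_weight_def atMost_nat_numeral algebra_simps)
  then have H4: "hess_quad 6 g 4 = 64800 * (g 0)\<^sup>2 * c ^ 6"
    unfolding all by (simp add: eval_nat_numeral algebra_simps)
  have "hess_quad 6 g 6 = 2 * (72 * g 2 * g 6 + 6 * g 3 * g 5 - 8 * g 4 * g 4)"
    by (simp add: hess_polar_alt hess_weight_def atMost_nat_numeral algebra_simps)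
  then have H6: "hess_quad 6 g 6 = - 324000 * (g 0)\<^sup>2 * c ^ 8"
    unfolding all by (simp add: eval_nat_numeral algebra_simps)
  have "hess_quad 6 g 2 = - 16 * lam" "hess_quad 6 g 4 = 8 * lam" "hess_quad 6 g 6 = - 16 * lam"
    unfolding eq by (simp_all add: hess_quad_special_form s hess_weight_def)
  \<comment> \<open>The special Hessian has the coefficients -16, 8, -16, and 4 * 8^2 = 16^2. For
    the spurious solution the two sides differ by a factor of 4.\<close>
  then have "4 * (hess_quad 6 g 4)\<^sup>2 = hess_quad 6 g 2 * hess_quad 6 g 6"
    by (simp add: power2_eq_square)
  then have "4 * (64800 * (g 0)\<^sup>2 * c ^ 6)\<^sup>2 = 12960 * 324000 * ((g 0)\<^sup>2 * c ^ 6)\<^sup>2"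
    unfolding H2 H4 H6 by (simp add: eval_nat_numeral algebra_simps)
  then have "(16796160000 - 4199040000) * ((g 0)\<^sup>2 * c ^ 6)\<^sup>2 = 0"
    by (simp add: algebra_simps power2_eq_square)
  then show False using nz by simp
qed

text \<open>If g vanishes at 0 or at infinity, \<open>fibre_order\<close> applies to it or to its
  reversal. Otherwise g agrees with a d-th power of parameter \<open>c\<close> below order 2 a, and
  with one of parameter \<open>e\<close> from the other end. The overlap forces c e = 1, so g is
  itself a d-th power and has zero Hessian, against \<open>lam \<noteq> 0\<close>.\<close>

theorem fibre_special_form:
  fixes g :: "nat \<Rightarrow> 'a::field_char_0"
  assumes d: "d \<ge> 5" and eq: "\<And>n. hess_quad d g n = lam * hess_quad d (special_form d) n" and lam: "lam \<noteq> 0"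
  shows "g (special_exp d) \<noteq> 0 \<and> (\<forall>i\<le>d. g i = g (special_exp d) * special_form d i)"
proof -
  let ?a = "special_exp d"
  note b = special_exp_bounds[OF d]
  define r where "r i = g (d - i)" for i
  have req: "hess_quad d r n = lam * hess_quad d (special_form d) n" for n
  proof (cases "n \<le> 2 * d - 4")
    case True
    have "hess_quad d r n = hess_quad d g (2 * d - 4 - n)" "hess_quad d (\<lambda>i. special_form d (d - i)) n = hess_quad d (special_form d) (2 * d - 4 - n)"
      unfolding r_def using d True by (simp_all add: hess_polar_reverse)
    moreover have "hess_quad d (\<lambda>i. special_form d (d - i)) n = hess_quad d (special_form d) n"
      by (rule hess_polar_cong) (simp_all add: special_form_reverse d)
    ultimately show ?thesis by (metis eq)
  qed (simp add: hess_polar_above)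
  have low: "n + 2 < 2 * ?a \<Longrightarrow> hess_quad d g n = 0" "n + 2 < 2 * ?a \<Longrightarrow> hess_quad d r n = 0" for n
    by (simp_all add: eq req hess_quad_special_form_low[OF d])
  show ?thesis
  proof (cases "g 0 = 0 \<or> r 0 = 0")
    case True
    then show ?thesis
    proof
      assume "g 0 = 0"
      then have "g i = 0" if "i < ?a" for i
        using hess_quad_low_vanish[of ?a d g] low b that by simp
      then show ?thesis using fibre_order[OF d eq lam] by blast
    next
      assume "r 0 = 0"
      then have "r i = 0" if "i < ?a" for i
        using hess_quad_low_vanish[of ?a d r] low b that by simp
      note * = fibre_order[OF d req lam this]
      have "g i = r ?a * special_form d i" if "i \<le> d" for i
        using *(2)[of "d - i"] that by (simp add: r_def special_form_reverse[OF d])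
      moreover from this[OF b(5)] have "g ?a = r ?a" by (simp add: special_form_def)
      ultimately show ?thesis using *(1) by auto
    qed
  next
    case False
    define c where "c = g 1 / (of_nat d * g 0)"
    define e where "e = r 1 / (of_nat d * r 0)"
    have gc: "g i = g 0 * of_nat (d choose i) * c ^ i" if "i < 2 * ?a" for i
      unfolding c_def using False that d b by (intro fibre_unit[of "2 * ?a"] low) auto
    have re: "r i = r 0 * of_nat (d choose i) * e ^ i" if "i < 2 * ?a" for i
      unfolding e_def using False that d b by (intro fibre_unit[of "2 * ?a"] low) auto
    have ov: "g 0 * c ^ i = r 0 * e ^ (d - i)" if "i < 2 * ?a" "d - i < 2 * ?a" for i
    proof -
      have "r (d - i) = g i" using that b by (simp add: r_def)
      then have "of_nat (d choose i) * (g 0 * c ^ i) = of_nat (d choose i) * (r 0 * e ^ (d - i))"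
        using gc[OF that(1)] re[OF that(2)] that b binomial_symmetric[of i d] by (simp add: ac_simps)
      moreover have "of_nat (d choose i) \<noteq> (0::'a)" using that b by simp
      ultimately show ?thesis by simp
    qed
    \<comment> \<open>Index 3 lies in the overlap for every d \<ge> 5; it ties the vanishing of
      \<open>c\<close> to that of \<open>e\<close> and later gives the value of
      \<open>r 0\<close>.\<close>
    have three: "3 < 2 * ?a" "d - 3 < 2 * ?a" using b d by linarith+
    have "hess_quad d g (2 * ?a - 2) \<noteq> 0"
      using lam b hess_weight_special_exp_nonzero[OF d b(5)] by (simp add: eq hess_quad_special_form_special_exp[OF d])
    moreover have "hess_quad d g (2 * ?a - 2) = 0"
    proof (cases "c = 0 \<or> e = 0")
      case True
      moreover have "c ^ 3 = 0 \<longleftrightarrow> e ^ (d - 3) = 0"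
        using ov[OF three] False by (metis mult_eq_0_iff)
      then have "c = 0 \<longleftrightarrow> e = 0" using d by simp
      ultimately have "c = 0" "e = 0" by auto
      \<comment> \<open>Only the two end coefficients survive, and end indices never add up to 2 a,
        as 0 < 2 a < d.\<close>
      have z: "g i = 0" if "0 < i" "i < d" for i
      proof (cases "i < 2 * ?a")
        case True
        then show ?thesis using gc[of i] \<open>c = 0\<close> that by simp
      next
        case False
        then have "d - i < 2 * ?a" using b d by linarith
        then show ?thesis using re[of "d - i"] \<open>e = 0\<close> that by (simp add: r_def)
      qed
      show ?thesis
        unfolding hess_polar_def
      proof (intro sum.neutral ballI)
        fix i j assume "i \<in> {..d}" "j \<in> {..d}"
        have "g i = 0 \<or> g j = 0" if "i + j = 2 * ?a - 2 + 2"
        proof -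
          have "i > 0 \<and> i < d \<or> j > 0 \<and> j < d" using that b by linarith
          then show ?thesis using z by blast
        qed
        then show "(if i + j = 2 * ?a - 2 + 2 then of_int (hess_weight d i j) * g i * g j else 0) = 0" by auto
      qed
    next
      case nz: False
      have ce: "c * e = 1"
      proof (cases "d = 6")
        case True
        have s: "special_exp d = 2" by (simp add: special_exp_def True)
        show ?thesis
        proof (rule fibre_six[OF _ lam])
          show "hess_quad 6 g n = lam * hess_quad 6 (special_form 6) n" for n
            using eq[of n] unfolding True .
          show "g 0 \<noteq> 0" "c \<noteq> 0" "e \<noteq> 0" using False nz by auto
          show "g i = g 0 * of_nat (6 choose i) * c ^ i" if "i < 4" for i
            using gc[of i] that unfolding True s[unfolded True] by simp
          show "g (6 - i) = g 6 * of_nat (6 choose i) * e ^ i" if "i < 4" for i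
            using re[of i] that unfolding True s[unfolded True] r_def by simp
        qed
      next
        case d6: False
        \<comment> \<open>Two consecutive indices of the overlap d - 2 a < i < 2 a, whose comparison
          gives c e = 1. Only d = 6 has no such pair.\<close>
        obtain i where i: "i < 2 * ?a" "d - i < 2 * ?a" "Suc i < 2 * ?a" "d - Suc i < 2 * ?a" "Suc i \<le> d"
        proof (cases "d = 2 * ?a + 1")
          case True
          then show ?thesis using that[of 2] b d by linarith
        next
          case False
          then have "d = 2 * ?a + 2" using b by linarith
          moreover from this have "d \<ge> 8" using d d6 by presburger
          ultimately
          show ?thesis using that[of 3] by linarith
        qed
        have e: "e ^ (d - i) = e ^ (d - Suc i) * e" using i(5) by (metis Suc_diff_Suc Suc_le_eq power_Suc2)
        have "r 0 * e ^ (d - Suc i) = g 0 * c ^ i * c" using ov[OF i(3,4)] by (simp add: ac_simps)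
        also have "\<dots> = r 0 * e ^ (d - Suc i) * (e * c)"
          unfolding ov[OF i(1,2)] e by (simp add: ac_simps)
        finally show ?thesis using False nz by (simp add: mult.commute)
      qed
      have pow: "c ^ n * e ^ n = 1" for n using ce by (simp add: power_mult_distrib[symmetric])
      have r0: "r 0 = g 0 * c ^ d"
      proof -
        have "g 0 * c ^ d = g 0 * c ^ 3 * c ^ (d - 3)"
          using d by (simp add: mult.assoc power_add[symmetric])
        also have "\<dots> = r 0 * (c ^ (d - 3) * e ^ (d - 3))"
          unfolding ov[OF three] by (simp add: ac_simps)
        finally show ?thesis by (simp add: pow)
      qed
      have all: "g i = g 0 * of_nat (d choose i) * c ^ i" if "i \<le> d" for i
      proof (cases "i < 2 * ?a")
        case False
        then have "d - i < 2 * ?a" using b d by linarith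
        from re[OF this] have "g i = g 0 * of_nat (d choose i) * (c ^ d * e ^ (d - i))"
          using that by (simp add: r_def binomial_symmetric[of i d]) (simp add: r0[unfolded r_def, simplified] ac_simps)
        also have "c ^ d * e ^ (d - i) = c ^ i * (c ^ (d - i) * e ^ (d - i))"
          using that by (simp add: mult.assoc[symmetric] power_add[symmetric])
        finally show ?thesis by (simp add: pow)
      qed (rule gc)
      have "hess_quad d g (2 * ?a - 2) = hess_quad d (\<lambda>i. g 0 * of_nat (d choose i) * c ^ i) (2 * ?a - 2)"
        by (rule hess_polar_cong[OF all all])
      then show ?thesis by (simp only: hess_quad_binomial)
    qed
    ultimately show ?thesis by contradiction
  qed
qed

section \<open>Limits of forms with a given Hessian\<close>

text \<open>Divisibility is total in a valuation ring, so a finite family can be divided by its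
  largest member. The quotient at \<open>t\<close> is 1, hence the normalized family has a nonzero
  reduction.\<close>

lemma max_valuation:
  assumes M: "place_graph M" and "finite I" "i0 \<in> I" "x i0 \<noteq> 0"
  shows "\<exists>t\<in>I. x t \<noteq> 0 \<and> (\<forall>i\<in>I. \<exists>u. (x i / x t, u) \<in> M)"
proof -
  note hM = local_graph_hom[OF place_graph_local[OF M]]
  have "\<exists>t\<in>S. \<forall>i\<in>S. \<exists>u. (x i / x t, u) \<in> M"
    if "finite S" "S \<noteq> {}" "\<And>i. i \<in> S \<Longrightarrow> x i \<noteq> 0" for S
    using that
  proof (induction S rule: finite_ne_induct)
    case (singleton j)
    then show ?case using graph_one[OF hM] by (auto intro!: exI[of _ 1])
  next
    case (insert j S)
    then obtain t where t: "t \<in> S" "\<And>i. i \<in> S \<Longrightarrow> \<exists>u. (x i / x t, u) \<in> M" by auto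
    show ?case
    proof (cases "\<exists>u. (x j / x t, u) \<in> M")
      case True
      then show ?thesis using t by blast
    next
      case False
      then have *: "(x t / x j, 0) \<in> M"
        using M by (metis inverse_divide place_graph_def)
      have "\<exists>u. (x i / x j, u) \<in> M" if iS: "i \<in> S" for i
      proof -
        obtain u where "(x i / x t, u) \<in> M" using t(2)[OF iS] by blast
        from graph_mult[OF hM this *] show ?thesis
          using insert.prems[of t] t(1) by auto
      qed
      then show ?thesis
        using graph_one[OF hM] insert.prems[of j] by (intro bexI[of _ j]) (auto intro!: exI[of _ 1])
    qed
  qed
  note max = this
  have "\<exists>t\<in>{i \<in> I. x i \<noteq> 0}. \<forall>i\<in>{i \<in> I. x i \<noteq> 0}. \<exists>u. (x i / x t, u) \<in> M"
    using assms(2-4) by (intro max) auto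
  then obtain t
    where t: "t \<in> I" "x t \<noteq> 0" "\<And>i. i \<in> I \<Longrightarrow> x i \<noteq> 0 \<Longrightarrow> \<exists>u. (x i / x t, u) \<in> M"
    by blast
  have "\<exists>u. (x i / x t, u) \<in> M" if "i \<in> I" for i
    using t(3)[OF that] graph_zero[OF hM] by (cases "x i = 0") auto
  then show ?thesis using t by blast
qed

text \<open>The Hessian of \<open>special_form d\<close> has three terms with exponents in arithmetic progression, so a
  nonzero root has multiplicity at most two; the root \<open>0\<close> has multiplicity \<open>2 * special_exp d - 2\<close>.\<close>

lemma special_form_root_multiplicity:
  fixes r :: "'a::field_char_0"
  assumes d: "d \<ge> 5"
  shows "\<exists>n<d - 2. (\<Sum>m\<le>2 * d - 4. hess_quad d (special_form d) m * of_nat (m choose n) * r ^ (m - n)) \<noteq> 0"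
proof (rule ccontr)
  define \<eta> where "\<eta> m = (hess_quad d (special_form d) m :: 'a)" for m
  let ?a = "special_exp d"
  note b = special_exp_bounds[OF d]
  define p w where "p = 2 * ?a - 2" and "w = d - 2 * ?a"
  have w: "w > 0" using b by (simp add: w_def)
  have \<eta>p: "\<eta> p \<noteq> 0"
    using hess_weight_special_exp_nonzero[OF d b(5)] by (simp add: \<eta>_def p_def hess_quad_special_form_special_exp[OF d])
  have supp: "\<eta> m = 0" if "m \<notin> {p, p + w, p + 2 * w}" for m
  proof -
    have "m + 2 \<noteq> 2 * ?a" "m + 2 \<noteq> 2 * (d - ?a)" "m + 2 \<noteq> d"
      using that b by (auto simp: p_def w_def)
    then show ?thesis by (simp add: \<eta>_def hess_quad_special_form[OF d])
  qed
  \<comment> \<open>The sums in question are the Taylor coefficients at \<open>r\<close> of the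
    polynomial with coefficients \<eta>.\<close>
  assume "\<not> ?thesis"
  then have z: "(\<Sum>m\<le>2 * d - 4. \<eta> m * of_nat (m choose n) * r ^ (m - n)) = 0" if "n < d - 2" for n
    using that by (auto simp: \<eta>_def)
  show False
  proof (cases "r = 0")
    case True
    \<comment> \<open>At the root 0 the order is p = 2 a - 2, which is below d - 2.\<close>
    have "(\<Sum>m\<le>2 * d - 4. \<eta> m * of_nat (m choose p) * r ^ (m - p)) = (\<Sum>m\<in>{p}. \<eta> m * of_nat (m choose p) * r ^ (m - p))"
    proof (rule sum.mono_neutral_right)
      show "\<forall>m\<in>{..2 * d - 4} - {p}. \<eta> m * of_nat (m choose p) * r ^ (m - p) = 0"
      proof
        fix m assume "m \<in> {..2 * d - 4} - {p}"
        then have "m < p \<or> m > p" by auto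
        then show "\<eta> m * of_nat (m choose p) * r ^ (m - p) = 0"
          using True by (auto simp: power_0_left)
      qed
    qed (use b d in \<open>auto simp: p_def\<close>)
    then show False using z[of p] \<eta>p b by (auto simp: p_def)
  next
    case False
    define X where "X m = \<eta> m * r ^ m" for m
    \<comment> \<open>Three Taylor coefficients are available because d - 2 \<ge> 3; multiplying
      them by \<open>r ^ n\<close> removes the shift of the exponents.\<close>
    have S: "(\<Sum>m\<in>{p, p + w, p + 2 * w}. X m * of_nat (m choose n)) = 0" if "n < 3" for n
    proof -
      have "(\<Sum>m\<in>{p, p + w, p + 2 * w}. X m * of_nat (m choose n)) =
          (\<Sum>m\<le>2 * d - 4. X m * of_nat (m choose n))"
        by (rule sum.mono_neutral_left) (use b supp in \<open>auto simp: p_def w_def X_def\<close>)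
      also have "\<dots> = (\<Sum>m\<le>2 * d - 4. r ^ n * (\<eta> m * of_nat (m choose n) * r ^ (m - n)))"
      proof (rule sum.cong[OF refl])
        fix m
        show "X m * of_nat (m choose n) = r ^ n * (\<eta> m * of_nat (m choose n) * r ^ (m - n))"
        proof (cases "n \<le> m")
          case True
          then have "r ^ m = r ^ n * r ^ (m - n)" by (simp add: power_add[symmetric])
          then show ?thesis by (simp add: X_def)
        qed (simp add: binomial_eq_0)
      qed
      also have "\<dots> = 0"
        using z[of n] that d by (simp add: sum_distrib_left[symmetric])
      finally show ?thesis .
    qed
    define x y v where "x = X p" and "y = X (p + w)" and "v = X (p + 2 * w)"
    define P W where "P = (of_nat p :: 'a)" and "W = (of_nat w :: 'a)"
    have W: "W \<noteq> 0" using w by (simp add: W_def)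
    have two: "2 * of_nat (m choose 2) = (of_nat m * (of_nat m - 1) :: 'a)" for m
    proof -
      have "even (m * (m - 1))" by (cases m) auto
      then have "2 * (m choose 2) = m * (m - 1)" unfolding choose_two by (rule dvd_mult_div_cancel)
      then have "of_nat (2 * (m choose 2)) = (of_nat (m * (m - 1)) :: 'a)" by (rule arg_cong)
      then show ?thesis by (cases m) (simp_all add: algebra_simps)
    qed
    \<comment> \<open>Three linear equations in three unknowns, independent because the exponents p,
      p + w, p + 2 w are distinct and the characteristic is 0.\<close>
    have 0: "x + y + v = 0" and 1: "x * P + y * (P + W) + v * (P + 2 * W) = 0"
      and "2 * (x * of_nat (p choose 2) + y * of_nat ((p + w) choose 2) + v * of_nat ((p + 2 * w) choose 2)) = 0"
      using S[of 0] S[of 1] S[of 2] w by (simp_all add: x_def y_def v_def P_def W_def add.assoc)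
    then have "x * (2 * of_nat (p choose 2)) + y * (2 * of_nat ((p + w) choose 2))
        + v * (2 * of_nat ((p + 2 * w) choose 2)) = 0"
      by (simp add: algebra_simps)
    then have 2: "x * (P * (P - 1)) + y * ((P + W) * (P + W - 1)) + v * ((P + 2 * W) * (P + 2 * W - 1)) = 0"
      unfolding two by (simp add: P_def W_def)
    have x: "x = - y - v" using 0 by (simp add: algebra_simps eq_neg_iff_add_eq_0)
    have "W * (y + 2 * v) = 0" using 1 unfolding x by (simp add: algebra_simps)
    then have y: "y = - 2 * v" using W by (simp add: eq_neg_iff_add_eq_0)
    have "2 * W * W * v = 0" using 2 unfolding x y by (simp add: algebra_simps)
    then have "x = 0" using W unfolding x y by simp
    then show False using \<eta>p False by (simp add: x_def X_def)
  qed
qed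

text \<open>A form reducing to a \<open>d\<close>-th power, after a translation killing its second coefficient, is
  \<open>x\<^sup>d\<close> plus small terms of degree at most \<open>d - 2\<close>; hence the leading part of its Hessian is divisible by
  \<open>x\<^sup>d\<^sup>-\<^sup>2\<close>.\<close>

lemma place_not_power:
  fixes M :: "('a::field \<times> 'b::field_char_0) set"
  assumes d: "d \<ge> 5" and M: "place_graph M"
    and g: "\<And>i. i \<le> d \<Longrightarrow> (g i, \<gamma> i) \<in> M" and gd: "g d = 1"
    and \<mu>: "(\<mu>, 0) \<in> M" "\<mu> \<noteq> 0" and \<kappa>: "\<kappa> \<noteq> 0"
    and h: "\<And>n. n \<le> 2 * d - 4 \<Longrightarrow> (h n, \<kappa> * hess_quad d (special_form d) n) \<in> M"
    and hess: "\<And>n. n \<le> 2 * d - 4 \<Longrightarrow> hess_quad d g n = \<mu> * h n"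
  shows False
proof -
  note lM = place_graph_local[OF M]
  note hM = local_graph_hom[OF lM]
  have gd': "\<gamma> d = 1" using g[of d] gd graph_one[OF hM] graph_unique[OF hM] by auto
  have dM: "(of_nat d, of_nat d) \<in> M" by (rule graph_of_nat[OF hM])
  have d0: "of_nat d \<noteq> (0::'b)" using d by simp
  then have d0': "of_nat d \<noteq> (0::'a)" using graph_nonzero[OF hM dM] by simp
  define \<rho> where "\<rho> = - (g (d - 1) / of_nat d)"
  define r where "r = - (\<gamma> (d - 1) / of_nat d)"
  have \<rho>: "(\<rho>, r) \<in> M"
    unfolding \<rho>_def r_def by (intro graph_uminus[OF hM] local_graph_divide[OF lM] g dM d0) simp
  define p where "p = (\<Sum>i\<le>d. monom (g i) i)"
  define q where "q = (\<Sum>i\<le>d. monom (\<gamma> i) i)"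
  have cp: "coeff p i = (if i \<le> d then g i else 0)" and cq: "coeff q i = (if i \<le> d then \<gamma> i else 0)" for i
    by (auto simp: p_def q_def coeff_sum)
  have dp: "degree p \<le> d" and dq: "degree q \<le> d" by (auto intro!: degree_le simp: cp cq)
  define G where "G = coeff (pcompose p [:\<rho>, 1:])"
  define \<Gamma> where "\<Gamma> = coeff (pcompose q [:r, 1:])"
  have G_alt: "G k = (\<Sum>i\<le>d. g i * of_nat (i choose k) * \<rho> ^ (i - k))" for k
    unfolding G_def coeff_pcompose_linear[OF dp] by (intro sum.cong) (auto simp: cp)
  have \<Gamma>_alt: "\<Gamma> k = (\<Sum>i\<le>d. \<gamma> i * of_nat (i choose k) * r ^ (i - k))" for k
    unfolding \<Gamma>_def coeff_pcompose_linear[OF dq] by (intro sum.cong) (auto simp: cq)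
  have G\<Gamma>: "(G k, \<Gamma> k) \<in> M" for k
    unfolding G_alt \<Gamma>_alt
    by (intro graph_sum[OF hM] graph_mult[OF hM] graph_of_nat[OF hM] graph_power[OF hM] \<rho> g) auto
  have Gd: "G d = 1"
  proof -
    have "G d = (\<Sum>i\<in>{d}. g i * of_nat (i choose d) * \<rho> ^ (i - d))"
      unfolding G_alt by (rule sum.mono_neutral_right) (auto simp: binomial_eq_0)
    then show ?thesis using gd by simp
  qed
  have Gd1: "G (d - 1) = 0"
  proof -
    have "G (d - 1) = (\<Sum>i\<in>{d - 1, d}. g i * of_nat (i choose (d - 1)) * \<rho> ^ (i - (d - 1)))"
      unfolding G_alt using d by (intro sum.mono_neutral_right) (auto simp: binomial_eq_0)
    also have "\<dots> = g (d - 1) + of_nat d * \<rho>"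
    proof -
      have "d choose (d - 1) = d" using d binomial_symmetric[of 1 d] by simp
      then show ?thesis using d gd by (simp add: Suc_diff_Suc)
    qed
    finally show ?thesis using d0' by (simp add: \<rho>_def)
  qed
  have hp: "coeff (hess_poly d p) n = hess_quad d g n" and hess_quad: "coeff (hess_poly d q) n = hess_quad d \<gamma> n" for n
    unfolding hess_quad_poly[OF dp, symmetric] hess_quad_poly[OF dq, symmetric]
    by (rule hess_polar_cong; simp add: cp cq)+
  have "hess_quad d \<gamma> n = 0" for n
  proof (cases "n \<le> 2 * d - 4")
    case True
    have "(hess_quad d g n, hess_quad d \<gamma> n) \<in> M" by (rule hess_polar_graph[OF hM]) (use g in auto)
    moreover have "(hess_quad d g n, 0 * (\<kappa> * hess_quad d (special_form d) n)) \<in> M"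
      unfolding hess[OF True] using graph_mult[OF hM \<mu>(1) h[OF True]] .
    ultimately show ?thesis using graph_unique[OF hM] by fastforce
  qed (simp add: hess_polar_above)
  then have "hess_poly d q = 0" by (intro poly_eqI) (simp add: hess_quad)
  then have \<Gamma>0: "hess_quad d \<Gamma> n = 0" for n
    unfolding \<Gamma>_def using dq by (subst hess_quad_poly) (simp_all add: hess_poly_pcompose degree_pcompose)
  define \<delta> where "\<delta> = (\<lambda>i::nat. if i = d then 1 else 0 :: 'b)"
  define \<delta>' where "\<delta>' = (\<lambda>i::nat. if i = d then 1 else 0 :: 'a)"
  have \<delta>0: "hess_quad d \<delta> n = 0" and \<delta>0': "hess_quad d \<delta>' n = 0" for n
    unfolding \<delta>_def \<delta>'_def by (simp_all add: hess_polar_delta_delta hess_weight_diag)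
  \<comment> \<open>The reduction has zero Hessian and no term of degree d - 1, so descending
    induction with the pivots \<open>hess_weight d d i\<close> shows that it is x^d. Hence the lower
    coefficients of \<open>G\<close> lie in the kernel.\<close>
  have \<Gamma>z: "\<Gamma> i = 0" if "i < d" for i
    using that
  proof (induction "d - i" arbitrary: i rule: less_induct)
    case less
    show ?case
    proof (cases "i = d - 1")
      case True
      then show ?thesis using G\<Gamma>[of i] Gd1 graph_zero_unique[OF hM] by simp
    next
      case False
      have "hess_quad d \<Gamma> (d + i - 2) - hess_quad d \<delta> (d + i - 2) =
          (if d = i then 1 else 2) * of_int (hess_weight d d i) * (\<Gamma> d * \<Gamma> i - \<delta> d * \<delta> i)"
      proof (rule hess_quad_diff)
        fix k l assume kl: "k \<le> d" "l \<le> d" "k + l = d + i - 2 + 2" "k \<noteq> d" "k \<noteq> i"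
        then have "i < k" "k < d" "l < d" using d by linarith+
        then show "\<Gamma> k * \<Gamma> l = \<delta> k * \<delta> l" using less.hyps[of k] kl by (simp add: \<delta>_def)
      qed (use less.prems d in auto)
      moreover have "\<Gamma> d = 1" using G\<Gamma>[of d] Gd graph_one[OF hM] graph_unique[OF hM] by auto
      moreover have "hess_weight d d i \<noteq> 0" using False less.prems by (auto simp: hess_weight_top)
      ultimately show ?thesis using less.prems by (simp add: \<Gamma>0 \<delta>0) (simp add: \<delta>_def)
    qed
  qed
  \<comment> \<open>\<open>hh\<close> and \<open>ee\<close> are the coefficients of \<open>h\<close>
    and of its reduction after the translation.\<close>
  define hh where "hh n = (\<Sum>m\<le>2 * d - 4. h m * of_nat (m choose n) * \<rho> ^ (m - n))" for n
  define ee where "ee n = (\<Sum>m\<le>2 * d - 4. (\<kappa> * hess_quad d (special_form d) m) * of_nat (m choose n) * r ^ (m - n))" for n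
  have he: "(hh n, ee n) \<in> M" for n
    unfolding hh_def ee_def
    by (intro graph_sum[OF hM] graph_mult[OF hM] graph_of_nat[OF hM] graph_power[OF hM] \<rho> h) auto
  have Gh: "hess_quad d G n = \<mu> * hh n" for n
  proof -
    have deg: "degree (hess_poly d p) \<le> 2 * d - 4"
      by (rule degree_le) (simp add: hp hess_polar_above)
    have "hess_quad d G n = coeff (pcompose (hess_poly d p) [:\<rho>, 1:]) n"
      unfolding G_def using dp by (subst hess_quad_poly) (simp_all add: hess_poly_pcompose degree_pcompose)
    also have "\<dots> = (\<Sum>m\<le>2 * d - 4. hess_quad d g m * of_nat (m choose n) * \<rho> ^ (m - n))"
      unfolding coeff_pcompose_linear[OF deg] hp ..
    also have "\<dots> = \<mu> * hh n"
      unfolding hh_def sum_distrib_left by (intro sum.cong) (simp_all add: hess mult.assoc)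
    finally show ?thesis .
  qed
  obtain n0 where n0: "n0 < d - 2" "ee n0 \<noteq> 0"
  proof -
    obtain n where n: "n < d - 2"
      "(\<Sum>m\<le>2 * d - 4. hess_quad d (special_form d) m * of_nat (m choose n) * r ^ (m - n)) \<noteq> 0"
      using special_form_root_multiplicity[OF d] by blast
    have "ee n = \<kappa> * (\<Sum>m\<le>2 * d - 4. hess_quad d (special_form d) m * of_nat (m choose n) * r ^ (m - n))"
      unfolding ee_def sum_distrib_left by (intro sum.cong) (simp_all add: mult.assoc)
    then show ?thesis using that n \<kappa> by simp
  qed
  show False
  proof (cases "\<exists>i\<in>{..d - 2}. G i \<noteq> 0")
    case False
    have "hess_quad d G n0 = hess_quad d \<delta>' n0"
    proof (rule hess_polar_cong)
      fix i assume "i \<le> d"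
      then have "i \<le> d - 2 \<or> i = d - 1 \<or> i = d" by linarith
      then show "G i = \<delta>' i" using False Gd Gd1 d by (auto simp: \<delta>'_def)
      then show "G i = \<delta>' i" .
    qed
    then have "hh n0 = 0" using Gh[of n0] \<mu>(2) by (simp add: \<delta>0')
    then show False using he[of n0] n0 graph_zero_unique[OF hM] by simp
  next
    case True
    then obtain t where t: "t \<le> d - 2" "G t \<noteq> 0" "\<And>i. i \<le> d - 2 \<Longrightarrow> \<exists>u. (G i / G t, u) \<in> M"
      using max_valuation[OF M, of "{..d - 2}" _ G] by (metis atMost_iff finite_atMost)
    \<comment> \<open>The largest of the lower coefficients. Then G is x^d + \<beta> e, where e has
      degree at most d - 2 and a nonzero reduction \<epsilon>, and the Hessian of G is \<beta>
      R.\<close>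
    define \<beta> where "\<beta> = G t"
    have \<beta>: "(\<beta>, 0) \<in> M" "\<beta> \<noteq> 0"
      using G\<Gamma>[of t] \<Gamma>z[of t] t d by (auto simp: \<beta>_def)
    define e where "e i = (if i \<le> d - 2 then G i / \<beta> else 0)" for i
    have "\<forall>i. \<exists>u. (e i, u) \<in> M"
      using t(3) graph_zero[OF hM] by (auto simp: e_def \<beta>_def)
    then obtain \<epsilon> where \<epsilon>: "\<And>i. (e i, \<epsilon> i) \<in> M" by metis
    have "e t = 1" using t by (simp add: e_def \<beta>_def)
    then have \<epsilon>t: "\<epsilon> t = 1" using \<epsilon>[of t] graph_one[OF hM] graph_unique[OF hM] by auto
    define R where "R n = 2 * hess_polar d \<delta>' e n + \<beta> * hess_quad d e n" for n
    define \<omega> where "\<omega> n = 2 * hess_polar d \<delta> \<epsilon> n" for n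
    have "(\<delta>' i, \<delta> i) \<in> M" for i
      by (auto simp: \<delta>_def \<delta>'_def graph_one[OF hM] graph_zero[OF hM])
    then have "(R n, 2 * hess_polar d \<delta> \<epsilon> n + 0 * hess_quad d \<epsilon> n) \<in> M" for n
      unfolding R_def using \<epsilon> \<beta>(1) graph_of_nat[OF hM, of 2]
      by (intro graph_add[OF hM] graph_mult[OF hM] hess_polar_graph[OF hM]) auto
    then have R\<omega>: "(R n, \<omega> n) \<in> M" for n by (simp add: \<omega>_def)
    have "hess_quad d G n = \<beta> * R n" for n
    proof -
      have "hess_quad d G n = hess_quad d (\<lambda>i. \<delta>' i + \<beta> * e i) n"
      proof (rule hess_polar_cong)
        fix i assume "i \<le> d"
        then have "i \<le> d - 2 \<or> i = d - 1 \<or> i = d" by linarith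
        then show "G i = \<delta>' i + \<beta> * e i" using \<beta>(2) Gd Gd1 d by (auto simp: \<delta>'_def e_def)
        then show "G i = \<delta>' i + \<beta> * e i" .
      qed
      also have "\<dots> = \<beta> * R n"
        by (simp add: hess_polar_add_left hess_polar_add_right hess_polar_scale_left hess_polar_scale_right \<delta>0' R_def
          hess_polar_commute[of d e \<delta>'] algebra_simps)
      finally show ?thesis .
    qed
    then have R: "\<mu> * hh n = \<beta> * R n" for n using Gh by simp
    \<comment> \<open>The polarization with x^d has only exponents from d - 2 on; in particular it
      vanishes at \<open>n0\<close>.\<close>
    have \<omega>: "\<omega> n = (if d \<le> n + 2 \<and> n + 2 - d \<le> d then 2 * (of_int (hess_weight d d (n + 2 - d)) * \<epsilon> (n + 2 - d)) else 0)" for n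
      unfolding \<omega>_def \<delta>_def by (simp add: hess_polar_delta)
    show False
    \<comment> \<open>Compare the sizes of \<mu> and \<beta>. If \<open>\<mu> / \<beta>\<close> has
      a value u, then u times \<open>ee\<close> is \<omega>; the coefficient of \<omega> at t + d -
      2 makes u nonzero, so \<open>ee n0\<close> would be 0. If it is a pole, \<open>hh\<close> is R
      times an element of the kernel, and again \<open>ee n0\<close> would be 0.\<close>
    proof (cases "\<exists>u. (\<mu> / \<beta>, u) \<in> M")
      case True
      then obtain u where u: "(\<mu> / \<beta>, u) \<in> M" by blast
      have uw: "u * ee n = \<omega> n" for n
      proof -
        have "R n = (\<mu> / \<beta>) * hh n" using R[of n] \<beta>(2) by (simp add: field_simps)
        then show ?thesis using graph_unique[OF hM graph_mult[OF hM u he[of n]]] R\<omega>[of n] by simp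
      qed
      have "\<omega> (t + d - 2) = 2 * of_int (hess_weight d d t)"
      proof -
        have "t + d - 2 + 2 - d = t" "d \<le> t + d - 2 + 2" "t \<le> d" using d t(1) by linarith+
        then show ?thesis unfolding \<omega> by (simp only: \<epsilon>t) simp
      qed
      moreover have "hess_weight d d t \<noteq> 0" using t d by (auto simp: hess_weight_top)
      ultimately have "u \<noteq> 0" using uw[of "t + d - 2"] by auto
      moreover have "\<omega> n0 = 0" using n0 by (simp add: \<omega>)
      ultimately show False using uw[of n0] n0 by simp
    next
      case False
      then have *: "(\<beta> / \<mu>, 0) \<in> M" using M by (metis inverse_divide place_graph_def)
      have "hh n0 = (\<beta> / \<mu>) * R n0" using R[of n0] \<mu>(2) by (simp add: field_simps)
      then have "ee n0 = 0 * \<omega> n0"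
        using graph_unique[OF hM he[of n0]] graph_mult[OF hM * R\<omega>[of n0]] by simp
      then show False using n0 by simp
    qed
  qed
qed

text \<open>The Hessian enters through ratios to the coefficient of index 2 a - 2, the lowest
  nonzero one for the special form. The form \<open>b\<close> is normalized by its largest
  coefficient, not by the one of index a; that the latter has the same size is part of what
  \<open>fibre_special_form\<close> yields.\<close>

lemma place_value:
  fixes M :: "('a::field \<times> 'b::field_char_0) set"
  assumes d: "d \<ge> 5" and M: "place_graph M"
    and nz: "hess_quad d b (2 * special_exp d - 2) \<noteq> 0"
    and h: "\<And>n. (hess_quad d b n / hess_quad d b (2 * special_exp d - 2),
      hess_quad d (special_form d) n / hess_quad d (special_form d) (2 * special_exp d - 2)) \<in> M" and i: "i \<le> d"
  shows "(b i / b (special_exp d), special_form d i) \<in> M"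
proof -
  note lM = place_graph_local[OF M]
  note hM = local_graph_hom[OF lM]
  note bd = special_exp_bounds[OF d]
  define r where "r = 2 * special_exp d - 2"
  have \<kappa>: "hess_quad d (special_form d) r \<noteq> (0::'b)"
    using hess_weight_special_exp_nonzero[OF d bd(5)] by (simp add: r_def hess_quad_special_form_special_exp[OF d])
  have "\<exists>i\<le>d. b i \<noteq> 0"
  proof (rule ccontr)
    assume "\<not> (\<exists>i\<le>d. b i \<noteq> 0)"
    then have "hess_quad d b (2 * special_exp d - 2) = hess_quad d (\<lambda>_. 0) (2 * special_exp d - 2)" by (intro hess_polar_cong) auto
    then show False using nz by (simp add: hess_polar_zero)
  qed
  then obtain j where j: "j \<le> d" "b j \<noteq> 0" "\<And>i. i \<le> d \<Longrightarrow> \<exists>u. (b i / b j, u) \<in> M"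
    using max_valuation[OF M, of "{..d}" _ b] by (metis atMost_iff finite_atMost)
  define g where "g i = b i / b j" for i
  obtain \<gamma> where \<gamma>: "\<And>i. i \<le> d \<Longrightarrow> (g i, \<gamma> i) \<in> M"
    using j(3) unfolding g_def by metis
  define h where "h n = hess_quad d b n / hess_quad d b r" for n
  define \<mu> where "\<mu> = hess_quad d g r"
  have gb: "hess_quad d g n = hess_quad d b n / (b j)\<^sup>2" for n
  proof -
    have "hess_quad d g n = hess_quad d (\<lambda>i. inverse (b j) * b i) n"
      by (rule hess_polar_cong) (simp_all add: g_def field_simps)
    then show ?thesis
      unfolding hess_polar_scale_left hess_polar_scale_right using j(2) by (simp add: power2_eq_square field_simps)
  qed
  have \<mu>0: "\<mu> \<noteq> 0" using nz j(2) by (simp add: \<mu>_def gb r_def)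
  have hess: "hess_quad d g n = \<mu> * h n" for n
    using nz by (simp add: \<mu>_def gb h_def r_def)
  have hM': "(h n, inverse (hess_quad d (special_form d) r) * hess_quad d (special_form d) n) \<in> M" for n
    using assms(4)[of n] by (simp add: h_def r_def divide_inverse mult.commute)
  have \<mu>M: "(\<mu>, hess_quad d \<gamma> r) \<in> M"
    unfolding \<mu>_def by (rule hess_polar_graph[OF hM]) (use \<gamma> in auto)
  have eq: "hess_quad d \<gamma> n = (hess_quad d \<gamma> r / hess_quad d (special_form d) r) * hess_quad d (special_form d) n" for n
  proof -
    have "(hess_quad d g n, hess_quad d \<gamma> n) \<in> M" by (rule hess_polar_graph[OF hM]) (use \<gamma> in auto)
    from graph_unique[OF hM this] graph_mult[OF hM \<mu>M hM'[of n]] show ?thesis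
      unfolding hess by (simp add: field_simps)
  qed
  have \<gamma>j: "\<gamma> j = 1"
    using \<gamma>[OF j(1)] j(2) graph_one[OF hM] graph_unique[OF hM] by (auto simp: g_def)
  show ?thesis
  proof (cases "hess_quad d \<gamma> r = 0")
    case False
    then have "hess_quad d \<gamma> r / hess_quad d (special_form d) r \<noteq> 0" using \<kappa> by simp
    note f = fibre_special_form[OF d eq this]
    from f have nz': "\<gamma> (special_exp d) \<noteq> 0" ..
    have "(g i / g (special_exp d), \<gamma> i / \<gamma> (special_exp d)) \<in> M"
      using \<gamma> i bd(5) nz' by (intro local_graph_divide[OF lM])
    moreover have "g i / g (special_exp d) = b i / b (special_exp d)" using j(2) by (simp add: g_def)
    moreover have "\<gamma> i / \<gamma> (special_exp d) = special_form d i"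
      using f i nz' by (metis nonzero_mult_div_cancel_left)
    ultimately show ?thesis by simp
  next
    case True
    then have z: "hess_quad d \<gamma> n = 0" for n using eq[of n] by simp
    have False
    proof (cases "\<gamma> d = 0")
      case False
      have gd: "g d \<noteq> 0" using graph_nonzero[OF hM \<gamma>[of d]] False by simp
      show False
      proof (rule place_not_power[OF d M])
        show "(g i / g d, \<gamma> i / \<gamma> d) \<in> M" if "i \<le> d" for i
          using \<gamma>[OF that] \<gamma>[of d] False by (intro local_graph_divide[OF lM]) auto
        show "g d / g d = 1" using gd by simp
        show "(\<mu> / (g d)\<^sup>2, 0) \<in> M"
          using local_graph_divide[OF lM \<mu>M graph_power[OF hM \<gamma>[of d], of 2]] False True by simp
        show "\<mu> / (g d)\<^sup>2 \<noteq> 0" using \<mu>0 gd by simp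
        show "inverse (hess_quad d (special_form d) r) \<noteq> (0::'b)" using \<kappa> by simp
        show "(h n, inverse (hess_quad d (special_form d) r) * hess_quad d (special_form d) n) \<in> M" for n by (rule hM')
        show "hess_quad d (\<lambda>i. g i / g d) n = \<mu> / (g d)\<^sup>2 * h n" for n
        proof -
          have "hess_quad d (\<lambda>i. g i / g d) n = hess_quad d (\<lambda>i. inverse (g d) * g i) n"
            by (rule hess_polar_cong) (simp_all add: field_simps)
          then show ?thesis
            unfolding hess_polar_scale_left hess_polar_scale_right hess by (simp add: power2_eq_square field_simps)
        qed
      qed
    next
      \<comment> \<open>The reduction is now a nonzero constant, the d-th power of the linear form
        vanishing at infinity, so the reversed form is used.\<close>
      case True
      have rz: "hess_quad d (\<lambda>i. \<gamma> (d - i)) n = 0" for n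
        using d z by (cases "n \<le> 2 * d - 4") (simp_all add: hess_polar_reverse hess_polar_above)
      have "\<gamma> (d - i) = 0" if "i < d" for i
        using hess_quad_low_vanish[of d d "\<lambda>i. \<gamma> (d - i)" i] rz True that by simp
      then have "\<gamma> i = 0" if "0 < i" "i \<le> d" for i
        using that by (metis diff_diff_cancel diff_less less_le_trans)
      then have "\<gamma> 0 \<noteq> 0" using \<gamma>j j(1) by (cases "j = 0") auto
      then have g0: "g 0 \<noteq> 0" using graph_nonzero[OF hM \<gamma>[of 0]] by simp
      show False
      proof (rule place_not_power[OF d M])
        show "(g (d - i) / g 0, \<gamma> (d - i) / \<gamma> 0) \<in> M" if "i \<le> d" for i
          using \<gamma>[of "d - i"] \<gamma>[of 0] \<open>\<gamma> 0 \<noteq> 0\<close> by (intro local_graph_divide[OF lM]) auto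
        show "g (d - d) / g 0 = 1" using g0 by simp
        show "(\<mu> / (g 0)\<^sup>2, 0) \<in> M"
          using local_graph_divide[OF lM \<mu>M graph_power[OF hM \<gamma>[of 0], of 2]] \<open>\<gamma> 0 \<noteq> 0\<close> z by simp
        show "\<mu> / (g 0)\<^sup>2 \<noteq> 0" using \<mu>0 g0 by simp
        show "inverse (hess_quad d (special_form d) r) \<noteq> (0::'b)" using \<kappa> by simp
        show "(h (2 * d - 4 - n), inverse (hess_quad d (special_form d) r) * hess_quad d (special_form d) n) \<in> M" if "n \<le> 2 * d - 4" for n
        proof -
          have "hess_quad d (\<lambda>i. special_form d (d - i)) n = (hess_quad d (special_form d) n :: 'b)"
            by (rule hess_polar_cong) (simp_all add: special_form_reverse[OF d])
          then have "hess_quad d (special_form d) (2 * d - 4 - n) = (hess_quad d (special_form d) n :: 'b)"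
            using hess_polar_reverse[of d n "special_form d :: nat \<Rightarrow> 'b" "special_form d"] d that by simp
          then show ?thesis using hM'[of "2 * d - 4 - n"] by simp
        qed
        show "hess_quad d (\<lambda>i. g (d - i) / g 0) n = \<mu> / (g 0)\<^sup>2 * h (2 * d - 4 - n)" if "n \<le> 2 * d - 4" for n
        proof -
          have "hess_quad d (\<lambda>i. g (d - i) / g 0) n = hess_quad d (\<lambda>i. inverse (g 0) * g (d - i)) n"
            by (rule hess_polar_cong) (simp_all add: field_simps)
          then have "hess_quad d (\<lambda>i. g (d - i) / g 0) n = inverse (g 0) * (inverse (g 0) * hess_quad d (\<lambda>i. g (d - i)) n)"
            by (simp only: hess_polar_scale_left hess_polar_scale_right)
          also have "hess_quad d (\<lambda>i. g (d - i)) n = \<mu> * h (2 * d - 4 - n)"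
            using hess_polar_reverse[of d n g g] d that hess by simp
          finally show ?thesis by (simp add: power2_eq_square field_simps)
        qed
      qed
    qed
    then show ?thesis ..
  qed
qed

section \<open>Coefficients are rational functions of the Hessian\<close>

lemma hess_quad_mem_filt:
  assumes "strongly_integral_family G d t N c"
  shows "hess_quad d t n \<in> strongly_integral_family.filt G d t N 2"
proof -
  interpret strongly_integral_family G d t N c by fact
  have tt: "t i * t j \<in> filt 2" if "i \<le> d" "j \<le> d" for i j
  proof -
    have "mon (\<lambda>k. (if k = i then 1 else 0) + (if k = j then 1 else 0)) \<in> filt 2"
      using that by (intro mon_filt) (simp add: wt_add wt_unit)
    then show ?thesis using that by (simp add: mon_add mon_unit)
  qed
  have "of_int (hess_weight d i j) * (t i * t j) \<in> filt 2" if "i \<le> d" "j \<le> d" for i j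
    using filt_scale[OF tt[OF that] graph_of_int[OF local_graph_hom[OF G]]] .
  then show ?thesis
    unfolding hess_polar_def by (intro filt_sum) (simp add: filt_zero mult.assoc)
qed

text \<open>The linear part of \<open>n \<mapsto> hess_quad d (special_form d + t) n\<close> is triangular in \<open>t\<close>, with
  pivots \<open>hess_weight d (special_exp d) s\<close>.\<close>

lemma coords_in_local:
  fixes G :: "('a::field \<times> 'b::{alg_closed_field, field_char_0}) set"
  assumes d: "d \<ge> 5" and G: "local_graph G" and ba: "b (special_exp d) \<noteq> 0"
    and nz: "hess_quad d b (2 * special_exp d - 2) \<noteq> 0"
    and h: "\<And>n. (hess_quad d b n / hess_quad d b (2 * special_exp d - 2),
      hess_quad d (special_form d) n / hess_quad d (special_form d) (2 * special_exp d - 2)) \<in> G" and i: "i \<le> d"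
  shows "b i / b (special_exp d) \<in> fst ` G"
proof -
  note hG = local_graph_hom[OF G]
  note bd = special_exp_bounds[OF d]
  let ?a = "special_exp d"
  define r where "r = 2 * ?a - 2"
  have sf: "(special_form d k, special_form d k) \<in> H" if "hom_graph H" for H :: "('a \<times> 'b) set" and k
    using graph_zero[OF that] graph_one[OF that] by (simp add: special_form_def)
  \<comment> \<open>The displacement from the special form. It is sent to 0 by every place over
    \<open>G\<close>, hence strongly integral; the aim is \<open>t i \<in> filt 2\<close>.\<close>
  define t where "t k = b k / b ?a - special_form d k" for k
  have "(t k, 0) \<in> M" if M: "place_graph M" "G \<subseteq> M" and k: "k \<le> d" for M k
  proof -
    note hM = local_graph_hom[OF place_graph_local[OF M(1)]]
    have "(b k / b ?a, special_form d k) \<in> M"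
      by (rule place_value[OF d M(1) nz _ k]) (use h M(2) in auto)
    from graph_diff[OF hM this sf[OF hM, of k]] show ?thesis by (simp add: t_def)
  qed
  then have "\<exists>N c. (\<forall>m<N. (c m, 0) \<in> G) \<and> t k ^ N = (\<Sum>m<N. c m * t k ^ m)" if "k \<le> d" for k
    using strongly_integral[OF G] that by blast
  then obtain N c where Nc: "\<And>k. k \<le> d \<Longrightarrow> (\<forall>m<N k. (c k m, 0) \<in> G) \<and> t k ^ N k = (\<Sum>m<N k. c k m * t k ^ m)"
    by metis
  interpret strongly_integral_family G d t N c
    by standard (use G Nc in auto)
  have qt: "hess_quad d t n \<in> filt 2" for n
    by (rule hess_quad_mem_filt) (rule strongly_integral_family_axioms)
  have small: "\<nu> * mon \<alpha> \<in> filt 2" if "(\<nu>, 0) \<in> G" for \<nu> \<alpha>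
    using NS_filt[OF nn_RS[OF _ mon_RS]] that by blast
  \<comment> \<open>A factor from the kernel puts such expressions in the \<open>t i\<close> into n
    R[t], whatever their degree.\<close>
  have small_sum: "\<nu> * hess_polar d x y n \<in> filt 2"
    if "(\<nu>, 0) \<in> G" and xy: "\<And>k l. k \<le> d \<Longrightarrow> l \<le> d \<Longrightarrow> \<exists>a \<alpha>. (\<exists>u. (a, u) \<in> G) \<and> x k * y l = a * mon \<alpha>"
    for \<nu> x y n
  proof -
    have "\<nu> * (of_int (hess_weight d k l) * (x k * y l)) \<in> filt 2" if kl: "k \<le> d" "l \<le> d" for k l
    proof -
      obtain a \<alpha> u where a: "(a, u) \<in> G" "x k * y l = a * mon \<alpha>" using xy[OF kl] by blast
      have "(\<nu> * (of_int (hess_weight d k l) * a), 0 * (of_int (hess_weight d k l) * u)) \<in> G"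
        using \<open>(\<nu>, 0) \<in> G\<close> a(1) by (intro graph_mult[OF hG] graph_of_int[OF hG])
      then show ?thesis using small[of "\<nu> * (of_int (hess_weight d k l) * a)" \<alpha>] by (simp add: a(2) ac_simps)
    qed
    then show ?thesis
      unfolding hess_polar_def sum_distrib_left by (intro filt_sum) (simp add: filt_zero mult.assoc)
  qed
  let ?f = "special_form d :: nat \<Rightarrow> 'a"
  have fG: "(hess_quad d ?f n, hess_quad d (special_form d) n) \<in> G" for n
    by (rule hess_polar_graph[OF hG]) (auto intro: sf hG)
  have fr: "hess_quad d (special_form d) r \<noteq> (0::'b)"
    using hess_weight_special_exp_nonzero[OF d bd(5)] by (simp add: r_def hess_quad_special_form_special_exp[OF d])
  then have fr': "hess_quad d ?f r \<noteq> 0" using graph_nonzero[OF hG fG] by blast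
  define \<eta> where "\<eta> n = hess_quad d ?f n / hess_quad d ?f r" for n
  have \<eta>G: "(\<eta> n, hess_quad d (special_form d) n / hess_quad d (special_form d) r) \<in> G" for n
    unfolding \<eta>_def by (rule local_graph_divide[OF G fG fG fr])
  \<comment> \<open>Deviation of the Hessian ratios from those of the special form; it reduces to 0
    by hypothesis.\<close>
  define \<nu> where "\<nu> n = hess_quad d b n / hess_quad d b r - \<eta> n" for n
  have \<nu>G: "(\<nu> n, 0) \<in> G" for n
    using graph_diff[OF hG h[of n] \<eta>G[of n]] by (simp add: \<nu>_def r_def)
  have expand: "hess_quad d b n / (b ?a)\<^sup>2 = hess_quad d ?f n + 2 * hess_polar d ?f t n + hess_quad d t n" for n
  proof -
    have "hess_quad d (\<lambda>k. ?f k + t k) n = hess_quad d (\<lambda>k. inverse (b ?a) * b k) n"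
      by (rule hess_polar_cong) (simp_all add: t_def field_simps)
    then have "hess_quad d b n / (b ?a)\<^sup>2 = hess_quad d (\<lambda>k. ?f k + t k) n"
      unfolding hess_polar_scale_left hess_polar_scale_right by (simp add: power2_eq_square field_simps)
    then show ?thesis
      by (simp add: hess_polar_add_left hess_polar_add_right hess_polar_commute[of d t ?f])
  qed
  \<comment> \<open>The coefficient of index \<open>r\<close> eliminates the unknown scale of the
    Hessian. Apart from the two linear terms, everything is quadratic in \<open>t\<close> or carries
    a factor \<nu>.\<close>
  have rel: "2 * hess_polar d ?f t n = \<eta> n * (2 * hess_polar d ?f t r) + \<eta> n * hess_quad d t r - hess_quad d t n
      + (\<nu> n * hess_quad d ?f r + 2 * (\<nu> n * hess_polar d ?f t r) + \<nu> n * hess_quad d t r)" for n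
  proof -
    have "hess_quad d b n / (b ?a)\<^sup>2 = (\<eta> n + \<nu> n) * (hess_quad d b r / (b ?a)\<^sup>2)"
      using nz by (simp add: \<nu>_def r_def)
    moreover have "hess_quad d ?f n = \<eta> n * hess_quad d ?f r" using fr' by (simp add: \<eta>_def)
    ultimately show ?thesis unfolding expand by (simp add: algebra_simps)
  qed
  have "mon (\<lambda>_. 0) = 1" by (simp add: mon_def)
  moreover have G1: "\<exists>u. (1, u) \<in> G" using graph_one[OF hG] by blast
  moreover have "\<exists>u. (?f k * ?f l, u) \<in> G" for k l using graph_mult[OF hG sf[OF hG] sf[OF hG]] by blast
  ultimately have s1: "\<nu> n * hess_quad d ?f r \<in> filt 2" for n
    by (intro small_sum \<nu>G) (metis mult.right_neutral)
  have s2: "\<nu> n * hess_polar d ?f t r \<in> filt 2" for n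
  proof (intro small_sum \<nu>G)
    fix k l assume "l \<le> d"
    then have "?f k * t l = ?f k * mon (\<lambda>j. if j = l then 1 else 0)"
      using mon_unit[of l 1] by simp
    moreover have "(?f k, special_form d k) \<in> G" by (rule sf[OF hG])
    ultimately show "\<exists>a \<alpha>. (\<exists>u. (a, u) \<in> G) \<and> ?f k * t l = a * mon \<alpha>" by (intro exI conjI)
  qed
  have s3: "\<nu> n * hess_quad d t r \<in> filt 2" for n
  proof (intro small_sum \<nu>G)
    fix k l assume kl: "k \<le> d" "l \<le> d"
    have "mon (\<lambda>j. (if j = k then 1 else 0) + (if j = l then 1 else 0)) = t k * t l"
      unfolding mon_add[of "\<lambda>j. if j = k then 1 else 0" "\<lambda>j. if j = l then 1 else 0"]
      by (simp only: mon_unit[OF kl(1)] mon_unit[OF kl(2)] power_one_right)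
    then have "t k * t l = 1 * mon (\<lambda>j. (if j = k then 1 else 0) + (if j = l then 1 else 0))"
      by (simp only: mult_1_left)
    with graph_one[OF hG] show "\<exists>a \<alpha>. (\<exists>u. (a, u) \<in> G) \<and> t k * t l = a * mon \<alpha>"
      by (intro exI conjI)
  qed
  have two: "(2, 2) \<in> G" using graph_of_nat[OF hG, of 2] by simp
  have rest: "\<eta> n * hess_quad d t r - hess_quad d t n + (\<nu> n * hess_quad d ?f r + 2 * (\<nu> n * hess_polar d ?f t r) + \<nu> n * hess_quad d t r) \<in> filt 2" for n
    by (intro filt_add filt_diff filt_scale[OF qt \<eta>G] qt s1 s3 filt_scale[OF s2 two])
  have ta: "t ?a = 0" using ba by (simp add: t_def special_form_def)
  have square: "t s \<in> filt 2" if "s \<le> d" for s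
    using that
  proof (induction s rule: less_induct)
    case (less s)
    show ?case
    proof (cases "s = ?a")
      case False
      \<comment> \<open>At this index \<open>t s\<close> appears with the pivot
        \<open>hess_weight d a s\<close>. The other term of the special form contributes
        \<open>t s'\<close> with s' = s - (d - 2 a) < s.\<close>
      define n where "n = ?a + s - 2"
      have n2: "n + 2 = ?a + s" using bd by (simp add: n_def)
      define s' where "s' = ?a + s - (d - ?a)"
      define tail where "tail = (if d - ?a \<le> ?a + s \<and> s' \<le> d then of_int (hess_weight d (d - ?a) s') * t s' else 0)"
      have tail: "tail \<in> filt 2"
      proof (cases "d - ?a \<le> ?a + s \<and> s' \<le> d")
        case True
        then have "s' < s" using bd by (auto simp: s'_def)
        then show ?thesis
          using less True filt_scale[OF _ graph_of_int[OF hG]] by (auto simp: tail_def)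
      next
        case False
        then show ?thesis unfolding tail_def by (simp only: if_False filt_zero)
      qed
      have lin: "hess_polar d ?f t n = of_int (hess_weight d ?a s) * t s + tail"
        unfolding hess_polar_special_form[OF d] n2 tail_def s'_def
        by (simp only: add_diff_cancel_left' le_add1 less.prems simp_thms if_True)
      \<comment> \<open>For s < a the factor \<open>\<eta> n\<close> is 0. Otherwise the linear part
        at \<open>r\<close> involves only \<open>t a\<close>, which is 0, and a coordinate of index
        3 a - d < a \<le> s, known by induction.\<close>
      have "\<eta> n * (2 * hess_polar d ?f t r) \<in> filt 2"
      proof (cases "s < ?a")
        case True
        then have "hess_quad d ?f n = 0" using n2 by (intro hess_quad_special_form_low[OF d]) simp
        then show ?thesis by (simp add: \<eta>_def filt_zero)
      next
        case nless: False
        have r2: "r + 2 = 2 * ?a" using bd by (simp add: r_def)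
        have "hess_polar d ?f t r \<in> filt 2"
          unfolding hess_polar_special_form[OF d] r2
        proof (intro filt_add)
          show "(if ?a \<le> 2 * ?a \<and> 2 * ?a - ?a \<le> d then of_int (hess_weight d ?a (2 * ?a - ?a)) * t (2 * ?a - ?a) else 0) \<in> filt 2"
            by (simp add: ta filt_zero)
          show "(if d - ?a \<le> 2 * ?a \<and> 2 * ?a - (d - ?a) \<le> d
            then of_int (hess_weight d (d - ?a) (2 * ?a - (d - ?a))) * t (2 * ?a - (d - ?a)) else 0) \<in> filt 2"
          proof (cases "d - ?a \<le> 2 * ?a \<and> 2 * ?a - (d - ?a) \<le> d")
            case True
            have lt: "2 * ?a - (d - ?a) < s" using bd nless by linarith
            have "t (2 * ?a - (d - ?a)) \<in> filt 2"
              by (rule less.IH[OF lt]) (use lt less.prems in linarith)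
            then show ?thesis
              using True filt_scale[OF _ graph_of_int[OF hG]] by (simp only: if_True simp_thms)
          next
            case False
            then show ?thesis by (simp only: if_False filt_zero)
          qed
        qed
        then show ?thesis by (intro filt_scale[OF filt_scale[OF _ two] \<eta>G])
      qed
      from filt_add[OF this rest[of n]] have "2 * hess_polar d ?f t n \<in> filt 2"
        by (simp only: rel[of n] add_diff_eq[symmetric] add.assoc)
      from filt_diff[OF this filt_scale[OF tail two]]
      have m: "of_int (2 * hess_weight d ?a s) * t s \<in> filt 2"
        by (simp add: lin algebra_simps)
      have piv: "(of_int (2 * hess_weight d ?a s), of_int (2 * hess_weight d ?a s)) \<in> G" by (rule graph_of_int[OF hG])
      have pn: "of_int (2 * hess_weight d ?a s) \<noteq> (0::'b)" using hess_weight_special_exp_nonzero[OF d less.prems] by simp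
      then have "of_int (2 * hess_weight d ?a s) \<noteq> (0::'a)" using graph_nonzero[OF hG piv] by blast
      then have "t s = inverse (of_int (2 * hess_weight d ?a s)) * (of_int (2 * hess_weight d ?a s) * t s)"
        by (metis left_inverse mult.assoc mult_1_left)
      then show ?thesis using filt_scale[OF m local_graph_inverse[OF G piv pn]] by simp
    qed (simp add: ta filt_zero)
  qed
  obtain u where "(t i, u) \<in> G" using integral_in_local[OF square i] by auto
  from graph_add[OF hG this sf[OF hG, of i]] show ?thesis by (force simp: t_def)
qed

section \<open>Binary forms and their Hessians in coordinates\<close>

definition bimon :: "nat \<Rightarrow> nat \<Rightarrow> nat \<Rightarrow>\<^sub>0 nat" where
  "bimon i j = Poly_Mapping.single 0 i + Poly_Mapping.single 1 j"

abbreviation form_mon :: "nat \<Rightarrow> nat \<Rightarrow> nat \<Rightarrow>\<^sub>0 nat" where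
  "form_mon d i \<equiv> bimon i (d - i)"

lemma lookup_bimon: "Poly_Mapping.lookup (bimon i j) k = (if k = 0 then i else if k = 1 then j else 0)"
  by (simp add: bimon_def lookup_add lookup_single when_def)

lemma bimon_inject [simp]: "bimon i j = bimon k l \<longleftrightarrow> i = k \<and> j = l"
proof
  assume "bimon i j = bimon k l"
  then have "Poly_Mapping.lookup (bimon i j) n = Poly_Mapping.lookup (bimon k l) n" for n by simp
  from this[of 0] this[of 1] show "i = k \<and> j = l" by (simp add: lookup_bimon)
qed simp

lemma bimon_add: "bimon i j + bimon k l = bimon (i + k) (j + l)"
  by (rule poly_mapping_eqI) (simp add: lookup_add lookup_bimon)

lemma bimon_diff_0: "bimon i j - Poly_Mapping.single 0 1 = bimon (i - 1) j"
  by (rule poly_mapping_eqI) (simp add: lookup_minus lookup_bimon lookup_single when_def)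

lemma bimon_diff_1: "bimon i j - Poly_Mapping.single 1 1 = bimon i (j - 1)"
  by (rule poly_mapping_eqI) (simp add: lookup_minus lookup_bimon lookup_single when_def)

lemma monomials_sum_eq:
  assumes "finite I" "Poly_Mapping.keys m \<subseteq> I"
  shows "(\<Sum>i\<in>Poly_Mapping.keys m. Poly_Mapping.lookup m i) = (\<Sum>i\<in>I. Poly_Mapping.lookup m i)"
  by (rule sum.mono_neutral_left) (use assms in \<open>auto simp: in_keys_iff\<close>)

lemma atMost_1: "{..1::nat} = {0, 1}"
  by auto

lemma form_coords_1: "form_coords d 1 = form_mon d ` {..d}"
proof (intro subset_antisym subsetI)
  fix m assume m: "m \<in> form_coords d 1"
  then have k: "Poly_Mapping.keys m \<subseteq> {..1}" by (simp add: monomials_def)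
  have "(\<Sum>i\<in>{..1}. Poly_Mapping.lookup m i) = d"
    using m monomials_sum_eq[OF _ k] by (simp add: monomials_def)
  then have s: "Poly_Mapping.lookup m 0 + Poly_Mapping.lookup m 1 = d" by (simp add: atMost_1)
  have "m = form_mon d (Poly_Mapping.lookup m 0)"
  proof (rule poly_mapping_eqI)
    fix i
    have "Poly_Mapping.lookup m i = 0" if "i > 1"
      using k that by (auto simp: in_keys_iff subset_iff)
    then show "Poly_Mapping.lookup m i = Poly_Mapping.lookup (form_mon d (Poly_Mapping.lookup m 0)) i"
      using s by (auto simp: lookup_bimon)
  qed
  then show "m \<in> form_mon d ` {..d}" using s by (intro image_eqI[of _ _ "Poly_Mapping.lookup m 0"]) auto
next
  fix m assume "m \<in> form_mon d ` {..d}"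
  then obtain i where i: "i \<le> d" "m = form_mon d i" by auto
  have k: "Poly_Mapping.keys m \<subseteq> {..1}" by (auto simp: i in_keys_iff lookup_bimon split: if_splits)
  show "m \<in> form_coords d 1"
    using k i monomials_sum_eq[OF _ k] by (simp add: monomials_def lookup_bimon atMost_1)
qed

lemma finite_form_coords: "finite (form_coords d 1)"
  unfolding form_coords_1 by simp

lemma inj_mono: "inj_on (form_mon d) {..d}"
  by (rule inj_onI) simp

lemma form_as_sum:
  assumes "Poly_Mapping.keys v \<subseteq> form_coords d 1"
  shows "v = (\<Sum>i\<le>d. Poly_Mapping.single (form_mon d i) (Poly_Mapping.lookup v (form_mon d i)))"
proof -
  have "v = (\<Sum>m\<in>Poly_Mapping.keys v. Poly_Mapping.single m (Poly_Mapping.lookup v m))"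
    by (rule sum_single_keys[symmetric])
  also have "\<dots> = (\<Sum>m\<in>form_mon d ` {..d}. Poly_Mapping.single m (Poly_Mapping.lookup v m))"
    by (rule sum.mono_neutral_left) (use assms[unfolded form_coords_1] in \<open>auto simp: in_keys_iff\<close>)
  finally show ?thesis by (simp add: sum.reindex[OF inj_mono])
qed

lemma pdiff_add: "pdiff i (F + G) = pdiff i F + pdiff i G"
  unfolding pdiff_def
  by (rule setsum_keys_plus_distrib) (simp_all add: distrib_left single_add)

lemma pdiff_sum: "pdiff i (sum F A) = (\<Sum>a\<in>A. pdiff i (F a))"
  by (induction A rule: infinite_finite_induct) (simp_all add: pdiff_add, simp_all add: pdiff_def)

lemma pdiff_single:
  "pdiff i (Poly_Mapping.single m a) =
    Poly_Mapping.single (m - Poly_Mapping.single i 1) (of_nat (Poly_Mapping.lookup m i) * a)"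
  by (simp add: pdiff_def)

text \<open>Truncated subtraction does no harm: wherever an exponent is cut off, the coefficient is
  0.\<close>

lemma hess_sum:
  fixes b :: "nat \<Rightarrow> 'k::comm_ring_1" and d :: nat
  defines "f \<equiv> \<Sum>i\<le>d. Poly_Mapping.single (form_mon d i) (b i)"
  shows "hess f = (\<Sum>i\<le>d. \<Sum>j\<le>d. Poly_Mapping.single (bimon (i - 2 + j) (d - i + (d - j - 2)))
        (of_nat (i * (i - 1) * ((d - j) * (d - j - 1))) * (b i * b j)))
    - (\<Sum>i\<le>d. \<Sum>j\<le>d. Poly_Mapping.single (bimon (i - 1 + (j - 1)) (d - i - 1 + (d - j - 1)))
        (of_nat (i * (d - i) * (j * (d - j))) * (b i * b j)))"
proof -
  have 00: "pdiff 0 (pdiff 0 f) = (\<Sum>i\<le>d. Poly_Mapping.single (bimon (i - 2) (d - i)) (of_nat (i * (i - 1)) * b i))"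
    unfolding f_def pdiff_sum pdiff_single bimon_diff_0
    by (intro sum.cong refl) (simp add: lookup_bimon numeral_2_eq_2 mult_ac)
  have 11: "pdiff 1 (pdiff 1 f) = (\<Sum>i\<le>d. Poly_Mapping.single (bimon i (d - i - 2)) (of_nat ((d - i) * (d - i - 1)) * b i))"
    unfolding f_def pdiff_sum pdiff_single bimon_diff_1
    by (intro sum.cong refl) (simp add: lookup_bimon numeral_2_eq_2 mult_ac)
  have 01: "pdiff 0 (pdiff 1 f) = (\<Sum>i\<le>d. Poly_Mapping.single (bimon (i - 1) (d - i - 1)) (of_nat (i * (d - i)) * b i))"
    unfolding f_def pdiff_sum pdiff_single bimon_diff_1 bimon_diff_0
    by (intro sum.cong refl) (simp add: lookup_bimon mult_ac)
  show ?thesis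
    unfolding hess_def 00 11 01 power2_eq_square sum_product mult_single bimon_add
    by (intro arg_cong2[where f = "(-)"] sum.cong refl) (simp_all add: mult_ac)
qed

lemma forms_0: "0 \<in> forms I e"
  by (simp add: forms_def)

lemma forms_add: "F \<in> forms I e \<Longrightarrow> G \<in> forms I e \<Longrightarrow> F + G \<in> forms I e"
  using keys_add[of F G] by (auto simp: forms_def)

lemma forms_uminus: "F \<in> forms I e \<Longrightarrow> - (F :: ('i, 'k::ab_group_add) mpoly) \<in> forms I e"
  by (auto simp: forms_def subset_iff in_keys_iff)

lemma forms_diff:
  "F \<in> forms I e \<Longrightarrow> G \<in> forms I e \<Longrightarrow> F - (G :: ('i, 'k::ab_group_add) mpoly) \<in> forms I e"
  using forms_add[OF _ forms_uminus] by (metis diff_conv_add_uminus)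

lemma forms_sum: "(\<And>a. a \<in> A \<Longrightarrow> F a \<in> forms I e) \<Longrightarrow> sum F A \<in> forms I e"
  by (induction A rule: infinite_finite_induct) (auto intro: forms_0 forms_add)

lemma forms_single: "c = 0 \<or> m \<in> monomials I e \<Longrightarrow> Poly_Mapping.single m c \<in> forms I e"
  by (auto simp: forms_def)

lemma forms_const: "Poly_Mapping.single 0 c \<in> forms I 0"
  by (intro forms_single) (simp add: monomials_def)

lemma forms_one: "1 \<in> forms I 0"
  unfolding single_one[symmetric] by (rule forms_const)

lemma forms_scale: "F \<in> forms I e \<Longrightarrow> Poly_Mapping.single 0 (c :: 'k::comm_ring_1) * F \<in> forms I e"
  using forms_mult[OF forms_const] by fastforce

lemma forms_prod:
  fixes F :: "'a \<Rightarrow> ('i, 'k::field) mpoly"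
  assumes "\<And>a. a \<in> A \<Longrightarrow> F a \<in> forms I (e a)"
  shows "prod F A \<in> forms I (sum e A)"
  using assms
proof (induction A rule: infinite_finite_induct)
  case (insert a A)
  then show ?case using forms_mult[of "F a" I "e a"] by simp
qed (simp_all add: forms_one)

lemma hess_forms:
  fixes v :: "(nat, 'k::field) mpoly"
  assumes "Poly_Mapping.keys v \<subseteq> form_coords d 1" "d \<ge> 2"
  shows "Poly_Mapping.keys (hess v) \<subseteq> form_coords (2 * d - 4) 1"
proof -
  have m: "bimon i j \<in> form_coords (2 * d - 4) 1" if "i + j = 2 * d - 4" for i j
    using that unfolding form_coords_1 by (auto intro!: image_eqI[of _ _ i])
  have "hess v \<in> forms {..1} (2 * d - 4)"
  proof (subst form_as_sum[OF assms(1)], subst hess_sum, intro forms_diff forms_sum forms_single)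
    fix i j assume "i \<in> {..d}" "j \<in> {..d}"
    let ?c = "Poly_Mapping.lookup v (form_mon d i) * Poly_Mapping.lookup v (form_mon d j)"
    show "of_nat (i * (i - 1) * ((d - j) * (d - j - 1))) * ?c = 0 \<or>
      bimon (i - 2 + j) (d - i + (d - j - 2)) \<in> form_coords (2 * d - 4) 1"
    proof (cases "i \<ge> 2 \<and> j + 2 \<le> d")
      case True
      then show ?thesis using \<open>i \<in> {..d}\<close> by (intro disjI2 m) auto
    next
      case False
      then have "i * (i - 1) * ((d - j) * (d - j - 1)) = 0" by auto
      then show ?thesis by (metis mult_zero_left of_nat_0)
    qed
    show "of_nat (i * (d - i) * (j * (d - j))) * ?c = 0 \<or>
      bimon (i - 1 + (j - 1)) (d - i - 1 + (d - j - 1)) \<in> form_coords (2 * d - 4) 1"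
    proof (cases "i = 0 \<or> i = d \<or> j = 0 \<or> j = d")
      case True
      then have "i * (d - i) * (j * (d - j)) = 0" by auto
      then show ?thesis by (metis mult_zero_left of_nat_0)
    next
      case False
      then show ?thesis using \<open>i \<in> {..d}\<close> \<open>j \<in> {..d}\<close> by (intro disjI2 m) auto
    qed
  qed
  then show ?thesis by (simp add: forms_def)
qed

text \<open>Coefficientwise form of Euler's relation. The left side is symmetrized in
  \<open>i\<close> and \<open>j\<close>, which accounts for the factor 2 in
  \<open>lookup_hess\<close>.\<close>

lemma hess_weight_hess:
  assumes "i \<le> d" "j \<le> d"
  shows "int (i * (i - 1) * ((d - j) * (d - j - 1))) + int (j * (j - 1) * ((d - i) * (d - i - 1)))
    - 2 * int (i * (d - i) * (j * (d - j))) = (int d - 1) * hess_weight d i j"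
proof -
  have s: "int (x * (x - 1)) = int x * (int x - 1)" for x
    by (cases x) (simp_all add: algebra_simps)
  have dd: "int (d - i) = int d - int i" "int (d - j) = int d - int j"
    using assms by (simp_all add: of_nat_diff)
  have "int (i * (i - 1) * ((d - j) * (d - j - 1))) = int i * (int i - 1) * ((int d - int j) * (int d - int j - 1))"
    "int (j * (j - 1) * ((d - i) * (d - i - 1))) = int j * (int j - 1) * ((int d - int i) * (int d - int i - 1))"
    unfolding of_nat_mult[of "i * (i - 1)"] of_nat_mult[of "j * (j - 1)"] s dd by (rule refl)+
  moreover have "int (i * (d - i) * (j * (d - j))) = int i * (int d - int i) * (int j * (int d - int j))"
    unfolding of_nat_mult dd by (rule refl)
  ultimately show ?thesis unfolding hess_weight_def by (simp only:) (simp add: algebra_simps)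
qed

lemma lookup_hess:
  fixes v :: "(nat, 'k::field) mpoly"
  assumes v: "Poly_Mapping.keys v \<subseteq> form_coords d 1" and d: "d \<ge> 2" and n: "n \<le> 2 * d - 4"
  shows "2 * Poly_Mapping.lookup (hess v) (form_mon (2 * d - 4) n) =
    (of_nat d - 1) * hess_quad d (\<lambda>i. Poly_Mapping.lookup v (form_mon d i)) n"
proof -
  define b where "b i = Poly_Mapping.lookup v (form_mon d i)" for i
  let ?S = "\<lambda>f. \<Sum>i\<le>d. \<Sum>j\<le>d. if i + j = n + 2 then of_nat (f i j) * (b i * b j) else 0 :: 'k"
  define c1 where "c1 i j = i * (i - 1) * ((d - j) * (d - j - 1))" for i j
  define c2 where "c2 i j = i * (d - i) * (j * (d - j))" for i j
  have "Poly_Mapping.lookup (hess v) (form_mon (2 * d - 4) n) = ?S c1 - ?S c2"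
  proof (subst form_as_sum[OF v], subst hess_sum, fold b_def,
      unfold lookup_minus lookup_sum lookup_single when_def bimon_inject,
      intro arg_cong2[where f = "(-)"] sum.cong refl)
    fix i j assume ij: "i \<in> {..d}" "j \<in> {..d}"
    show "(if i - 2 + j = n \<and> d - i + (d - j - 2) = 2 * d - 4 - n
       then of_nat (i * (i - 1) * ((d - j) * (d - j - 1))) * (b i * b j) else 0) =
      (if i + j = n + 2 then of_nat (c1 i j) * (b i * b j) else 0)"
    proof (cases "i \<ge> 2 \<and> j + 2 \<le> d")
      case True
      then have "(i - 2 + j = n \<and> d - i + (d - j - 2) = 2 * d - 4 - n) = (i + j = n + 2)"
        using ij n by auto
      then show ?thesis by (simp add: c1_def)
    next
      case False
      then have "i * (i - 1) * ((d - j) * (d - j - 1)) = 0" by auto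
      then show ?thesis unfolding c1_def by (metis mult_zero_left of_nat_0)
    qed
    show "(if i - 1 + (j - 1) = n \<and> d - i - 1 + (d - j - 1) = 2 * d - 4 - n
       then of_nat (i * (d - i) * (j * (d - j))) * (b i * b j) else 0) =
      (if i + j = n + 2 then of_nat (c2 i j) * (b i * b j) else 0)"
    proof (cases "i = 0 \<or> i = d \<or> j = 0 \<or> j = d")
      case True
      then have "i * (d - i) * (j * (d - j)) = 0" by auto
      then show ?thesis unfolding c2_def by (metis mult_zero_left of_nat_0)
    next
      case False
      then have "(i - 1 + (j - 1) = n \<and> d - i - 1 + (d - j - 1) = 2 * d - 4 - n) = (i + j = n + 2)"
        using ij n by auto
      then show ?thesis by (simp add: c2_def)
    qed
  qed
  moreover have "?S c1 = ?S (\<lambda>i j. c1 j i)"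
    by (subst sum.swap) (intro sum.cong refl, simp add: add.commute mult.commute)
  ultimately have "2 * Poly_Mapping.lookup (hess v) (form_mon (2 * d - 4) n) = ?S c1 + ?S (\<lambda>i j. c1 j i) - 2 * ?S c2"
    by simp
  also have "\<dots> = (\<Sum>i\<le>d. \<Sum>j\<le>d. if i + j = n + 2 then
      (of_nat (c1 i j) + of_nat (c1 j i) - 2 * of_nat (c2 i j)) * (b i * b j) else 0)"
    unfolding sum_distrib_left sum.distrib[symmetric] sum_subtractf[symmetric]
    by (intro sum.cong refl) (simp add: algebra_simps)
  also have "\<dots> = (of_nat d - 1) * hess_quad d b n"
    unfolding hess_polar_def sum_distrib_left
  proof (intro sum.cong refl)
    fix i j assume "i \<in> {..d}" "j \<in> {..d}"
    then have "of_int (int (c1 i j) + int (c1 j i) - 2 * int (c2 i j)) = (of_int ((int d - 1) * hess_weight d i j) :: 'k)"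
      using hess_weight_hess[of i d j] by (simp only: c1_def c2_def atMost_iff)
    then have "of_nat (c1 i j) + of_nat (c1 j i) - 2 * of_nat (c2 i j) = (of_nat d - 1) * (of_int (hess_weight d i j) :: 'k)"
      by simp
    then show "(if i + j = n + 2 then (of_nat (c1 i j) + of_nat (c1 j i) - 2 * of_nat (c2 i j)) * (b i * b j) else 0) =
      (of_nat d - 1) * (if i + j = n + 2 then of_int (hess_weight d i j) * b i * b j else 0)"
      by (simp add: mult.assoc)
  qed
  finally show ?thesis by (simp add: b_def[abs_def])
qed

lemma mpoly_at_zero: "mpoly_at 0 v = 0"
  by (simp add: mpoly_at_def)

lemma mpoly_at_one: "mpoly_at 1 v = 1"
  using mpoly_at_single[of 0 1 v] by simp

lemma mpoly_at_uminus: "mpoly_at (- F) v = - mpoly_at (F :: ('i, 'k::comm_ring_1) mpoly) v"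
  using mpoly_at_add[of F "- F" v] by (simp add: mpoly_at_zero eq_neg_iff_add_eq_0 add.commute)

lemma mpoly_at_diff: "mpoly_at (F - G) v = mpoly_at F v - mpoly_at (G :: ('i, 'k::comm_ring_1) mpoly) v"
  using mpoly_at_add[of F "- G" v] by (simp add: mpoly_at_uminus)

lemma mpoly_at_const: "mpoly_at (Poly_Mapping.single 0 c) v = c"
  by (simp add: mpoly_at_single)

lemma mpoly_at_prod: "mpoly_at (prod F A) v = (\<Prod>a\<in>A. mpoly_at (F a) v)"
  by (induction A rule: infinite_finite_induct) (simp_all add: mpoly_at_one mpoly_at_mult)

definition mpoly_var :: "'i \<Rightarrow> ('i, 'k::comm_semiring_1) mpoly" where
  "mpoly_var i = Poly_Mapping.single (Poly_Mapping.single i 1) 1"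

lemma mpoly_at_mpoly_var: "mpoly_at (mpoly_var i) v = Poly_Mapping.lookup v i"
  by (simp add: mpoly_var_def mpoly_at_single)

lemma mpoly_var_forms: "i \<in> I \<Longrightarrow> mpoly_var i \<in> forms I 1"
  unfolding mpoly_var_def by (intro forms_single) (simp add: monomials_def)

lemma mpoly_var_nonzero: "mpoly_var i \<noteq> (0 :: ('i, 'k::comm_ring_1) mpoly)"
  unfolding mpoly_var_def by (metis lookup_single_eq lookup_zero zero_neq_one)

text \<open>The weights are integers, so the expression commutes with ring homomorphisms; used for
  evaluation and for the embedding into the fraction field.\<close>

lemma hess_polar_hom:
  fixes f :: "'a::comm_ring_1 \<Rightarrow> 'b::comm_ring_1"
  assumes add: "\<And>x y. f (x + y) = f x + f y" and mult: "\<And>x y. f (x * y) = f x * f y" and one: "f 1 = 1"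
  shows "f (hess_polar d b c n) = hess_polar d (\<lambda>i. f (b i)) (\<lambda>i. f (c i)) n"
proof -
  have 0: "f 0 = 0" using add[of 0 0] by simp
  have um: "f (- x) = - f x" for x
    using add[of x "- x"] by (simp add: 0 eq_neg_iff_add_eq_0 add.commute)
  have nat: "f (of_nat m) = of_nat m" for m by (induction m) (simp_all add: 0 add one)
  have int: "f (of_int z) = of_int z" for z
    by (cases z) (simp_all add: nat um del: of_nat_Suc)
  have sum: "f (sum g A) = (\<Sum>a\<in>A. f (g a))" for g :: "nat \<Rightarrow> 'a" and A
    by (induction A rule: infinite_finite_induct) (simp_all add: 0 add)
  show ?thesis
    unfolding hess_polar_def sum by (intro sum.cong refl) (simp add: mult int 0)
qed

lemma mpoly_at_hess_polar:
  "mpoly_at (hess_polar d b c n) v = hess_polar d (\<lambda>i. mpoly_at (b i) v) (\<lambda>i. mpoly_at (c i) (v :: 'i \<Rightarrow>\<^sub>0 'k::comm_ring_1)) n"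
  by (rule hess_polar_hom) (simp_all add: mpoly_at_add mpoly_at_mult mpoly_at_one)

lemma hess_polar_forms:
  fixes b :: "nat \<Rightarrow> ('i, 'k::comm_ring_1) mpoly"
  assumes "\<And>i. i \<le> d \<Longrightarrow> b i \<in> forms I e" "\<And>i. i \<le> d \<Longrightarrow> c i \<in> forms I e'"
  shows "hess_polar d b c n \<in> forms I (e + e')"
proof -
  have int: "(of_int z :: ('i, 'k) mpoly) = Poly_Mapping.single 0 (of_int z)" for z by simp
  have "Poly_Mapping.single 0 (of_int z) * b i * c j \<in> forms I (e + e')" if "i \<le> d" "j \<le> d" for z i j
    unfolding mult.assoc using that by (intro forms_scale forms_mult assms)
  then show ?thesis
    unfolding hess_polar_def int by (intro forms_sum) (simp add: forms_0)
qed

text \<open>The generic form: its coefficients are the coordinate functions on the space of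
  forms.\<close>

definition gen_form :: "nat \<Rightarrow> nat \<Rightarrow> (nat \<Rightarrow>\<^sub>0 nat, 'k::comm_ring_1) mpoly" where
  "gen_form d i = mpoly_var (form_mon d i)"

definition special_form_poly :: "nat \<Rightarrow> (nat, 'k::comm_ring_1) mpoly" where
  "special_form_poly d = (\<Sum>i\<le>d. Poly_Mapping.single (form_mon d i) (special_form d i))"

lemma form_mon_eq: "form_mon d i = form_mon d j \<longleftrightarrow> i = j"
  by auto

lemma sum_single_lookup:
  "i \<le> d \<Longrightarrow> Poly_Mapping.lookup (\<Sum>i\<le>d. Poly_Mapping.single (form_mon d i) (b i)) (form_mon d i) = b i"
  by (simp add: lookup_sum lookup_single when_def form_mon_eq del: bimon_inject)

lemma sum_single_keys_subset:
  "Poly_Mapping.keys (\<Sum>i\<le>d. Poly_Mapping.single (form_mon d i) (b i)) \<subseteq> form_coords d 1"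
  unfolding form_coords_1 by (rule order_trans[OF keys_sum]) auto

lemma special_form_poly_keys: "Poly_Mapping.keys (special_form_poly d) \<subseteq> form_coords d 1"
  unfolding special_form_poly_def by (rule sum_single_keys_subset)

lemma special_form_poly_lookup: "i \<le> d \<Longrightarrow> Poly_Mapping.lookup (special_form_poly d) (form_mon d i) = special_form d i"
  unfolding special_form_poly_def by (rule sum_single_lookup)

lemma hess_quad_gen_form:
  fixes v :: "(nat, 'k::field) mpoly"
  assumes "Poly_Mapping.keys v \<subseteq> form_coords d 1" "d \<ge> 2" "n \<le> 2 * d - 4"
  shows "(of_nat d - 1) * mpoly_at (hess_quad d (gen_form d) n) v =
    2 * Poly_Mapping.lookup (hess v) (form_mon (2 * d - 4) n)"
  unfolding lookup_hess[OF assms] mpoly_at_hess_polar gen_form_def mpoly_at_mpoly_var ..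

text \<open>The polynomials P(hess f) with P a form of degree \<open>e\<close>. Stating this by
  values avoids substitution into P and reduces the ring operations to the rules for
  \<open>mpoly_at\<close>.\<close>

definition pullback :: "nat \<Rightarrow> nat \<Rightarrow> (nat \<Rightarrow>\<^sub>0 nat, 'k::field) mpoly set" where
  "pullback d e = {p. \<exists>P\<in>forms (form_coords (2 * d - 4) 1) e.
     \<forall>v. Poly_Mapping.keys v \<subseteq> form_coords d 1 \<longrightarrow> mpoly_at p v = mpoly_at P (hess v)}"

lemma pullback_one: "1 \<in> pullback d 0"
  unfolding pullback_def using forms_one by (auto intro!: bexI[of _ 1] simp: mpoly_at_one)

lemma pullback_diff:
  assumes "p \<in> pullback d e" "q \<in> pullback d e"
  shows "p - q \<in> pullback d e"
proof -
  obtain P where P: "P \<in> forms (form_coords (2 * d - 4) 1) e"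
    "\<And>v. Poly_Mapping.keys v \<subseteq> form_coords d 1 \<Longrightarrow> mpoly_at p v = mpoly_at P (hess v)"
    using assms(1) by (auto simp: pullback_def)
  obtain Q where Q: "Q \<in> forms (form_coords (2 * d - 4) 1) e"
    "\<And>v. Poly_Mapping.keys v \<subseteq> form_coords d 1 \<Longrightarrow> mpoly_at q v = mpoly_at Q (hess v)"
    using assms(2) by (auto simp: pullback_def)
  show ?thesis
    unfolding pullback_def using forms_diff[OF P(1) Q(1)] P(2) Q(2)
    by (intro CollectI bexI[of _ "P - Q"]) (auto simp: mpoly_at_diff)
qed

lemma pullback_mult:
  assumes "p \<in> pullback d e" "q \<in> pullback d e'"
  shows "p * q \<in> pullback d (e + e')"
proof -
  obtain P where P: "P \<in> forms (form_coords (2 * d - 4) 1) e"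
    "\<And>v. Poly_Mapping.keys v \<subseteq> form_coords d 1 \<Longrightarrow> mpoly_at p v = mpoly_at P (hess v)"
    using assms(1) by (auto simp: pullback_def)
  obtain Q where Q: "Q \<in> forms (form_coords (2 * d - 4) 1) e'"
    "\<And>v. Poly_Mapping.keys v \<subseteq> form_coords d 1 \<Longrightarrow> mpoly_at q v = mpoly_at Q (hess v)"
    using assms(2) by (auto simp: pullback_def)
  show ?thesis
    unfolding pullback_def using forms_mult[OF P(1) Q(1)] P(2) Q(2)
    by (intro CollectI bexI[of _ "P * Q"]) (auto simp: mpoly_at_mult)
qed

lemma hess_quad_pullback:
  assumes "d \<ge> 2"
  shows "hess_quad d (gen_form d) n \<in> (pullback d 1 :: (nat \<Rightarrow>\<^sub>0 nat, 'k::field_char_0) mpoly set)"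
proof (cases "n \<le> 2 * d - 4")
  case True
  let ?m = "form_mon (2 * d - 4) n"
  let ?P = "Poly_Mapping.single 0 (2 / (of_nat d - 1)) * mpoly_var ?m :: (nat \<Rightarrow>\<^sub>0 nat, 'k) mpoly"
  have "?m \<in> form_coords (2 * d - 4) 1" unfolding form_coords_1 using True by blast
  then have "?P \<in> forms (form_coords (2 * d - 4) 1) 1" by (intro forms_scale mpoly_var_forms)
  moreover have "mpoly_at (hess_quad d (gen_form d) n) v = mpoly_at ?P (hess v)"
    if "Poly_Mapping.keys v \<subseteq> form_coords d 1" for v
  proof -
    have "of_nat d \<noteq> (1::'k)" using assms by (metis of_nat_1 of_nat_eq_iff numeral_le_one_iff semiring_norm(69))
    then show ?thesis
      using hess_quad_gen_form[OF that assms True] by (simp add: mpoly_at_mult mpoly_at_const mpoly_at_mpoly_var field_simps)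
  qed
  ultimately show ?thesis unfolding pullback_def by blast
next
  case False
  then show ?thesis
    unfolding pullback_def using forms_0 by (auto intro!: bexI[of _ 0] simp: hess_polar_above mpoly_at_zero)
qed

text \<open>The local ring R of the overview, each fraction paired with its value at the special
  form. Equal degrees of numerator and denominator make it depend on hess f only up to
  scalars.\<close>

definition pullback_graph :: "nat \<Rightarrow> ((nat \<Rightarrow>\<^sub>0 nat, 'k::field) mpoly fract \<times> 'k) set" where
  "pullback_graph d = {(Fract p q, mpoly_at p (special_form_poly d) / mpoly_at q (special_form_poly d)) |p q e.
     p \<in> pullback d e \<and> q \<in> pullback d e \<and> mpoly_at q (special_form_poly d) \<noteq> 0}"

lemma pullback_graphI:
  "p \<in> pullback d e \<Longrightarrow> q \<in> pullback d e \<Longrightarrow> mpoly_at q (special_form_poly d) \<noteq> 0 \<Longrightarrow>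
    x = Fract p q \<Longrightarrow> u = mpoly_at p (special_form_poly d) / mpoly_at q (special_form_poly d) \<Longrightarrow> (x, u) \<in> pullback_graph d"
  unfolding pullback_graph_def by blast

lemma pullback_graphE:
  assumes "(x, u) \<in> pullback_graph d"
  obtains p q e where "p \<in> pullback d e" "q \<in> pullback d e" "mpoly_at q (special_form_poly d) \<noteq> 0" "q \<noteq> 0"
    "x = Fract p q" "u = mpoly_at p (special_form_poly d) / mpoly_at q (special_form_poly d)"
proof -
  obtain p q e where "p \<in> pullback d e" "q \<in> pullback d e" "mpoly_at q (special_form_poly d) \<noteq> 0"
    "x = Fract p q" "u = mpoly_at p (special_form_poly d) / mpoly_at q (special_form_poly d)"
    using assms unfolding pullback_graph_def by blast
  moreover from this(3) have "q \<noteq> 0" by (auto simp: mpoly_at_zero)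
  ultimately show thesis by (rule_tac that) auto
qed

lemma pullback_graph_local: "local_graph (pullback_graph d :: (_ \<times> 'k::field) set)"
  unfolding local_graph_def hom_graph_def
proof (intro conjI allI impI)
  show "(1, 1) \<in> pullback_graph d"
    by (rule pullback_graphI[OF pullback_one pullback_one]) (simp_all add: mpoly_at_one One_fract_def)
next
  fix x y :: "(nat \<Rightarrow>\<^sub>0 nat, 'k) mpoly fract" and u v
  assume "(x, u) \<in> pullback_graph d" "(y, v) \<in> pullback_graph d"
  then obtain p q e p' q' e' where 1: "p \<in> pullback d e" "q \<in> pullback d e" "mpoly_at q (special_form_poly d) \<noteq> 0" "q \<noteq> 0"
    "x = Fract p q" "u = mpoly_at p (special_form_poly d) / mpoly_at q (special_form_poly d)"
    and 2: "p' \<in> pullback d e'" "q' \<in> pullback d e'" "mpoly_at q' (special_form_poly d) \<noteq> 0" "q' \<noteq> 0"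
    "y = Fract p' q'" "v = mpoly_at p' (special_form_poly d) / mpoly_at q' (special_form_poly d)"
    by (elim pullback_graphE)
  have qq: "q * q' \<in> pullback d (e + e')" using 1 2 by (intro pullback_mult)
  have "p * q' - p' * q \<in> pullback d (e + e')"
    using pullback_mult[OF 1(1) 2(2)] pullback_mult[OF 2(1) 1(2)] by (intro pullback_diff) (simp_all add: add.commute)
  then show "(x - y, u - v) \<in> pullback_graph d"
    by (rule pullback_graphI[OF _ qq])
       (use 1 2 in \<open>simp_all add: mpoly_at_mult mpoly_at_diff diff_frac_eq\<close>)
  have "p * p' \<in> pullback d (e + e')" using 1 2 by (intro pullback_mult)
  then show "(x * y, u * v) \<in> pullback_graph d"
    by (rule pullback_graphI[OF _ qq]) (use 1 2 in \<open>simp_all add: mpoly_at_mult\<close>)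
next
  fix u assume "(0 :: (nat \<Rightarrow>\<^sub>0 nat, 'k) mpoly fract, u) \<in> pullback_graph d"
  then obtain p q e where 1: "q \<noteq> 0" "0 = Fract p q" "u = mpoly_at p (special_form_poly d) / mpoly_at q (special_form_poly d)"
    by (elim pullback_graphE)
  then have "p = 0" by (simp add: Zero_fract_def eq_fract)
  then show "u = 0" by (simp add: 1 mpoly_at_zero)
next
  fix x :: "(nat \<Rightarrow>\<^sub>0 nat, 'k) mpoly fract" and u
  assume "(x, u) \<in> pullback_graph d" "u \<noteq> 0"
  then obtain p q e where 1: "p \<in> pullback d e" "q \<in> pullback d e" "mpoly_at q (special_form_poly d) \<noteq> 0" "q \<noteq> 0"
    "x = Fract p q" "u = mpoly_at p (special_form_poly d) / mpoly_at q (special_form_poly d)"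
    by (elim pullback_graphE)
  then show "(inverse x, inverse u) \<in> pullback_graph d"
    using \<open>u \<noteq> 0\<close> by (intro pullback_graphI[OF 1(2,1)]) auto
qed

text \<open>\<open>coords_in_local\<close> for the generic form over the fraction field, cleared of
  denominators: an identity of polynomials can be evaluated at every form, also where
  \<open>q\<close> vanishes.\<close>

lemma gen_coords_in_local:
  assumes d: "d \<ge> 5" and i: "i \<le> d"
  shows "\<exists>p q e. p \<in> pullback d e \<and> q \<in> pullback d e \<and> mpoly_at q (special_form_poly d) \<noteq> 0 \<and>
    gen_form d i * q = gen_form d (special_exp d) * (p :: (nat \<Rightarrow>\<^sub>0 nat, 'k::{alg_closed_field, field_char_0}) mpoly)"
proof -
  let ?r = "2 * special_exp d - 2"
  let ?X = "gen_form d :: nat \<Rightarrow> (nat \<Rightarrow>\<^sub>0 nat, 'k) mpoly"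
  note bd = special_exp_bounds[OF d]
  have d2: "d \<ge> 2" using d by simp
  define b where "b i = Fract (?X i) 1" for i
  have hqb: "hess_quad d b n = Fract (hess_quad d ?X n) 1" for n
    unfolding b_def by (rule hess_polar_hom[symmetric]) (simp_all add: One_fract_def)
  have at: "mpoly_at (hess_quad d ?X n) (special_form_poly d) = hess_quad d (special_form d) n" for n
    unfolding mpoly_at_hess_polar gen_form_def mpoly_at_mpoly_var
    by (rule hess_polar_cong) (simp_all add: special_form_poly_lookup)
  have "hess_quad d (special_form d) ?r \<noteq> (0::'k)"
    using hess_weight_special_exp_nonzero[OF d bd(5)] by (simp add: hess_quad_special_form_special_exp[OF d])
  then have r0: "mpoly_at (hess_quad d ?X ?r) (special_form_poly d) \<noteq> 0" by (simp add: at)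
  then have r0': "hess_quad d ?X ?r \<noteq> 0" by (auto simp: mpoly_at_zero)
  have "b i / b (special_exp d) \<in> fst ` (pullback_graph d :: (_ \<times> 'k) set)"
  proof (rule coords_in_local[OF d pullback_graph_local _ _ _ i])
    show "b (special_exp d) \<noteq> 0"
      by (simp add: b_def Zero_fract_def eq_fract gen_form_def mpoly_var_nonzero)
    show "hess_quad d b ?r \<noteq> 0"
      using r0' by (simp add: hqb Zero_fract_def eq_fract)
    show "(hess_quad d b n / hess_quad d b ?r, hess_quad d (special_form d) n / hess_quad d (special_form d) ?r) \<in> pullback_graph d" for n
    proof (rule pullback_graphI[OF hess_quad_pullback[OF d2] hess_quad_pullback[OF d2] r0])
      show "hess_quad d b n / hess_quad d b ?r = Fract (hess_quad d ?X n) (hess_quad d ?X ?r)" by (simp add: hqb)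
      show "hess_quad d (special_form d) n / hess_quad d (special_form d) ?r =
        mpoly_at (hess_quad d ?X n) (special_form_poly d) / mpoly_at (hess_quad d ?X ?r) (special_form_poly d)"
        unfolding at ..
    qed
  qed
  then obtain u where "(b i / b (special_exp d), u) \<in> pullback_graph d" by auto
  then obtain p q e where pq: "p \<in> pullback d e" "q \<in> pullback d e" "mpoly_at q (special_form_poly d) \<noteq> 0" "q \<noteq> 0"
    "b i / b (special_exp d) = Fract p q"
    by (elim pullback_graphE)
  have "?X (special_exp d) \<noteq> 0" by (simp add: gen_form_def mpoly_var_nonzero)
  then have "?X i * q = ?X (special_exp d) * p"
    using pq(4,5) by (simp add: b_def eq_fract mult.commute)
  then show ?thesis using pq by blast
qed

theorem hessian_inverse_forms:
  assumes d: "d \<ge> 5"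
  shows "\<exists>e F. (\<forall>i\<le>d. F i \<in> forms (form_coords (2 * d - 4) 1) e) \<and>
    mpoly_at (F (special_exp d)) (hess (special_form_poly d)) \<noteq> (0::'k::{alg_closed_field, field_char_0}) \<and>
    (\<forall>v i. Poly_Mapping.keys v \<subseteq> form_coords d 1 \<longrightarrow> i \<le> d \<longrightarrow>
      Poly_Mapping.lookup v (form_mon d i) * mpoly_at (F (special_exp d)) (hess v) =
      Poly_Mapping.lookup v (form_mon d (special_exp d)) * mpoly_at (F i) (hess v))"
proof -
  let ?J = "form_coords (2 * d - 4) 1"
  let ?a = "special_exp d"
  have a: "?a \<le> d" using special_exp_bounds[OF d] by simp
  have "\<exists>P Q e. P \<in> forms ?J e \<and> Q \<in> forms ?J e \<and> mpoly_at Q (hess (special_form_poly d)) \<noteq> (0::'k) \<and>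
    (\<forall>v. Poly_Mapping.keys v \<subseteq> form_coords d 1 \<longrightarrow>
      Poly_Mapping.lookup v (form_mon d i) * mpoly_at Q (hess v) =
      Poly_Mapping.lookup v (form_mon d ?a) * mpoly_at P (hess v))" if i: "i \<le> d" for i
  proof -
    obtain p q :: "(nat \<Rightarrow>\<^sub>0 nat, 'k) mpoly" and e where pq: "p \<in> pullback d e" "q \<in> pullback d e"
      "mpoly_at q (special_form_poly d) \<noteq> 0" "gen_form d i * q = gen_form d ?a * p"
      using gen_coords_in_local[OF d i] by blast
    obtain P where P: "P \<in> forms ?J e"
      "\<And>v. Poly_Mapping.keys v \<subseteq> form_coords d 1 \<Longrightarrow> mpoly_at p v = mpoly_at P (hess v)"
      using pq(1) by (auto simp: pullback_def)
    obtain Q where Q: "Q \<in> forms ?J e"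
      "\<And>v. Poly_Mapping.keys v \<subseteq> form_coords d 1 \<Longrightarrow> mpoly_at q v = mpoly_at Q (hess v)"
      using pq(2) by (auto simp: pullback_def)
    have "Poly_Mapping.lookup v (form_mon d i) * mpoly_at Q (hess v) =
      Poly_Mapping.lookup v (form_mon d ?a) * mpoly_at P (hess v)"
      if "Poly_Mapping.keys v \<subseteq> form_coords d 1" for v
      using arg_cong[OF pq(4), of "\<lambda>x. mpoly_at x v"]
      by (simp add: mpoly_at_mult gen_form_def mpoly_at_mpoly_var P(2)[OF that] Q(2)[OF that])
    then show ?thesis using P(1) Q(1) pq(3) Q(2)[OF special_form_poly_keys] by auto
  qed
  then obtain P Q e where PQ: "\<And>i. i \<le> d \<Longrightarrow> P i \<in> forms ?J (e i) \<and> Q i \<in> forms ?J (e i) \<and>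
    mpoly_at (Q i) (hess (special_form_poly d)) \<noteq> (0::'k) \<and>
    (\<forall>v. Poly_Mapping.keys v \<subseteq> form_coords d 1 \<longrightarrow>
      Poly_Mapping.lookup v (form_mon d i) * mpoly_at (Q i) (hess v) =
      Poly_Mapping.lookup v (form_mon d ?a) * mpoly_at (P i) (hess v))"
    by metis
  \<comment> \<open>Passage to a common denominator: the fractions P_i / Q_i become
    \<open>F i\<close> over \<open>F ?a\<close>, and all entries get the same degree, as homogeneous
    coordinates require.\<close>
  define F where "F i = (if i = ?a then \<Prod>j\<le>d. Q j else P i * (\<Prod>j\<in>{..d} - {i}. Q j))" for i
  have "F i \<in> forms ?J (\<Sum>j\<le>d. e j)" if "i \<le> d" for i
  proof (cases "i = ?a")
    case True
    then show ?thesis using PQ by (auto simp: F_def intro!: forms_prod)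
  next
    case False
    have "P i * (\<Prod>j\<in>{..d} - {i}. Q j) \<in> forms ?J (e i + (\<Sum>j\<in>{..d} - {i}. e j))"
      using PQ that by (intro forms_mult forms_prod) auto
    also have "e i + (\<Sum>j\<in>{..d} - {i}. e j) = (\<Sum>j\<le>d. e j)"
      using that by (intro sum.remove[symmetric]) auto
    finally show ?thesis using False by (simp add: F_def)
  qed
  moreover have "mpoly_at (F ?a) (hess (special_form_poly d)) \<noteq> 0"
    using PQ by (auto simp: F_def mpoly_at_prod)
  moreover have "Poly_Mapping.lookup v (form_mon d i) * mpoly_at (F ?a) (hess v) =
      Poly_Mapping.lookup v (form_mon d ?a) * mpoly_at (F i) (hess v)"
    if v: "Poly_Mapping.keys v \<subseteq> form_coords d 1" and i: "i \<le> d" for v i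
  proof (cases "i = ?a")
    case False
    have "mpoly_at (F ?a) (hess v) = mpoly_at (Q i) (hess v) * (\<Prod>j\<in>{..d} - {i}. mpoly_at (Q j) (hess v))"
      by (simp add: F_def mpoly_at_prod, intro prod.remove) (use i in auto)
    moreover have "Poly_Mapping.lookup v (form_mon d i) * mpoly_at (Q i) (hess v) =
      Poly_Mapping.lookup v (form_mon d ?a) * mpoly_at (P i) (hess v)"
      using PQ[OF i] v by blast
    ultimately show ?thesis
      using False by (simp add: F_def mpoly_at_mult mpoly_at_prod mult.assoc[symmetric])
  qed simp
  ultimately show ?thesis by blast
qed

section \<open>The birational inverse\<close>

lemma proj_space_point:
  assumes "p \<in> proj_space I" "v \<in> p"
  shows "p = proj_point v" "v \<noteq> 0" "Poly_Mapping.keys v \<subseteq> I"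
proof -
  obtain u where u: "p = proj_point u" "u \<noteq> 0" "Poly_Mapping.keys u \<subseteq> I"
    using assms(1) by (auto simp: proj_space_def)
  then obtain c where c: "c \<noteq> 0" "v = Poly_Mapping.map ((*) c) u"
    using assms(2) by (auto simp: proj_point_def)
  show "p = proj_point v" using u c by (simp add: proj_point_scale)
  show "Poly_Mapping.keys v \<subseteq> I" using u c by (simp add: keys_scale)
  show "v \<noteq> 0" using u(2) c by (metis keys_eq_empty keys_scale)
qed

lemma proj_spaceE:
  assumes "p \<in> proj_space I"
  obtains v where "p = proj_point v" "v \<noteq> 0" "Poly_Mapping.keys v \<subseteq> I"
  using assms by (auto simp: proj_space_def)

lemma proj_point_in_space: "v \<noteq> 0 \<Longrightarrow> Poly_Mapping.keys v \<subseteq> I \<Longrightarrow> proj_point v \<in> proj_space I"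
  by (auto simp: proj_space_def)

lemma proj_pointD: "w \<in> proj_point v \<Longrightarrow> \<exists>c. c \<noteq> 0 \<and> w = Poly_Mapping.map ((*) c) v"
  by (auto simp: proj_point_def)

lemma mpoly_at_proj_point:
  assumes "F \<in> forms I e" "w \<in> proj_point v"
  shows "mpoly_at F w = 0 \<longleftrightarrow> mpoly_at F v = 0"
  using proj_pointD[OF assms(2)] mpoly_at_scale[OF assms(1)] by auto

lemma zero_locus_proj_point:
  assumes S: "S \<subseteq> (\<Union>e. forms I e)" and v: "v \<noteq> 0" "Poly_Mapping.keys v \<subseteq> I"
  shows "proj_point v \<in> zero_locus I S \<longleftrightarrow> (\<forall>F\<in>S. mpoly_at F v = 0)"
proof
  assume "proj_point v \<in> zero_locus I S"
  then show "\<forall>F\<in>S. mpoly_at F v = 0" using proj_point_self[of v] by (auto simp: zero_locus_def)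
next
  assume z: "\<forall>F\<in>S. mpoly_at F v = 0"
  have "mpoly_at F w = 0" if F: "F \<in> S" and w: "w \<in> proj_point v" for F w
  proof -
    obtain e where "F \<in> forms I e" using S F by blast
    then show ?thesis using mpoly_at_proj_point[OF _ w] z F by blast
  qed
  then show "proj_point v \<in> zero_locus I S"
    using proj_point_in_space[OF v] by (auto simp: zero_locus_def)
qed

section \<open>Polynomial functions along lines and irreducibility of parametrized sets\<close>

definition polyfun :: "('a::comm_ring_1 \<Rightarrow> 'a) \<Rightarrow> bool" where
  "polyfun f \<longleftrightarrow> (\<exists>p. \<forall>t. f t = poly p t)"

lemma polyfun_const: "polyfun (\<lambda>_. c)"
  unfolding polyfun_def by (rule exI[of _ "[:c:]"]) simp

lemma polyfun_id: "polyfun (\<lambda>t. t)"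
  unfolding polyfun_def by (rule exI[of _ "[:0, 1:]"]) simp

lemma polyfun_add: "polyfun f \<Longrightarrow> polyfun g \<Longrightarrow> polyfun (\<lambda>t. f t + g t)"
  unfolding polyfun_def by (metis poly_add)

lemma polyfun_mult: "polyfun f \<Longrightarrow> polyfun g \<Longrightarrow> polyfun (\<lambda>t. f t * g t)"
  unfolding polyfun_def by (metis poly_mult)

lemma polyfun_power: "polyfun f \<Longrightarrow> polyfun (\<lambda>t. f t ^ n)"
  by (induction n) (simp_all add: polyfun_const polyfun_mult)

lemma polyfun_sum: "(\<And>a. a \<in> A \<Longrightarrow> polyfun (f a)) \<Longrightarrow> polyfun (\<lambda>t. \<Sum>a\<in>A. f a t)"
  by (induction A rule: infinite_finite_induct) (simp_all add: polyfun_const polyfun_add)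

lemma polyfun_prod: "(\<And>a. a \<in> A \<Longrightarrow> polyfun (f a)) \<Longrightarrow> polyfun (\<lambda>t. \<Prod>a\<in>A. f a t)"
  by (induction A rule: infinite_finite_induct) (simp_all add: polyfun_const polyfun_mult)

lemma polyfun_mpoly_at:
  "(\<And>i. polyfun (\<lambda>t. Poly_Mapping.lookup (u t) i)) \<Longrightarrow> polyfun (\<lambda>t. mpoly_at F (u t))"
  unfolding mpoly_at_def
  by (intro polyfun_sum polyfun_mult polyfun_const polyfun_prod polyfun_power)

lemma polyfun_finite_zeros:
  fixes f :: "'a::idom \<Rightarrow> 'a"
  assumes "polyfun f" "f s \<noteq> 0"
  shows "finite {t. f t = 0}"
proof -
  obtain p where p: "\<And>t. f t = poly p t" using assms(1) by (auto simp: polyfun_def)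
  then have "p \<noteq> 0" using assms(2) by auto
  then show ?thesis using poly_roots_finite by (simp add: p)
qed

definition line :: "('i \<Rightarrow>\<^sub>0 'k::field) \<Rightarrow> ('i \<Rightarrow>\<^sub>0 'k) \<Rightarrow> 'k \<Rightarrow> 'i \<Rightarrow>\<^sub>0 'k" where
  "line v w t = v + Poly_Mapping.map ((*) t) (w - v)"

lemma line_0: "line v w 0 = v" and line_1: "line v w 1 = w"
  by (rule poly_mapping_eqI; simp add: line_def lookup_add lookup_scale lookup_minus)+

lemma line_keys: "Poly_Mapping.keys v \<subseteq> I \<Longrightarrow> Poly_Mapping.keys w \<subseteq> I \<Longrightarrow> Poly_Mapping.keys (line v w t) \<subseteq> I"
proof
  fix i assume vw: "Poly_Mapping.keys v \<subseteq> I" "Poly_Mapping.keys w \<subseteq> I"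
    and i: "i \<in> Poly_Mapping.keys (line v w t)"
  show "i \<in> I"
  proof (rule ccontr)
    assume "i \<notin> I"
    then have "Poly_Mapping.lookup v i = 0" "Poly_Mapping.lookup w i = 0"
      using vw by (auto simp: in_keys_iff subset_iff)
    then show False using i by (simp add: line_def in_keys_iff lookup_add lookup_scale lookup_minus)
  qed
qed

lemma polyfun_line: "polyfun (\<lambda>t. Poly_Mapping.lookup (line v w t) i)"
  unfolding line_def lookup_add lookup_scale
  by (intro polyfun_add polyfun_mult polyfun_const polyfun_id)

lemma nonzero_lookup: "v \<noteq> 0 \<Longrightarrow> \<exists>i. Poly_Mapping.lookup v i \<noteq> 0"
  by (metis lookup_zero poly_mapping_eqI)

lemma finite_vector_zeros:
  fixes u :: "'k::field \<Rightarrow> 'i \<Rightarrow>\<^sub>0 'k"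
  assumes "\<And>i. polyfun (\<lambda>t. Poly_Mapping.lookup (u t) i)" "u s \<noteq> 0"
  shows "finite {t. u t = 0}"
proof -
  obtain i where "Poly_Mapping.lookup (u s) i \<noteq> 0" using nonzero_lookup[OF assms(2)] by blast
  from polyfun_finite_zeros[OF assms(1) this] show ?thesis
    by (rule rev_finite_subset) auto
qed

text \<open>On the line joining two points, a polynomial that is nonzero at one of them vanishes at finitely
  many parameters only.\<close>

lemma irreducible_closure:
  fixes u :: "('i \<Rightarrow>\<^sub>0 'k::field_char_0) \<Rightarrow> ('j \<Rightarrow>\<^sub>0 'k)"
  assumes ne: "A \<noteq> {}" and u: "\<And>v. v \<in> A \<Longrightarrow> u v \<noteq> 0 \<and> Poly_Mapping.keys (u v) \<subseteq> J"
    and pf: "\<And>v w i. v \<in> A \<Longrightarrow> w \<in> A \<Longrightarrow> polyfun (\<lambda>t. Poly_Mapping.lookup (u (line v w t)) i)"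
    and fin: "\<And>v w. v \<in> A \<Longrightarrow> w \<in> A \<Longrightarrow> finite {t. line v w t \<notin> A}"
  shows "irreducible_in (zariski J) (zariski J closure_of ((\<lambda>v. proj_point (u v)) ` A))"
proof -
  let ?X = "(\<lambda>v. proj_point (u v)) ` A"
  have sub: "?X \<subseteq> topspace (zariski J)"
    using u by (auto simp: topspace_zariski intro!: proj_point_in_space)
  show ?thesis
    unfolding irreducible_in_def
  proof (intro conjI allI impI)
    show "zariski J closure_of ?X \<noteq> {}" using ne closure_of_subset[OF sub] by auto
    show "zariski J closure_of ?X \<subseteq> topspace (zariski J)" by (rule closure_of_subset_topspace)
    fix B C assume BC: "closedin (zariski J) B \<and> closedin (zariski J) C \<and> zariski J closure_of ?X \<subseteq> B \<union> C"
    have "?X \<subseteq> B \<or> ?X \<subseteq> C"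
    proof (rule ccontr)
      assume "\<not> ?thesis"
      then obtain v w where vw: "v \<in> A" "w \<in> A" "proj_point (u v) \<notin> B" "proj_point (u w) \<notin> C" by auto
      obtain S T where S: "S \<subseteq> (\<Union>e. forms J e)" "B = zero_locus J S" and T: "T \<subseteq> (\<Union>e. forms J e)" "C = zero_locus J T"
        using BC by (auto simp: closedin_zariski)
      obtain F where F: "F \<in> S" "mpoly_at F (u v) \<noteq> 0"
        using vw u zero_locus_proj_point[OF S(1)] S(2) by blast
      obtain H where H: "H \<in> T" "mpoly_at H (u w) \<noteq> 0"
        using vw u zero_locus_proj_point[OF T(1)] T(2) by blast
      let ?c = "line v w"
      have "finite {t. mpoly_at F (u (?c t)) = 0}"
        by (rule polyfun_finite_zeros[of _ 0]) (simp_all add: polyfun_mpoly_at pf vw line_0 F)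
      moreover have "finite {t. mpoly_at H (u (?c t)) = 0}"
        by (rule polyfun_finite_zeros[of _ 1]) (simp_all add: polyfun_mpoly_at pf vw line_1 H)
      ultimately have bad: "finite ({t. mpoly_at F (u (?c t)) = 0} \<union> {t. mpoly_at H (u (?c t)) = 0} \<union> {t. ?c t \<notin> A})"
        using fin[OF vw(1,2)] by simp
      obtain t where "t \<notin> {t. mpoly_at F (u (?c t)) = 0} \<union> {t. mpoly_at H (u (?c t)) = 0} \<union> {t. ?c t \<notin> A}"
        using ex_new_if_finite[OF infinite_UNIV_char_0 bad] by (rule exE)
      then have t: "mpoly_at F (u (?c t)) \<noteq> 0" "mpoly_at H (u (?c t)) \<noteq> 0" "?c t \<in> A" by simp_all
      have "proj_point (u (?c t)) \<in> zariski J closure_of ?X"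
        using closure_of_subset[OF sub] t(3) by (rule subsetD[OF _ imageI])
      moreover have "proj_point (u (?c t)) \<notin> B" "proj_point (u (?c t)) \<notin> C"
        unfolding S(2) T(2) using u[OF t(3)] zero_locus_proj_point[OF S(1), of "u (?c t)"]
          zero_locus_proj_point[OF T(1), of "u (?c t)"] F(1) H(1) t(1,2) by blast+
      ultimately show False using BC by blast
    qed
    then show "zariski J closure_of ?X \<subseteq> B \<or> zariski J closure_of ?X \<subseteq> C"
      using BC closure_of_minimal by metis
  qed
qed

lemma proj_space_variety:
  fixes I :: "'i set"
  assumes "finite I" "I \<noteq> {}"
  shows "proj_variety I (proj_space I :: ('i, 'k::field_char_0) point set)"
proof -
  let ?A = "{v :: 'i \<Rightarrow>\<^sub>0 'k. v \<noteq> 0 \<and> Poly_Mapping.keys v \<subseteq> I}"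
  have eq: "(\<lambda>v. proj_point v) ` ?A = proj_space I" by (auto simp: proj_space_def)
  obtain i where i: "i \<in> I" using assms(2) by blast
  have "irreducible_in (zariski I) (zariski I closure_of ((\<lambda>v. proj_point v) ` ?A))"
  proof (rule irreducible_closure[where u = "\<lambda>v. v"])
    have "Poly_Mapping.single i (1::'k) \<in> ?A"
      using i by simp (metis lookup_single_eq lookup_zero zero_neq_one)
    then show "?A \<noteq> {}" by blast
    fix v w :: "'i \<Rightarrow>\<^sub>0 'k" assume vw: "v \<in> ?A" "w \<in> ?A"
    have "finite {t. line v w t = 0}"
      by (rule finite_vector_zeros[of _ 0]) (use vw in \<open>simp_all add: polyfun_line line_0\<close>)
    then show "finite {t. line v w t \<notin> ?A}"
      by (rule rev_finite_subset) (use line_keys[of v I w] vw in auto)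
  qed (simp_all add: polyfun_line)
  then have "irreducible_in (zariski I) (zariski I closure_of (proj_space I :: ('i, 'k) point set))"
    by (simp only: eq)
  moreover have "zariski I closure_of (proj_space I) = (proj_space I :: ('i, 'k) point set)"
    by (metis closure_of_topspace topspace_zariski)
  ultimately show ?thesis
    unfolding proj_variety_def using assms(1) by (metis closedin_topspace topspace_zariski)
qed

lemma sum_single_superset:
  assumes "finite J" "Poly_Mapping.keys u \<subseteq> J"
  shows "(\<Sum>j\<in>J. Poly_Mapping.single j (Poly_Mapping.lookup u j)) = u"
proof -
  have "(\<Sum>j\<in>J. Poly_Mapping.single j (Poly_Mapping.lookup u j)) = (\<Sum>j\<in>Poly_Mapping.keys u. Poly_Mapping.single j (Poly_Mapping.lookup u j))"
    by (rule sum.mono_neutral_right) (use assms in \<open>auto simp: in_keys_iff\<close>)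
  then show ?thesis by (simp add: sum_single_keys)
qed

lemma proportional_point:
  fixes u y :: "'i \<Rightarrow>\<^sub>0 'k::field"
  assumes "u \<noteq> 0" "y \<noteq> 0" and eq: "\<And>m n. Poly_Mapping.lookup u n * Poly_Mapping.lookup y m = Poly_Mapping.lookup u m * Poly_Mapping.lookup y n"
  shows "proj_point u = proj_point y"
proof -
  obtain m where m: "Poly_Mapping.lookup y m \<noteq> 0" using nonzero_lookup[OF assms(2)] by blast
  define c where "c = Poly_Mapping.lookup u m / Poly_Mapping.lookup y m"
  have u: "u = Poly_Mapping.map ((*) c) y"
    by (rule poly_mapping_eqI) (use eq[of _ m] m in \<open>simp add: lookup_scale c_def field_simps\<close>)
  have "c \<noteq> 0"
  proof
    assume "c = 0"
    then have "u = 0" unfolding u by (intro poly_mapping_eqI) (simp add: lookup_scale)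
    then show False using assms(1) by simp
  qed
  then show ?thesis unfolding u by (rule proj_point_scale)
qed

section \<open>The Hessian map as a rational map\<close>

definition hess_form :: "nat \<Rightarrow> nat \<Rightarrow> (nat \<Rightarrow>\<^sub>0 nat, 'k::field) mpoly" where
  "hess_form d n = Poly_Mapping.single 0 ((of_nat d - 1) / 2) * hess_quad d (gen_form d) n"

lemma gen_form_forms: "i \<le> d \<Longrightarrow> gen_form d i \<in> forms (form_coords d 1) 1"
  unfolding gen_form_def form_coords_1 by (intro mpoly_var_forms) simp

lemma hess_form_forms: "hess_form d n \<in> forms (form_coords d 1) 2"
  unfolding hess_form_def using hess_polar_forms[OF gen_form_forms gen_form_forms]
  by (intro forms_scale) (simp add: numeral_2_eq_2)

locale hessian_degree =
  fixes d :: nat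
  assumes d: "d \<ge> 5"
begin

lemma hess_form_at:
  fixes v :: "(nat, 'k::field_char_0) mpoly"
  assumes "Poly_Mapping.keys v \<subseteq> form_coords d 1" "n \<le> 2 * d - 4"
  shows "mpoly_at (hess_form d n) v = Poly_Mapping.lookup (hess v) (form_mon (2 * d - 4) n)"
  using hess_quad_gen_form[OF assms(1) _ assms(2)] d
  by (simp add: hess_form_def mpoly_at_mult mpoly_at_const)

lemma hess_keys:
  "Poly_Mapping.keys (v :: (nat, 'k::field) mpoly) \<subseteq> form_coords d 1 \<Longrightarrow> Poly_Mapping.keys (hess v) \<subseteq> form_coords (2 * d - 4) 1"
  using d by (intro hess_forms) auto

lemma hess_nonzero_iff:
  fixes v :: "(nat, 'k::field_char_0) mpoly"
  assumes "Poly_Mapping.keys v \<subseteq> form_coords d 1"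
  shows "hess v \<noteq> 0 \<longleftrightarrow> (\<exists>n\<le>2 * d - 4. mpoly_at (hess_form d n) v \<noteq> 0)"
proof
  assume "hess v \<noteq> 0"
  then obtain m where m: "Poly_Mapping.lookup (hess v) m \<noteq> 0" using nonzero_lookup by blast
  then have "m \<in> form_coords (2 * d - 4) 1" using hess_keys[OF assms] by (auto simp: in_keys_iff)
  then obtain n where "n \<le> 2 * d - 4" "m = form_mon (2 * d - 4) n" unfolding form_coords_1 by auto
  then show "\<exists>n\<le>2 * d - 4. mpoly_at (hess_form d n) v \<noteq> 0" using m hess_form_at[OF assms] by auto
next
  assume "\<exists>n\<le>2 * d - 4. mpoly_at (hess_form d n) v \<noteq> 0"
  then show "hess v \<noteq> 0" using hess_form_at[OF assms] by auto
qed

lemma polyfun_hess: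
  fixes v w :: "(nat, 'k::field_char_0) mpoly"
  assumes "Poly_Mapping.keys v \<subseteq> form_coords d 1" "Poly_Mapping.keys w \<subseteq> form_coords d 1"
  shows "polyfun (\<lambda>t. Poly_Mapping.lookup (hess (line v w t)) m)"
proof (cases "m \<in> form_coords (2 * d - 4) 1")
  case True
  then obtain n where n: "n \<le> 2 * d - 4" "m = form_mon (2 * d - 4) n" unfolding form_coords_1 by auto
  have "polyfun (\<lambda>t. mpoly_at (hess_form d n) (line v w t))" by (intro polyfun_mpoly_at polyfun_line)
  then show ?thesis unfolding n(2) by (simp only: hess_form_at[OF line_keys[OF assms] n(1)])
next
  case False
  then have "Poly_Mapping.lookup (hess (line v w t)) m = 0" for t
    using hess_keys[OF line_keys[OF assms]] by (meson in_keys_iff subsetD)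
  then show ?thesis by (simp add: polyfun_const)
qed

lemma hess_zero: "hess (0 :: (nat, 'k::field) mpoly) = 0"
  by (simp add: hess_def pdiff_def)

lemma hessian_domain_iff:
  fixes v :: "(nat, 'k::field) mpoly"
  assumes "v \<noteq> 0" "Poly_Mapping.keys v \<subseteq> form_coords d 1"
  shows "proj_point v \<in> hessian_domain d \<longleftrightarrow> hess v \<noteq> 0"
proof
  assume "proj_point v \<in> hessian_domain d"
  then show "hess v \<noteq> 0" using proj_point_self[of v] by (auto simp: hessian_domain_def)
next
  assume h: "hess v \<noteq> 0"
  have "hess f \<noteq> 0" if f: "f \<in> proj_point v" for f
  proof -
    obtain c where c: "c \<noteq> 0" "f = Poly_Mapping.map ((*) c) v" using proj_pointD[OF f] by blast
    have "Poly_Mapping.keys (hess f) = Poly_Mapping.keys (hess v)"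
      unfolding c(2) hess_scale[OF c(1)] using c(1) by (simp add: keys_scale)
    then show ?thesis using h by (metis keys_eq_empty)
  qed
  then show "proj_point v \<in> hessian_domain d"
    using proj_point_in_space[OF assms] by (auto simp: hessian_domain_def Sigma_space_def)
qed

text \<open>The cone over the domain of the Hessian map. The density arguments run along lines,
  which live in the vector space.\<close>

definition hess_dom :: "(nat, 'k::field) mpoly set" where
  "hess_dom = {v. Poly_Mapping.keys v \<subseteq> form_coords d 1 \<and> hess v \<noteq> 0}"

lemma hess_dom_nonzero: "v \<in> hess_dom \<Longrightarrow> v \<noteq> 0"
  by (auto simp: hess_dom_def hess_zero)

lemma hessian_domain_image: "hessian_domain d = proj_point ` hess_dom"
proof (intro subset_antisym subsetI)
  fix p :: "(nat \<Rightarrow>\<^sub>0 nat, 'k::field) point" assume p: "p \<in> hessian_domain d"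
  then have "p \<in> proj_space (form_coords d 1)" by (simp add: hessian_domain_def Sigma_space_def)
  then obtain v where v: "p = proj_point v" "v \<noteq> 0" "Poly_Mapping.keys v \<subseteq> form_coords d 1"
    by (rule proj_spaceE)
  then show "p \<in> proj_point ` hess_dom" using p hessian_domain_iff by (auto simp: hess_dom_def)
next
  fix p :: "(nat \<Rightarrow>\<^sub>0 nat, 'k::field) point" assume "p \<in> proj_point ` hess_dom"
  then show "p \<in> hessian_domain d" using hessian_domain_iff hess_dom_nonzero by (auto simp: hess_dom_def)
qed

lemma hessian_image: "hessian_map ` hessian_domain d = (\<lambda>v. proj_point (hess v)) ` hess_dom"
  unfolding hessian_domain_image image_image hessian_map_proj_point ..

lemma special_form_poly_hess_dom: "special_form_poly d \<in> (hess_dom :: (nat, 'k::field_char_0) mpoly set)"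
proof -
  have n: "2 * special_exp d - 2 \<le> 2 * d - 4" using special_exp_bounds[OF d] by linarith
  have "hess_quad d (\<lambda>i. Poly_Mapping.lookup (special_form_poly d) (form_mon d i)) (2 * special_exp d - 2) = (hess_quad d (special_form d) (2 * special_exp d - 2) :: 'k)"
    by (rule hess_polar_cong) (simp_all add: special_form_poly_lookup)
  also have "\<dots> \<noteq> 0"
    using hess_weight_special_exp_nonzero[OF d] special_exp_bounds[OF d] by (simp add: hess_quad_special_form_special_exp[OF d])
  finally have "(of_nat d - 1) * hess_quad d (\<lambda>i. Poly_Mapping.lookup (special_form_poly d) (form_mon d i)) (2 * special_exp d - 2) \<noteq> (0::'k)"
    using d of_nat_eq_iff[of d 1, where 'a = 'k] by simp
  moreover have "2 * Poly_Mapping.lookup (hess (special_form_poly d :: (nat, 'k) mpoly)) (form_mon (2 * d - 4) (2 * special_exp d - 2)) =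
      (of_nat d - 1) * hess_quad d (\<lambda>i. Poly_Mapping.lookup (special_form_poly d) (form_mon d i)) (2 * special_exp d - 2)"
    by (rule lookup_hess[OF special_form_poly_keys _ n]) (use d in simp)
  ultimately have "hess (special_form_poly d) \<noteq> (0 :: (nat, 'k) mpoly)" by auto
  then show ?thesis unfolding hess_dom_def using special_form_poly_keys by blast
qed

lemma hess_dom_line:
  assumes "v \<in> hess_dom" "w \<in> (hess_dom :: (nat, 'k::field_char_0) mpoly set)"
  shows "finite {t. line v w t \<notin> hess_dom}"
proof -
  have vw: "Poly_Mapping.keys v \<subseteq> form_coords d 1" "Poly_Mapping.keys w \<subseteq> form_coords d 1" "hess v \<noteq> 0"
    using assms by (auto simp: hess_dom_def)
  have "finite {t. hess (line v w t) = 0}"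
    by (rule finite_vector_zeros[of _ 0]) (use vw in \<open>simp_all only: polyfun_hess line_0 not_False_eq_True\<close>)
  then show ?thesis
    by (rule rev_finite_subset) (use line_keys[OF vw(1,2)] in \<open>auto simp: hess_dom_def\<close>)
qed

definition hess_closure :: "(nat \<Rightarrow>\<^sub>0 nat, 'k::field) point set" where
  "hess_closure = zariski (form_coords (2 * d - 4) 1) closure_of (hessian_map ` hessian_domain d)"

lemma hess_point:
  "v \<in> hess_dom \<Longrightarrow> proj_point (hess v) \<in> proj_space (form_coords (2 * d - 4) 1)"
  unfolding hess_dom_def using hess_keys proj_point_in_space by blast

lemma hessian_image_closure: "hessian_map ` hessian_domain d \<subseteq> hess_closure"
  unfolding hess_closure_def
  by (rule closure_of_subset) (unfold hessian_image topspace_zariski, use hess_point in blast)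

lemma hess_closure_variety:
  "proj_variety (form_coords (2 * d - 4) 1) (hess_closure :: (nat \<Rightarrow>\<^sub>0 nat, 'k::field_char_0) point set)"
  unfolding proj_variety_def
proof (intro conjI)
  show "finite (form_coords (2 * d - 4) 1)" by (rule finite_form_coords)
  show "closedin (zariski (form_coords (2 * d - 4) 1)) (hess_closure :: (nat \<Rightarrow>\<^sub>0 nat, 'k) point set)"
    unfolding hess_closure_def by (rule closedin_closure_of)
  show "irreducible_in (zariski (form_coords (2 * d - 4) 1)) (hess_closure :: (nat \<Rightarrow>\<^sub>0 nat, 'k) point set)"
    unfolding hess_closure_def hessian_image
  proof (rule irreducible_closure)
    show "hess_dom \<noteq> ({} :: (nat, 'k) mpoly set)" using special_form_poly_hess_dom by blast
    show "hess v \<noteq> 0 \<and> Poly_Mapping.keys (hess v) \<subseteq> form_coords (2 * d - 4) 1"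
      if "v \<in> hess_dom" for v :: "(nat, 'k) mpoly"
      using that hess_keys unfolding hess_dom_def by blast
    show "polyfun (\<lambda>t. Poly_Mapping.lookup (hess (line v w t)) i)"
      if "v \<in> hess_dom" "w \<in> hess_dom" for v w :: "(nat, 'k) mpoly" and i
      using that by (intro polyfun_hess) (auto simp: hess_dom_def)
  qed (rule hess_dom_line)
qed

text \<open>The target is left open because it is once the closure of the image and once the whole
  projective space.\<close>

lemma hessian_rational:
  assumes Y: "proj_variety (form_coords (2 * d - 4) 1) Y" "hessian_map ` hessian_domain d \<subseteq> Y"
  shows "rational_map (form_coords d 1) (proj_space (form_coords d 1) :: (nat \<Rightarrow>\<^sub>0 nat, 'k::field_char_0) point set)
    (form_coords (2 * d - 4) 1) Y (hessian_domain d) hessian_map"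
  unfolding rational_map_def
proof (intro conjI Y)
  let ?I = "form_coords d 1" and ?J = "form_coords (2 * d - 4) 1"
  let ?U = "hessian_domain d :: (nat \<Rightarrow>\<^sub>0 nat, 'k) point set"
  have "form_mon d 0 \<in> ?I" unfolding form_coords_1 by (rule image_eqI[where x = 0]) simp_all
  then show "proj_variety ?I (proj_space ?I :: (nat \<Rightarrow>\<^sub>0 nat, 'k) point set)"
    by (intro proj_space_variety finite_form_coords) blast
  show "?U \<noteq> {}" unfolding hessian_domain_image using special_form_poly_hess_dom by blast
  let ?S = "hess_form d ` {..2 * d - 4} :: (nat \<Rightarrow>\<^sub>0 nat, 'k) mpoly set"
  have S: "?S \<subseteq> (\<Union>e. forms ?I e)" using hess_form_forms by blast
  have U: "?U = proj_space ?I - zero_locus ?I ?S"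
  proof (intro set_eqI)
    fix p :: "(nat \<Rightarrow>\<^sub>0 nat, 'k) point"
    show "p \<in> ?U \<longleftrightarrow> p \<in> proj_space ?I - zero_locus ?I ?S"
    proof (cases "p \<in> proj_space ?I")
      case True
      then obtain v where v: "p = proj_point v" "v \<noteq> 0" "Poly_Mapping.keys v \<subseteq> ?I"
        by (rule proj_spaceE)
      show ?thesis
        using True unfolding v(1) hessian_domain_iff[OF v(2,3)] hess_nonzero_iff[OF v(3)]
          Diff_iff zero_locus_proj_point[OF S v(2,3)] by auto
    qed (simp add: hessian_domain_def Sigma_space_def)
  qed
  have "openin (zariski ?I) ?U" unfolding openin_zariski using S U by blast
  moreover have "?U \<subseteq> proj_space ?I" unfolding U by blast
  ultimately show "openin (subtopology (zariski ?I) (proj_space ?I)) ?U"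
    by (metis inf.absorb1 openin_subtopology)
  show "regular_map ?I ?U ?J hessian_map"
    unfolding regular_map_def
  proof (rule ballI, rule exI[of _ ?U], intro conjI)
    fix p assume p: "p \<in> ?U"
    show "openin (subtopology (zariski ?I) ?U) ?U"
      using \<open>?U \<subseteq> proj_space ?I\<close> by (simp add: openin_subtopology_refl topspace_zariski)
    show "p \<in> ?U" by (rule p)
    define F where "F j = (hess_form d (Poly_Mapping.lookup j 0) :: (nat \<Rightarrow>\<^sub>0 nat, 'k) mpoly)" for j :: "nat \<Rightarrow>\<^sub>0 nat"
    have at: "mpoly_at (F j) v = Poly_Mapping.lookup (hess v) j"
      if "j \<in> ?J" "Poly_Mapping.keys v \<subseteq> ?I" for j v
      using that(1) hess_form_at[OF that(2)] unfolding form_coords_1 by (auto simp: F_def lookup_bimon)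
    have "(\<exists>j\<in>?J. mpoly_at (F j) v \<noteq> 0) \<and>
        hessian_map q = proj_point (\<Sum>j\<in>?J. Poly_Mapping.single j (mpoly_at (F j) v))"
      if q: "q \<in> ?U" "v \<in> q" for q v
    proof -
      have "q \<in> proj_space ?I" using q(1) \<open>?U \<subseteq> proj_space ?I\<close> by blast
      note v = proj_space_point[OF this q(2)]
      have h: "hess v \<noteq> 0" using q(1) hessian_domain_iff[OF v(2,3)] v(1) by simp
      have "(\<Sum>j\<in>?J. Poly_Mapping.single j (mpoly_at (F j) v)) =
          (\<Sum>j\<in>?J. Poly_Mapping.single j (Poly_Mapping.lookup (hess v) j))"
        by (rule sum.cong[OF refl]) (simp only: at[OF _ v(3)])
      also have "\<dots> = hess v"
        by (rule sum_single_superset[OF finite_form_coords hess_keys[OF v(3)]])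
      finally have sum: "(\<Sum>j\<in>?J. Poly_Mapping.single j (mpoly_at (F j) v)) = hess v" .
      have "\<exists>j\<in>?J. mpoly_at (F j) v \<noteq> 0"
      proof (rule ccontr)
        assume "\<not> ?thesis"
        then have "(\<Sum>j\<in>?J. Poly_Mapping.single j (mpoly_at (F j) v)) = 0" by (intro sum.neutral) auto
        then show False using sum h by simp
      qed
      then show ?thesis unfolding sum v(1) hessian_map_proj_point by simp
    qed
    moreover have "\<forall>j\<in>?J. F j \<in> forms ?I 2" unfolding F_def by (intro ballI hess_form_forms)
    ultimately show "\<exists>e F. (\<forall>j\<in>?J. F j \<in> forms ?I e) \<and> (\<forall>q\<in>?U. \<forall>v\<in>q. (\<exists>j\<in>?J. mpoly_at (F j) v \<noteq> 0) \<and>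
        hessian_map q = proj_point (\<Sum>j\<in>?J. Poly_Mapping.single j (mpoly_at (F j) v)))"
      by blast
  qed
qed

end

section \<open>The inverse rational map\<close>

context hessian_degree
begin

lemma inverse_map_point:
  fixes F :: "nat \<Rightarrow> (nat \<Rightarrow>\<^sub>0 nat, 'k::field) mpoly"
  assumes "\<And>i. i \<le> d \<Longrightarrow> F i \<in> forms J e" "c \<noteq> 0"
  shows "(\<Sum>i\<le>d. Poly_Mapping.single (form_mon d i) (mpoly_at (F i) (Poly_Mapping.map ((*) c) y))) =
    Poly_Mapping.map ((*) (c ^ e)) (\<Sum>i\<le>d. Poly_Mapping.single (form_mon d i) (mpoly_at (F i) y))"
proof (rule poly_mapping_eqI)
  fix m
  show "Poly_Mapping.lookup (\<Sum>i\<le>d. Poly_Mapping.single (form_mon d i) (mpoly_at (F i) (Poly_Mapping.map ((*) c) y))) m =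
    Poly_Mapping.lookup (Poly_Mapping.map ((*) (c ^ e)) (\<Sum>i\<le>d. Poly_Mapping.single (form_mon d i) (mpoly_at (F i) y))) m"
    unfolding lookup_scale lookup_sum lookup_single when_def sum_distrib_left
    by (intro sum.cong refl) (simp add: mpoly_at_scale[OF assms(1)])
qed

theorem birational:
  "birational_onto_image (form_coords d 1) (proj_space (form_coords d 1) :: (nat \<Rightarrow>\<^sub>0 nat, 'k::{alg_closed_field, field_char_0}) point set)
     (form_coords (2 * d - 4) 1) (proj_space (form_coords (2 * d - 4) 1)) (hessian_domain d) hessian_map"
proof -
  let ?I = "form_coords d 1" and ?J = "form_coords (2 * d - 4) 1"
  let ?X = "proj_space ?I :: (nat \<Rightarrow>\<^sub>0 nat, 'k) point set"
  let ?U = "hessian_domain d :: (nat \<Rightarrow>\<^sub>0 nat, 'k) point set"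
  let ?Y = "hess_closure :: (nat \<Rightarrow>\<^sub>0 nat, 'k) point set"
  let ?D = "hess_dom :: (nat, 'k) mpoly set"
  define a where "a = special_exp d"
  have a: "a \<le> d" using special_exp_bounds[OF d] by (simp add: a_def)
  obtain e and F :: "nat \<Rightarrow> (nat \<Rightarrow>\<^sub>0 nat, 'k) mpoly" where F: "\<And>i. i \<le> d \<Longrightarrow> F i \<in> forms ?J e"
    and F0: "mpoly_at (F a) (hess (special_form_poly d)) \<noteq> 0"
    and inv: "\<And>v i. Poly_Mapping.keys v \<subseteq> ?I \<Longrightarrow> i \<le> d \<Longrightarrow>
      Poly_Mapping.lookup v (form_mon d i) * mpoly_at (F a) (hess v) =
      Poly_Mapping.lookup v (form_mon d a) * mpoly_at (F i) (hess v)"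
    using hessian_inverse_forms[OF d, where 'k = 'k] unfolding a_def by blast
  \<comment> \<open>The inverse on coordinate vectors. Its coordinate of index a is
    \<open>F a\<close>, so it is nonzero wherever \<open>F a\<close> is.\<close>
  define R where "R y = (\<Sum>i\<le>d. Poly_Mapping.single (form_mon d i) (mpoly_at (F i) y))" for y
  have R_lookup: "Poly_Mapping.lookup (R y) (form_mon d i) = mpoly_at (F i) y" if "i \<le> d" for y i
    unfolding R_def by (rule sum_single_lookup[OF that])
  have R_keys: "Poly_Mapping.keys (R y) \<subseteq> ?I" for y
    unfolding R_def by (rule sum_single_keys_subset)
  have R_nonzero: "R y \<noteq> 0" if "mpoly_at (F a) y \<noteq> 0" for y
    using R_lookup[OF a, of y] that by auto
  define V where "V = {q \<in> ?Y. \<forall>y\<in>q. mpoly_at (F a) y \<noteq> 0}"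
  define h where "h q = proj_point (R (SOME y. y \<in> q))" for q
  have h_point: "h (proj_point y) = proj_point (R y)" for y
  proof -
    have "(SOME z. z \<in> proj_point y) \<in> proj_point y" using proj_point_self by (rule someI)
    then obtain c where c: "c \<noteq> 0" "(SOME z. z \<in> proj_point y) = Poly_Mapping.map ((*) c) y"
      using proj_pointD by blast
    have "R (Poly_Mapping.map ((*) c) y) = Poly_Mapping.map ((*) (c ^ e)) (R y)"
      unfolding R_def by (rule inverse_map_point[OF F c(1)])
    then show ?thesis using c by (simp add: h_def proj_point_scale)
  qed
  have Ysub: "?Y \<subseteq> proj_space ?J"
    unfolding hess_closure_def using closure_of_subset_topspace topspace_zariski by metis
  have V_iff: "proj_point y \<in> V \<longleftrightarrow> proj_point y \<in> ?Y \<and> mpoly_at (F a) y \<noteq> 0" for y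
    unfolding V_def using mpoly_at_proj_point[OF F[OF a]] proj_point_self[of y] by blast
  have recover: "proj_point (R (hess v)) = proj_point v \<and> (\<exists>c. c \<noteq> 0 \<and> R (hess v) = Poly_Mapping.map ((*) c) v)"
    if v: "v \<in> ?D" and nz: "mpoly_at (F a) (hess v) \<noteq> 0" for v
  proof -
    have kv: "Poly_Mapping.keys v \<subseteq> ?I" using v unfolding hess_dom_def by blast
    \<comment> \<open>If this coefficient were 0, \<open>inv\<close> would force all coefficients of
      \<open>v\<close> to vanish.\<close>
    have va: "Poly_Mapping.lookup v (form_mon d a) \<noteq> 0"
    proof
      assume z: "Poly_Mapping.lookup v (form_mon d a) = 0"
      have "Poly_Mapping.lookup v (form_mon d i) = 0" if "i \<le> d" for i
        using inv[OF kv that] z nz by simp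
      then have "v = 0" by (subst form_as_sum[OF kv]) (simp add: sum.neutral)
      then show False using hess_dom_nonzero[OF v] by simp
    qed
    define c where "c = mpoly_at (F a) (hess v) / Poly_Mapping.lookup v (form_mon d a)"
    have c: "c \<noteq> 0" using va nz by (simp add: c_def)
    have "R (hess v) = Poly_Mapping.map ((*) c) v"
    proof (rule poly_mapping_eqI)
      fix m
      show "Poly_Mapping.lookup (R (hess v)) m = Poly_Mapping.lookup (Poly_Mapping.map ((*) c) v) m"
      proof (cases "m \<in> ?I")
        case True
        then obtain i where i: "i \<le> d" "m = form_mon d i" unfolding form_coords_1 by auto
        show ?thesis
          unfolding i(2) R_lookup[OF i(1)] lookup_scale
          using inv[OF kv i(1)] va by (simp add: c_def field_simps)
      next
        case False
        then have "Poly_Mapping.lookup (R (hess v)) m = 0" "Poly_Mapping.lookup v m = 0"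
          using R_keys kv by (meson in_keys_iff subsetD)+
        then show ?thesis by (simp add: lookup_scale)
      qed
    qed
    then show ?thesis using c proj_point_scale[OF c] by metis
  qed
  have FaS: "{F a} \<subseteq> (\<Union>e. forms ?J e)" using F[OF a] by blast
  have openV: "openin (subtopology (zariski ?J) ?Y) V"
  proof -
    have "V = (proj_space ?J - zero_locus ?J {F a}) \<inter> ?Y"
    proof (intro set_eqI)
      fix q :: "(nat \<Rightarrow>\<^sub>0 nat, 'k) point"
      show "q \<in> V \<longleftrightarrow> q \<in> (proj_space ?J - zero_locus ?J {F a}) \<inter> ?Y"
      proof (cases "q \<in> ?Y")
        case True
        then have "q \<in> proj_space ?J" using Ysub by blast
        then obtain y where y: "q = proj_point y" "y \<noteq> 0" "Poly_Mapping.keys y \<subseteq> ?J"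
          by (rule proj_spaceE)
        show ?thesis
          using True \<open>q \<in> proj_space ?J\<close>
          unfolding y(1) V_iff Int_iff Diff_iff zero_locus_proj_point[OF FaS y(2,3)] by blast
      qed (simp add: V_def)
    qed
    moreover have "openin (zariski ?J) (proj_space ?J - zero_locus ?J {F a})"
      unfolding openin_zariski using FaS by blast
    ultimately show ?thesis unfolding openin_subtopology by blast
  qed
  have in_V: "proj_point (hess v) \<in> V" if "v \<in> ?D" "mpoly_at (F a) (hess v) \<noteq> 0" for v
    unfolding V_iff using that hessian_image_closure unfolding hessian_image by blast
  have VX: "h ` V \<subseteq> ?X"
  proof
    fix p assume "p \<in> h ` V"
    then obtain q where q: "q \<in> V" "p = h q" by blast
    then have "q \<in> proj_space ?J" using Ysub unfolding V_def by blast
    then obtain y where y: "q = proj_point y" by (rule proj_spaceE)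
    have "mpoly_at (F a) y \<noteq> 0" using q(1) unfolding y V_iff by blast
    then show "p \<in> ?X" unfolding q(2) y h_point by (intro proj_point_in_space R_nonzero R_keys)
  qed
  have regular: "regular_map ?J V ?I h"
    unfolding regular_map_def
  proof (rule ballI, rule exI[of _ V], intro conjI)
    fix p assume p: "p \<in> V"
    show "p \<in> V" by (rule p)
    have "V \<subseteq> topspace (zariski ?J)" using Ysub unfolding topspace_zariski V_def by blast
    then show "openin (subtopology (zariski ?J) V) V" by (simp only: openin_subtopology_refl)
    define F' where "F' j = F (Poly_Mapping.lookup j 0)" for j :: "nat \<Rightarrow>\<^sub>0 nat"
    have F': "F' (form_mon d i) = F i" for i by (simp add: F'_def lookup_bimon)
    have "\<forall>j\<in>?I. F' j \<in> forms ?J e"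
      unfolding form_coords_1[of d] using F by (auto simp only: F' atMost_iff)
    moreover have "(\<exists>j\<in>?I. mpoly_at (F' j) v \<noteq> 0) \<and>
        h q = proj_point (\<Sum>j\<in>?I. Poly_Mapping.single j (mpoly_at (F' j) v))"
      if q: "q \<in> V" "v \<in> q" for q v
    proof -
      have "q \<in> proj_space ?J" using q(1) Ysub unfolding V_def by blast
      then have qv: "q = proj_point v" using proj_space_point(1)[OF _ q(2)] by blast
      have "mpoly_at (F' (form_mon d a)) v \<noteq> 0" unfolding F' using q(1) unfolding qv V_iff by blast
      moreover have "form_mon d a \<in> ?I" unfolding form_coords_1 using a by blast
      moreover have "(\<Sum>j\<in>?I. Poly_Mapping.single j (mpoly_at (F' j) v)) = R v"
        unfolding form_coords_1 sum.reindex[OF inj_mono] R_def by (simp only: o_def F')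
      ultimately show ?thesis unfolding qv h_point by auto
    qed
    ultimately show "\<exists>e F. (\<forall>j\<in>?I. F j \<in> forms ?J e) \<and> (\<forall>q\<in>V. \<forall>v\<in>q. (\<exists>j\<in>?I. mpoly_at (F j) v \<noteq> 0) \<and>
        h q = proj_point (\<Sum>j\<in>?I. Poly_Mapping.single j (mpoly_at (F j) v)))"
      by blast
  qed
  have I0: "form_mon n 0 \<in> form_coords n 1" for n
    unfolding form_coords_1 by (rule image_eqI[where x = 0]) simp_all
  have varX: "proj_variety ?I ?X" and varJ: "proj_variety ?J (proj_space ?J :: (nat \<Rightarrow>\<^sub>0 nat, 'k) point set)"
    using I0 by (intro proj_space_variety finite_form_coords; blast)+
  have hess_special_form: "hess (special_form_poly d :: (nat, 'k) mpoly) \<noteq> 0"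
    using special_form_poly_hess_dom unfolding hess_dom_def by blast
  have V_ne: "V \<noteq> {}" using in_V[OF special_form_poly_hess_dom F0] by blast
  have rat_h: "rational_map ?J ?Y ?I ?X V h"
    unfolding rational_map_def by (intro conjI hess_closure_variety varX openV V_ne VX regular)
  have dense: "zariski ?I closure_of (h ` V) = ?X"
  proof
    show "zariski ?I closure_of (h ` V) \<subseteq> ?X"
      using closure_of_subset_topspace topspace_zariski by metis
    show "?X \<subseteq> zariski ?I closure_of (h ` V)"
    proof
      fix p assume "p \<in> ?X"
      then obtain w where w: "p = proj_point w" "w \<noteq> 0" "Poly_Mapping.keys w \<subseteq> ?I"
        by (rule proj_spaceE)
      obtain S where S: "S \<subseteq> (\<Union>e. forms ?I e)" "zariski ?I closure_of (h ` V) = zero_locus ?I S"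
        using closedin_closure_of[of "zariski ?I" "h ` V"] unfolding closedin_zariski by blast
      have sub: "h ` V \<subseteq> zero_locus ?I S"
        unfolding S(2)[symmetric] by (rule closure_of_subset) (use VX in \<open>simp only: topspace_zariski\<close>)
      have "mpoly_at H w = 0" if H: "H \<in> S" for H
      proof (rule ccontr)
        assume nz: "mpoly_at H w \<noteq> 0"
        \<comment> \<open>A form vanishing on the image of \<open>h\<close> is tested on the line
          from \<open>w\<close> to the special form: all but finitely many of its points are
          recovered from their Hessians, hence represent points of that image.\<close>
        let ?c = "line w (special_form_poly d)"
        note k = line_keys[OF w(3) special_form_poly_keys]
        have "finite {t. mpoly_at H (?c t) = 0}"
          by (rule polyfun_finite_zeros[of _ 0]) (simp_all add: polyfun_mpoly_at polyfun_line line_0 nz)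
        moreover have "finite {t. mpoly_at (F a) (hess (?c t)) = 0}"
          by (rule polyfun_finite_zeros[of _ 1])
             (use polyfun_mpoly_at[OF polyfun_hess[OF w(3) special_form_poly_keys]] F0 in \<open>simp_all add: line_1\<close>)
        moreover have "finite {t. hess (?c t) = 0}"
          by (intro finite_vector_zeros[of _ 1] polyfun_hess[OF w(3) special_form_poly_keys]) (simp add: line_1 hess_special_form)
        ultimately have bad: "finite ({t. mpoly_at H (?c t) = 0} \<union> {t. mpoly_at (F a) (hess (?c t)) = 0} \<union> {t. hess (?c t) = 0})"
          by blast
        obtain t where "t \<notin> {t. mpoly_at H (?c t) = 0} \<union> {t. mpoly_at (F a) (hess (?c t)) = 0} \<union> {t. hess (?c t) = 0}"
          using ex_new_if_finite[OF infinite_UNIV_char_0 bad] by (rule exE)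
        then have t: "mpoly_at H (?c t) \<noteq> 0" "mpoly_at (F a) (hess (?c t)) \<noteq> 0" "hess (?c t) \<noteq> 0" by simp_all
        have cD: "?c t \<in> ?D" unfolding hess_dom_def using t(3) k[of t] by blast
        have "h (proj_point (hess (?c t))) \<in> zero_locus ?I S" using in_V[OF cD t(2)] sub by blast
        then have "proj_point (?c t) \<in> zero_locus ?I S" using recover[OF cD t(2)] by (simp only: h_point)
        then show False
          using zero_locus_proj_point[OF S(1) hess_dom_nonzero[OF cD] k] H t(1) by blast
      qed
      then show "p \<in> zariski ?I closure_of (h ` V)"
        unfolding S(2) w(1) zero_locus_proj_point[OF S(1) w(2,3)] by blast
    qed
  qed
  have left: "h (hessian_map p) = p" if p: "p \<in> ?U" "hessian_map p \<in> V" for p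
  proof -
    obtain v where v: "v \<in> ?D" "p = proj_point v" using p(1) unfolding hessian_domain_image by blast
    have "mpoly_at (F a) (hess v) \<noteq> 0"
      using p(2) unfolding v(2) hessian_map_proj_point V_iff by blast
    then show ?thesis
      unfolding v(2) hessian_map_proj_point h_point using recover[OF v(1)] by blast
  qed
  \<comment> \<open>The coefficients of \<open>hess (R y)\<close> as forms in \<open>y\<close>. The
    identity \<open>hessian_map (h q) = q\<close> is claimed on all of \<open>V\<close>, which may
    contain points of the closure that are not Hessians, so it is derived from equations that extend
    to the closure.\<close>
  define HR where "HR n = Poly_Mapping.single 0 ((of_nat d - 1) / 2) * hess_quad d F n" for n
  have HR: "mpoly_at (HR n) y = Poly_Mapping.lookup (hess (R y)) (form_mon (2 * d - 4) n)" if "n \<le> 2 * d - 4" for n y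
  proof -
    have "mpoly_at (HR n) y = ((of_nat d - 1) / 2) * hess_quad d (\<lambda>i. mpoly_at (F i) y) n"
      by (simp add: HR_def mpoly_at_mult mpoly_at_const mpoly_at_hess_polar)
    also have "hess_quad d (\<lambda>i. mpoly_at (F i) y) n = hess_quad d (\<lambda>i. Poly_Mapping.lookup (R y) (form_mon d i)) n"
      by (rule hess_polar_cong) (simp_all only: R_lookup)
    finally have "2 * mpoly_at (HR n) y = (of_nat d - 1) * hess_quad d (\<lambda>i. Poly_Mapping.lookup (R y) (form_mon d i)) n"
      by (simp add: mult.commute)
    also have "\<dots> = 2 * Poly_Mapping.lookup (hess (R y)) (form_mon (2 * d - 4) n)"
      by (rule lookup_hess[OF R_keys _ that, symmetric]) (use d in simp)
    finally show ?thesis by simp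
  qed
  \<comment> \<open>The 2 x 2 minors expressing that \<open>hess (R y)\<close> and \<open>y\<close>
    are proportional. The factor \<open>F a\<close> makes them vanish on the whole image, including
    those Hessians from which \<open>R\<close> need not recover the form.\<close>
  define \<Psi> where "\<Psi> m n = F a * (HR m * mpoly_var (form_mon (2 * d - 4) n) - HR n * mpoly_var (form_mon (2 * d - 4) m))" for m n
  define S where "S = {\<Psi> m n |m n. m \<le> 2 * d - 4 \<and> n \<le> 2 * d - 4}"
  have \<Psi>_at: "mpoly_at (\<Psi> m n) y = mpoly_at (F a) y *
      (Poly_Mapping.lookup (hess (R y)) (form_mon (2 * d - 4) m) * Poly_Mapping.lookup y (form_mon (2 * d - 4) n)
      - Poly_Mapping.lookup (hess (R y)) (form_mon (2 * d - 4) n) * Poly_Mapping.lookup y (form_mon (2 * d - 4) m))"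
    if "m \<le> 2 * d - 4" "n \<le> 2 * d - 4" for m n y
    by (simp only: \<Psi>_def mpoly_at_mult mpoly_at_diff HR[OF that(1)] HR[OF that(2)] mpoly_at_mpoly_var)
  have S_forms: "S \<subseteq> (\<Union>e. forms ?J e)"
  proof -
    have HRf: "HR n \<in> forms ?J (e + e)" for n
      unfolding HR_def by (intro forms_scale hess_polar_forms F)
    have var: "mpoly_var (form_mon (2 * d - 4) n) \<in> forms ?J 1" if "n \<le> 2 * d - 4" for n
      unfolding form_coords_1 using that by (intro mpoly_var_forms) blast
    have "\<Psi> m n \<in> forms ?J (e + (e + e + 1))" if "m \<le> 2 * d - 4" "n \<le> 2 * d - 4" for m n
      unfolding \<Psi>_def by (intro forms_mult forms_diff F a HRf var that)
    then show ?thesis unfolding S_def by blast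
  qed
  have S_van: "?Y \<subseteq> zero_locus ?J S"
    unfolding hess_closure_def
  proof (rule closure_of_minimal)
    show "closedin (zariski ?J) (zero_locus ?J S)" unfolding closedin_zariski using S_forms by blast
    show "hessian_map ` ?U \<subseteq> zero_locus ?J S"
      unfolding hessian_image
    proof (rule image_subsetI)
      fix v assume v: "v \<in> ?D"
      have kv: "Poly_Mapping.keys v \<subseteq> ?I" "hess v \<noteq> 0" using v unfolding hess_dom_def by blast+
      have vanish: "mpoly_at (\<Psi> m n) (hess v) = 0" if mn: "m \<le> 2 * d - 4" "n \<le> 2 * d - 4" for m n
      proof (cases "mpoly_at (F a) (hess v) = 0")
        case False
        then obtain c where c: "c \<noteq> 0" "R (hess v) = Poly_Mapping.map ((*) c) v"
          using recover[OF v] by blast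
        show ?thesis unfolding \<Psi>_at[OF mn] c(2) hess_scale[OF c(1)] lookup_scale by simp
      qed (simp add: \<Psi>_at[OF mn])
      have "\<forall>P\<in>S. mpoly_at P (hess v) = 0"
      proof
        fix P assume "P \<in> S"
        then obtain m n where mn: "P = \<Psi> m n" "m \<le> 2 * d - 4" "n \<le> 2 * d - 4" unfolding S_def by blast
        show "mpoly_at P (hess v) = 0" unfolding mn(1) by (rule vanish[OF mn(2,3)])
      qed
      then show "proj_point (hess v) \<in> zero_locus ?J S"
        by (simp only: zero_locus_proj_point[OF S_forms kv(2) hess_keys[OF kv(1)]])
    qed
  qed
  have right: "hessian_map (h q) = q" if q: "q \<in> V" "h q \<in> ?U" for q
  proof -
    have qY: "q \<in> ?Y" using q(1) unfolding V_def by blast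
    then have "q \<in> proj_space ?J" using Ysub by blast
    then obtain y where y: "q = proj_point y" "y \<noteq> 0" "Poly_Mapping.keys y \<subseteq> ?J"
      by (rule proj_spaceE)
    have Fa: "mpoly_at (F a) y \<noteq> 0" using q(1) unfolding y(1) V_iff by blast
    have "hess (R y) \<noteq> 0"
      using q(2) unfolding y(1) h_point hessian_domain_iff[OF R_nonzero[OF Fa] R_keys] .
    moreover have "Poly_Mapping.lookup (hess (R y)) n * Poly_Mapping.lookup y m =
        Poly_Mapping.lookup (hess (R y)) m * Poly_Mapping.lookup y n" for m n
    proof (cases "m \<in> ?J \<and> n \<in> ?J")
      case True
      then obtain m' n' where mn: "m' \<le> 2 * d - 4" "m = form_mon (2 * d - 4) m'" "n' \<le> 2 * d - 4" "n = form_mon (2 * d - 4) n'"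
        unfolding form_coords_1 by auto
      have "\<Psi> n' m' \<in> S" unfolding S_def using mn by blast
      moreover have "proj_point y \<in> zero_locus ?J S" using S_van qY unfolding y(1) by blast
      ultimately have "mpoly_at (\<Psi> n' m') y = 0"
        unfolding zero_locus_proj_point[OF S_forms y(2,3)] by blast
      then show ?thesis using Fa unfolding \<Psi>_at[OF mn(3,1)] mn(2,4) by simp
    next
      case False
      then have "Poly_Mapping.lookup (hess (R y)) m = 0 \<and> Poly_Mapping.lookup y m = 0 \<or>
          Poly_Mapping.lookup (hess (R y)) n = 0 \<and> Poly_Mapping.lookup y n = 0"
        using hess_keys[OF R_keys] y(3) by (meson in_keys_iff subsetD)
      then show ?thesis by auto
    qed
    ultimately show ?thesis
      unfolding y(1) h_point hessian_map_proj_point by (intro proportional_point y(2))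
  qed
  have imgJ: "hessian_map ` ?U \<subseteq> proj_space ?J" using hessian_image_closure Ysub by blast
  have "dominant_map ?J ?Y ?I ?X V h" unfolding dominant_map_def using rat_h dense by blast
  moreover have "dominant_map ?I ?X ?J ?Y ?U hessian_map"
    unfolding dominant_map_def
    using hessian_rational[OF hess_closure_variety hessian_image_closure] hess_closure_def by blast
  ultimately have "birational_map ?I ?X ?J ?Y ?U hessian_map"
    unfolding birational_map_def using left right by blast
  moreover have "rational_map ?I ?X ?J (proj_space ?J) ?U hessian_map"
    by (rule hessian_rational[OF varJ imgJ])
  ultimately show ?thesis unfolding birational_onto_image_def hess_closure_def by blast
qed

end

theorem theorem2p8:
  fixes d :: nat
  assumes "d \<ge> 5"
  shows "birational_onto_image
           (form_coords d 1) (Sigma_space d 1 :: (nat \<Rightarrow>\<^sub>0 nat, 'k::{alg_closed_field, field_char_0}) point set)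
           (form_coords (2 * d - 4) 1) (Sigma_space (2 * d - 4) 1)
           (hessian_domain d) hessian_map"
proof -
  interpret hessian_degree d by standard (fact assms)
  show ?thesis unfolding Sigma_space_def by (rule birational)
qed

end
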